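(* Let $\mathbf{k}$ be a field with $\mathrm{char}(\mathbf{k})\neq 2$, and let $r$ be the cardinality of $\mathbf{k}^*/(\mathbf{k}^* )^2$. Then there are exactly $26+4r$ isomorphism classes of $6$-dimensional minimal algebras over $\mathbf{k}$ generated in degree $1$.
   Context: A minimal algebra over $\mathbf{k}$ generated in degree $1$ of dimension $n$ is a commutative differential graded algebra $(\wedge V,d)$ where $V$ is an $n$-dimensional $\mathbf{k}$-vector space concentrated in degree $1$ (so $\wedge V$ is the exterior algebra on $V$), $d$ is a degree $+1$ derivation with $d^2=0$, and there is a basis $x_1,\dots,x_n$ of $V$ with $dx_i\in\wedge^2\langle x_1,\dots,x_{i-1}\rangle$ for all $i$. Isomorphism means isomorphism of differential graded algebras over $\mathbf{k}$. *)

theory Defs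
  imports Main
begin

text \<open>Concrete model of the exterior algebra on an n-dimensional space V = k^n,
 with basis e_0,...,e_{n-1} in degree 1.  An element of the exterior algebra is a
 function assigning to each finite set S of indices the coefficient of
 e_S = e_{s_1} ... e_{s_p} (s_1 < ... < s_p); elements of the exterior algebra on
 k^n are those supported on subsets of {0..<n}.\<close>

definition ext_elems :: "nat \<Rightarrow> (nat set \<Rightarrow> 'k::field) set" where
  "ext_elems n = {f. \<forall>S. f S \<noteq> 0 \<longrightarrow> S \<subseteq> {..<n}}"

definition ext_homog :: "nat \<Rightarrow> nat \<Rightarrow> (nat set \<Rightarrow> 'k::field) \<Rightarrow> bool" where
  "ext_homog n p f \<longleftrightarrow> f \<in> ext_elems n \<and> (\<forall>S. f S \<noteq> 0 \<longrightarrow> card S = p)"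

text \<open>Sign of e_A e_B relative to e_{A \<union> B} (A, B disjoint): number of inversions.\<close>
definition ext_sign :: "nat set \<Rightarrow> nat set \<Rightarrow> 'k::field" where
  "ext_sign A B = (-1) ^ card {(a, b). a \<in> A \<and> b \<in> B \<and> b < a}"

definition ext_mult :: "(nat set \<Rightarrow> 'k::field) \<Rightarrow> (nat set \<Rightarrow> 'k) \<Rightarrow> nat set \<Rightarrow> 'k" where
  "ext_mult f g S = (if finite S then (\<Sum>A\<in>Pow S. ext_sign A (S - A) * f A * g (S - A)) else 0)"

definition ext_one :: "nat set \<Rightarrow> 'k::field" where
  "ext_one S = (if S = {} then 1 else 0)"

definition is_dga :: "nat \<Rightarrow> ((nat set \<Rightarrow> 'k::field) \<Rightarrow> (nat set \<Rightarrow> 'k)) \<Rightarrow> bool" where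
  "is_dga n d \<longleftrightarrow>
     (\<forall>f\<in>ext_elems n. d f \<in> ext_elems n) \<and>
     (\<forall>f\<in>ext_elems n. \<forall>g\<in>ext_elems n. \<forall>c.
        d (\<lambda>S. c * f S + g S) = (\<lambda>S. c * d f S + d g S)) \<and>
     (\<forall>p f. ext_homog n p f \<longrightarrow> ext_homog n (p + 1) (d f)) \<and>
     (\<forall>p a b. ext_homog n p a \<and> b \<in> ext_elems n \<longrightarrow>
        d (ext_mult a b) = (\<lambda>S. ext_mult (d a) b S + (-1) ^ p * ext_mult a (d b) S)) \<and>
     (\<forall>f\<in>ext_elems n. d (d f) = (\<lambda>S. 0))"

definition minimal_alg :: "nat \<Rightarrow> ((nat set \<Rightarrow> 'k::field) \<Rightarrow> (nat set \<Rightarrow> 'k)) \<Rightarrow> bool" where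
  "minimal_alg n d \<longleftrightarrow> is_dga n d \<and>
     (\<exists>x :: nat \<Rightarrow> nat set \<Rightarrow> 'k.
        (\<forall>i<n. ext_homog n 1 (x i)) \<and>
        (\<forall>c. (\<lambda>S. \<Sum>i<n. c i * x i S) = (\<lambda>S. 0) \<longrightarrow> (\<forall>i<n. c i = 0)) \<and>
        (\<forall>v. ext_homog n 1 v \<longrightarrow> (\<exists>c. v = (\<lambda>S. \<Sum>i<n. c i * x i S))) \<and>
        (\<forall>i<n. \<exists>c :: nat \<Rightarrow> nat \<Rightarrow> 'k.
            d (x i) = (\<lambda>S. \<Sum>j<i. \<Sum>l<i. c j l * ext_mult (x j) (x l) S)))"

definition dga_iso :: "nat \<Rightarrow> ((nat set \<Rightarrow> 'k::field) \<Rightarrow> (nat set \<Rightarrow> 'k))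
                        \<Rightarrow> ((nat set \<Rightarrow> 'k) \<Rightarrow> (nat set \<Rightarrow> 'k)) \<Rightarrow> bool" where
  "dga_iso n d1 d2 \<longleftrightarrow> (\<exists>\<phi>.
     bij_betw \<phi> (ext_elems n) (ext_elems n) \<and>
     (\<forall>f\<in>ext_elems n. \<forall>g\<in>ext_elems n. \<forall>c.
        \<phi> (\<lambda>S. c * f S + g S) = (\<lambda>S. c * \<phi> f S + \<phi> g S)) \<and>
     (\<forall>p f. ext_homog n p f \<longrightarrow> ext_homog n p (\<phi> f)) \<and>
     \<phi> ext_one = ext_one \<and>
     (\<forall>a\<in>ext_elems n. \<forall>b\<in>ext_elems n. \<phi> (ext_mult a b) = ext_mult (\<phi> a) (\<phi> b)) \<and>
     (\<forall>f\<in>ext_elems n. \<phi> (d1 f) = d2 (\<phi> f)))"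

definition minimal_iso_classes :: "'k::field itself \<Rightarrow> nat \<Rightarrow> ((nat set \<Rightarrow> 'k) \<Rightarrow> (nat set \<Rightarrow> 'k)) set set" where
  "minimal_iso_classes _ n =
     {d. minimal_alg n d} // {(d1, d2). minimal_alg n d1 \<and> minimal_alg n d2 \<and> dga_iso n d1 d2}"

definition square_classes :: "'k::field itself \<Rightarrow> 'k set set" where
  "square_classes _ = {x :: 'k. x \<noteq> 0} //
      {(a, b). a \<noteq> 0 \<and> b \<noteq> 0 \<and> (\<exists>c. c \<noteq> 0 \<and> a = c ^ 2 * b)}"

end

theory Submission
  imports Defs
begin

text \<open>The transpose of the differential on the generators of a minimal algebra is a nilpotent Lie bracket on the
  dual of \<open>V\<close>, every nilpotent bracket arises in this way, and isomorphisms correspond contravariantly.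

  In dimension six the coordinates of a bracket are normalised one after the other along a flag, which leads to
  26 forms \<open>normal_form k \<epsilon>\<close>; the parameter \<open>\<epsilon>\<close> occurs only for the last four values of \<open>k\<close>. Conversely, an
  isomorphism of brackets preserves the filtration \<open>W\<^sub>i\<^sub>+\<^sub>1 = {x. dx \<in> \<Lambda>\<^sup>2W\<^sub>i}\<close>, so its matrix is block triangular.
  Comparing the leading coefficients distinguishes the forms; in the four families they determine \<open>\<epsilon>\<close>, the
  discriminant of a binary quadratic form, up to multiplication by a nonzero square. With \<open>r\<close> square classes, each family
  contributes one class for \<open>\<epsilon> = 0\<close> and \<open>r\<close> classes for \<open>\<epsilon> \<noteq> 0\<close>, hence the total is \<open>22 + 4(1 + r)\<close>.\<close>

section \<open>Brackets in coordinates\<close>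

text \<open>The characteristic enters through quadratic algebra: completing squares in the
  coefficients of dx_5, diagonalising a hyperbolic form by a sum and a difference, and recovering a
  Pfaffian from its polarization. The parameter has two sources. In forms 22 and 24 the
  differentials dx_4 and dx_5 span a pencil of 2-forms in four variables, and the Pfaffian of a dx_4
  + b dx_5 is a^2 - \<epsilon> b^2. Form 22 is the single relation dz = xy over k[t]/(t^2 -
  \<epsilon>), with x = x_1 + t x_0, y = x_3 + t x_2 and z = x_5 + t x_4. In forms 23 and 25 the
  differential dx_5 is governed by a symmetric 2 by 2 matrix of determinant \<epsilon>. In all four
  a change of basis acts by congruence and scaling of a binary quadratic form, and both multiply its
  determinant by squares.\<close>

definition unit_vec :: "nat \<Rightarrow> nat \<Rightarrow> 'k::field" where
  "unit_vec p = (\<lambda>i. if i = p then 1 else 0)"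

text \<open>Vectors are total functions on \<open>nat\<close>, so a form on k^n must ignore the
  coordinates from n on; the second clause does this. It also makes \<open>linear_form m\<close>
  with a smaller m the way to say that only the first m coordinates are involved.\<close>

definition linear_form :: "nat \<Rightarrow> ((nat \<Rightarrow> 'k::field) \<Rightarrow> 'k) \<Rightarrow> bool" where
  "linear_form n f \<longleftrightarrow> (\<forall>c u v. f (\<lambda>k. c * u k + v k) = c * f u + f v) \<and>
     (\<forall>u. (\<forall>k<n. u k = 0) \<longrightarrow> f u = 0)"

definition linear_map :: "nat \<Rightarrow> ((nat \<Rightarrow> 'k::field) \<Rightarrow> nat \<Rightarrow> 'k) \<Rightarrow> bool" where
  "linear_map n F \<longleftrightarrow> (\<forall>i<n. linear_form n (\<lambda>u. F u i))"

definition injective_map :: "nat \<Rightarrow> ((nat \<Rightarrow> 'k::field) \<Rightarrow> nat \<Rightarrow> 'k) \<Rightarrow> bool" where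
  "injective_map n F \<longleftrightarrow> (\<forall>u. (\<forall>i<n. F u i = 0) \<longrightarrow> (\<forall>i<n. u i = 0))"

definition alternating :: "nat \<Rightarrow> ((nat \<Rightarrow> 'k::field) \<Rightarrow> (nat \<Rightarrow> 'k) \<Rightarrow> 'k) \<Rightarrow> bool" where
  "alternating n \<omega> \<longleftrightarrow> (\<forall>v. linear_form n (\<lambda>u. \<omega> u v)) \<and> (\<forall>u v. \<omega> v u = - \<omega> u v) \<and> (\<forall>u. \<omega> u u = 0)"

type_synonym 'k bracket = "(nat \<Rightarrow> 'k) \<Rightarrow> (nat \<Rightarrow> 'k) \<Rightarrow> nat \<Rightarrow> 'k"

definition jacobi :: "nat \<Rightarrow> 'k::field bracket \<Rightarrow> bool" where
  "jacobi n \<beta> \<longleftrightarrow> (\<forall>u v w. \<forall>i<n. \<beta> (\<beta> u v) w i + \<beta> (\<beta> v w) u i + \<beta> (\<beta> w u) v i = 0)"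

definition bracket :: "nat \<Rightarrow> 'k::field bracket \<Rightarrow> bool" where
  "bracket n \<beta> \<longleftrightarrow> (\<forall>i<n. alternating n (\<lambda>u v. \<beta> u v i))"

text \<open>In coordinates adapted to a flag of ideals, the \<open>i\<close>-th coordinate of a bracket depends only
  on the coordinates below \<open>i\<close>; this is the dual of \<open>dx\<^sub>i \<in> \<Lambda>\<^sup>2\<langle>x\<^sub>0, \<dots>, x\<^sub>i\<^sub>-\<^sub>1\<rangle>\<close>.\<close>
definition nilpotent :: "nat \<Rightarrow> 'k::field bracket \<Rightarrow> bool" where
  "nilpotent n \<beta> \<longleftrightarrow> jacobi n \<beta> \<and> (\<forall>i<n. alternating i (\<lambda>u v. \<beta> u v i))"

definition lie_hom :: "nat \<Rightarrow> ((nat \<Rightarrow> 'k::field) \<Rightarrow> nat \<Rightarrow> 'k) \<Rightarrow> 'k bracket \<Rightarrow> 'k bracket \<Rightarrow> bool" where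
  "lie_hom n F \<beta> \<beta>' \<longleftrightarrow> (\<forall>u v. \<forall>i<n. F (\<beta> u v) i = \<beta>' (F u) (F v) i)"

definition lie_iso :: "nat \<Rightarrow> 'k::field bracket \<Rightarrow> 'k bracket \<Rightarrow> bool" where
  "lie_iso n \<beta> \<beta>' \<longleftrightarrow> (\<exists>F. linear_map n F \<and> injective_map n F \<and> lie_hom n F \<beta> \<beta>')"

section \<open>Linear forms and invertible linear maps\<close>

lemma linear_formD:
  assumes "linear_form n f"
  shows "f (\<lambda>k. c * u k + v k) = c * f u + f v" "(\<And>k. k < n \<Longrightarrow> u k = 0) \<Longrightarrow> f u = 0"
  using assms by (auto simp: linear_form_def)

lemma linear_form_add: "linear_form n f \<Longrightarrow> f (\<lambda>k. u k + v k) = f u + f v"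
  using linear_formD(1)[of n f 1 u v] by simp

lemma linear_form_scale: "linear_form n f \<Longrightarrow> f (\<lambda>k. c * u k) = c * f u"
  using linear_formD(1)[of n f c u "\<lambda>_. 0"] linear_formD(2)[of n f "\<lambda>_. 0"] by simp

lemma linear_form_minus: "linear_form n f \<Longrightarrow> f (\<lambda>k. - u k) = - f u"
  using linear_form_scale[of n f "-1" u] by simp

lemma linear_form_cong:
  assumes "linear_form n f" "\<And>k. k < n \<Longrightarrow> u k = v k"
  shows "f u = f v"
proof -
  have "f (\<lambda>k. (-1) * u k + v k) = 0"
    by (rule linear_formD(2)[OF assms(1)]) (simp add: assms(2))
  then show ?thesis unfolding linear_formD(1)[OF assms(1)] by simp
qed

lemma linear_form_mono: "linear_form m f \<Longrightarrow> m \<le> n \<Longrightarrow> linear_form n f"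
  unfolding linear_form_def by auto

lemma linear_form_expand:
  assumes f: "linear_form n f"
  shows "f u = (\<Sum>j<n. u j * f (unit_vec j))"
proof -
  have "f (\<lambda>k. if k < m then u k else 0) = (\<Sum>j<m. u j * f (unit_vec j))" for m
  proof (induction m)
    case 0
    show ?case using linear_formD(2)[OF f] by simp
  next
    case (Suc m)
    have "(\<lambda>k. if k < Suc m then u k else 0) = (\<lambda>k. u m * unit_vec m k + (if k < m then u k else 0))"
      by (auto simp: unit_vec_def fun_eq_iff less_Suc_eq)
    then show ?case using Suc linear_formD(1)[OF f] by simp
  qed
  moreover have "f u = f (\<lambda>k. if k < n then u k else 0)"
    by (rule linear_form_cong[OF f]) simp
  ultimately show ?thesis by simp
qed

lemma linear_form_sum:
  assumes f: "linear_form n f" and "finite A"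
  shows "f (\<lambda>k. \<Sum>a\<in>A. g a k) = (\<Sum>a\<in>A. f (g a))"
  using assms(2)
proof (induction A rule: finite_induct)
  case empty
  show ?case using linear_formD(2)[OF f] by simp
next
  case (insert x A)
  then show ?case by (simp add: linear_form_add[OF f])
qed

lemma linear_form_lin_comb: "linear_form n (\<lambda>u. \<Sum>j<n. c j * u j)"
  by (auto simp: linear_form_def sum.distrib sum_distrib_left algebra_simps)

text \<open>Gaussian elimination by induction on the number of equations. This is the dimension
  count behind the inverses of injective maps and the comparison of filtration dimensions.\<close>

lemma underdetermined_system:
  fixes A :: "'i \<Rightarrow> nat \<Rightarrow> 'k::field"
  assumes "finite I" "q < card I"
  shows "\<exists>c. (\<exists>i\<in>I. c i \<noteq> 0) \<and> (\<forall>j<q. (\<Sum>i\<in>I. c i * A i j) = 0)"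
  using assms
proof (induction q arbitrary: I A)
  case 0
  then have "\<exists>i. i \<in> I" by (metis card.empty less_irrefl ex_in_conv)
  then show ?case by (intro exI[of _ "\<lambda>_. 1"]) auto
next
  case (Suc q)
  show ?case
  proof (cases "\<forall>i\<in>I. A i q = 0")
    case True
    obtain c where "\<exists>i\<in>I. c i \<noteq> 0" "\<forall>j<q. (\<Sum>i\<in>I. c i * A i j) = 0"
      using Suc.IH[of I A] Suc.prems by auto
    then show ?thesis using True by (intro exI[of _ c]) (auto simp: less_Suc_eq)
  next
    case False
    then obtain r where r: "r \<in> I" "A r q \<noteq> 0" by auto
    \<comment> \<open>Pivot on the unknown r: \<open>B i q\<close> is 0, so the reduced system has
      one equation less, and the value at r is then chosen to satisfy equation q.\<close>
    define B where "B i j = A i j - A i q / A r q * A r j" for i j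
    have "q < card (I - {r})" using Suc.prems r by (simp add: card_Diff_singleton)
    then obtain c where c: "\<exists>i\<in>I - {r}. c i \<noteq> 0" "\<forall>j<q. (\<Sum>i\<in>I - {r}. c i * B i j) = 0"
      using Suc.IH[of "I - {r}" B] Suc.prems by auto
    define s where "s = (\<Sum>i\<in>I - {r}. c i * A i q)"
    define c' where "c' = c(r := - s / A r q)"
    have eq: "(\<Sum>i\<in>I. c' i * A i j) = (\<Sum>i\<in>I - {r}. c i * A i j) - s / A r q * A r j" for j
    proof -
      have "(\<Sum>i\<in>I. c' i * A i j) = c' r * A r j + (\<Sum>i\<in>I - {r}. c' i * A i j)"
        using r Suc.prems by (simp add: sum.remove)
      also have "(\<Sum>i\<in>I - {r}. c' i * A i j) = (\<Sum>i\<in>I - {r}. c i * A i j)"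
        by (rule sum.cong) (auto simp: c'_def)
      finally show ?thesis by (simp add: c'_def)
    qed
    have "(\<Sum>i\<in>I - {r}. c i * B i j) = (\<Sum>i\<in>I - {r}. c i * A i j) - s / A r q * A r j" for j
      by (simp add: B_def s_def sum_subtractf right_diff_distrib sum_distrib_right sum_divide_distrib
          mult.assoc)
    then have "(\<Sum>i\<in>I. c' i * A i j) = 0" if "j < Suc q" for j
      using that c(2) r(2) unfolding eq by (cases "j = q") (auto simp: s_def less_Suc_eq)
    moreover have "\<exists>i\<in>I. c' i \<noteq> 0" using c(1) by (auto simp: c'_def)
    ultimately show ?thesis by blast
  qed
qed

text \<open>The n + 1 vectors F e_0, ..., F e_(n-1), e_k of k^n are dependent, and injectivity
  forces a nonzero coefficient at e_k, so each e_k lies in the image. Preimages of the unit vectors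
  are the columns of the inverse.\<close>

lemma injective_map_inverse:
  fixes F :: "(nat \<Rightarrow> 'k::field) \<Rightarrow> nat \<Rightarrow> 'k"
  assumes F: "linear_map n F" "injective_map n F"
  obtains G where "linear_map n G" "injective_map n G" "\<And>u i. i < n \<Longrightarrow> F (G u) i = u i"
    "\<And>u i. i < n \<Longrightarrow> G (F u) i = u i"
proof -
  have lin: "linear_form n (\<lambda>u. F u i)" if "i < n" for i
    using F(1) that by (simp add: linear_map_def)
  have "\<exists>x. \<forall>i<n. F x i = unit_vec k i" if "k < n" for k
  proof -
    define A where "A i j = (if i < n then F (unit_vec i) j else unit_vec k j)" for i j
    obtain c where c: "\<exists>i\<in>{..n}. c i \<noteq> 0" "\<forall>j<n. (\<Sum>i\<in>{..n}. c i * A i j) = 0"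
      using underdetermined_system[of "{..n}" n A] by auto
    have eq: "F c j + c n * unit_vec k j = 0" if "j < n" for j
    proof -
      have "(\<Sum>i\<in>{..n}. c i * A i j) = (\<Sum>i<n. c i * A i j) + c n * A n j"
        by (simp flip: lessThan_Suc_atMost)
      then show ?thesis using c(2) that linear_form_expand[OF lin[OF that], of c]
        by (simp add: A_def)
    qed
    have "c n \<noteq> 0"
    proof
      assume "c n = 0"
      then have "\<forall>i<n. c i = 0" using F(2) eq unfolding injective_map_def by auto
      then show False using c(1) \<open>c n = 0\<close> by (metis atMost_iff le_neq_implies_less)
    qed
    have "F (\<lambda>i. (- 1 / c n) * c i) j = unit_vec k j" if "j < n" for j
    proof -
      have "F c j = - (c n * unit_vec k j)" using eq[OF that] by (simp add: eq_neg_iff_add_eq_0)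
      then show ?thesis unfolding linear_form_scale[OF lin[OF that]] using \<open>c n \<noteq> 0\<close> by simp
    qed
    then show ?thesis by blast
  qed
  then obtain x where x: "\<And>k i. k < n \<Longrightarrow> i < n \<Longrightarrow> F (x k) i = unit_vec k i" by metis
  define G where "G u i = (\<Sum>k<n. x k i * u k)" for u i
  have FG: "F (G u) i = u i" if "i < n" for u i
  proof -
    have "F (G u) i = (\<Sum>k<n. F (\<lambda>i. u k * x k i) i)"
      unfolding G_def using linear_form_sum[OF lin[OF that], of "{..<n}" "\<lambda>k i. x k i * u k"]
      by (simp add: mult.commute)
    also have "\<dots> = (\<Sum>k<n. u k * unit_vec k i)"
      by (rule sum.cong) (auto simp: linear_form_scale[OF lin[OF that]] x that)
    also have "\<dots> = u i" using that by (simp add: unit_vec_def if_distrib cong: if_cong)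
    finally show ?thesis .
  qed
  have GF: "G (F u) i = u i" if "i < n" for u i
  proof -
    have "F (\<lambda>i. (-1) * u i + G (F u) i) j = 0" if "j < n" for j
      unfolding linear_formD(1)[OF lin[OF that]] using FG[OF that, of "F u"] by simp
    then have "- 1 * u i + G (F u) i = 0" using F(2) that unfolding injective_map_def by blast
    then show ?thesis by simp
  qed
  have linG: "linear_map n G"
    unfolding linear_map_def G_def using linear_form_lin_comb by auto
  moreover have "injective_map n G"
    unfolding injective_map_def
  proof (intro allI impI)
    fix u i assume u: "\<forall>i<n. G u i = 0" and i: "i < n"
    show "u i = 0" using FG[OF i, of u] linear_formD(2)[OF lin[OF i], of "G u"] u by simp
  qed
  ultimately show thesis using FG GF that by blast
qed

lemma alternatingD:
  assumes "alternating n \<omega>"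
  shows "linear_form n (\<lambda>u. \<omega> u v)" "linear_form n (\<lambda>v. \<omega> u v)" "\<omega> v u = - \<omega> u v" "\<omega> u u = 0"
proof -
  have l: "linear_form n (\<lambda>u. \<omega> u v)" for v
    using assms unfolding alternating_def by blast
  have a: "\<omega> v u = - \<omega> u v" for u v
    using assms unfolding alternating_def by blast
  show "linear_form n (\<lambda>u. \<omega> u v)" by (rule l)
  show "\<omega> v u = - \<omega> u v" by (rule a)
  show "\<omega> u u = 0" using assms unfolding alternating_def by blast
  have "linear_form n (\<lambda>v. - \<omega> v u)" using l[of u] by (auto simp: linear_form_def)
  moreover have "(\<lambda>v. - \<omega> v u) = \<omega> u" by (rule ext) (rule a[symmetric])
  ultimately show "linear_form n (\<lambda>v. \<omega> u v)" by simp
qed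

lemma sum_square_split:
  fixes f :: "nat \<Rightarrow> nat \<Rightarrow> 'a::comm_monoid_add"
  shows "(\<Sum>p<n. \<Sum>q<n. f p q) = (\<Sum>q<n. f q q + (\<Sum>p<q. f p q + f q p))"
proof (induction n)
  case (Suc n)
  have "(\<Sum>p<Suc n. \<Sum>q<Suc n. f p q) = (\<Sum>p<n. \<Sum>q<n. f p q) + ((\<Sum>p<n. f p n) + ((\<Sum>q<n. f n q) + f n n))"
    by (simp add: sum.distrib ac_simps)
  also have "\<dots> = (\<Sum>p<n. \<Sum>q<n. f p q) + (f n n + (\<Sum>p<n. f p n + f n p))"
    by (simp add: sum.distrib ac_simps)
  finally show ?case using Suc by simp
qed simp

lemma alternating_expand:
  assumes w: "alternating n \<omega>"
  shows "\<omega> u v = (\<Sum>q<n. \<Sum>p<q. \<omega> (unit_vec p) (unit_vec q) * (u p * v q - u q * v p))"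
proof -
  have "\<omega> u v = (\<Sum>p<n. \<Sum>q<n. u p * (v q * \<omega> (unit_vec p) (unit_vec q)))"
    unfolding linear_form_expand[OF alternatingD(1)[OF w], of u v]
    by (subst linear_form_expand[OF alternatingD(2)[OF w]]) (simp add: sum_distrib_left)
  also have "\<dots> = (\<Sum>q<n. \<Sum>p<q. u p * (v q * \<omega> (unit_vec p) (unit_vec q))
      + u q * (v p * \<omega> (unit_vec q) (unit_vec p)))"
    unfolding sum_square_split by (simp add: alternatingD(4)[OF w])
  also have "\<dots> = (\<Sum>q<n. \<Sum>p<q. \<omega> (unit_vec p) (unit_vec q) * (u p * v q - u q * v p))"
  proof (intro sum.cong refl)
    fix p q :: nat
    have "\<omega> (unit_vec q) (unit_vec p) = - \<omega> (unit_vec p) (unit_vec q)" by (rule alternatingD(3)[OF w])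
    then show "u p * (v q * \<omega> (unit_vec p) (unit_vec q)) + u q * (v p * \<omega> (unit_vec q) (unit_vec p))
      = \<omega> (unit_vec p) (unit_vec q) * (u p * v q - u q * v p)" by (simp add: algebra_simps)
  qed
  finally show ?thesis .
qed

lemma alternating_mono: "alternating m \<omega> \<Longrightarrow> m \<le> n \<Longrightarrow> alternating n \<omega>"
  unfolding alternating_def using linear_form_mono by blast

section \<open>Brackets, transport of structure and isomorphism\<close>

lemma nilpotent_imp_bracket: "nilpotent n \<beta> \<Longrightarrow> bracket n \<beta>"
  unfolding nilpotent_def bracket_def by (meson alternating_mono less_imp_le)

lemma bracketD:
  assumes "bracket n \<beta>" "i < n"
  shows "linear_form n (\<lambda>u. \<beta> u v i)" "linear_form n (\<lambda>v. \<beta> u v i)"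
    "\<beta> v u i = - \<beta> u v i" "\<beta> u u i = 0"
proof -
  have a: "alternating n (\<lambda>u v. \<beta> u v i)" using assms by (simp add: bracket_def)
  show "linear_form n (\<lambda>u. \<beta> u v i)" "linear_form n (\<lambda>v. \<beta> u v i)"
    "\<beta> v u i = - \<beta> u v i" "\<beta> u u i = 0"
    by (fact alternatingD[OF a])+
qed

lemma bracket_cong:
  assumes b: "bracket n \<beta>" and i: "i < n"
    and "\<And>k. k < n \<Longrightarrow> u k = u' k" "\<And>k. k < n \<Longrightarrow> v k = v' k"
  shows "\<beta> u v i = \<beta> u' v' i"
  using linear_form_cong[OF bracketD(1)[OF b i], of u u' v]
    linear_form_cong[OF bracketD(2)[OF b i], of v v' u'] assms(3,4) by simp

lemma linear_map_cong:
  assumes "linear_map n F" "i < n" "\<And>k. k < n \<Longrightarrow> u k = v k"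
  shows "F u i = F v i"
proof (rule linear_form_cong[where f = "\<lambda>u. F u i"])
  show "linear_form n (\<lambda>u. F u i)" using assms(1,2) by (simp add: linear_map_def)
qed (rule assms(3))

lemma linear_map_compose:
  fixes F G :: "(nat \<Rightarrow> 'k::field) \<Rightarrow> nat \<Rightarrow> 'k"
  assumes F: "linear_map n F" and G: "linear_map n G"
  shows "linear_map n (\<lambda>u. G (F u))"
  unfolding linear_map_def
proof (intro allI impI)
  fix i assume i: "i < n"
  have Gi: "linear_form n (\<lambda>u. G u i)" using G i by (simp add: linear_map_def)
  have Fk: "linear_form n (\<lambda>u. F u k)" if "k < n" for k using F that by (simp add: linear_map_def)
  show "linear_form n (\<lambda>u. G (F u) i)"
    unfolding linear_form_def
  proof (intro conjI allI impI)
    fix c :: 'k and u v :: "nat \<Rightarrow> 'k"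
    have "G (F (\<lambda>k. c * u k + v k)) i = G (\<lambda>k. c * F u k + F v k) i"
      by (rule linear_form_cong[OF Gi]) (rule linear_formD(1)[OF Fk])
    then show "G (F (\<lambda>k. c * u k + v k)) i = c * G (F u) i + G (F v) i"
      by (simp add: linear_formD(1)[OF Gi])
  next
    fix u :: "nat \<Rightarrow> 'k" assume "\<forall>k<n. u k = 0"
    then show "G (F u) i = 0" using linear_formD(2)[OF Gi] linear_formD(2)[OF Fk] by simp
  qed
qed

lemma lie_iso_refl: "lie_iso n \<beta> \<beta>"
  unfolding lie_iso_def
  by (rule exI[of _ "\<lambda>u. u"])
     (auto simp: linear_map_def linear_form_def injective_map_def lie_hom_def)

lemma lie_iso_trans [trans]:
  assumes "lie_iso n \<beta> \<beta>'" "lie_iso n \<beta>' \<beta>''"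
  shows "lie_iso n \<beta> \<beta>''"
proof -
  obtain F where F: "linear_map n F" "injective_map n F" "lie_hom n F \<beta> \<beta>'"
    using assms(1) by (auto simp: lie_iso_def)
  obtain G where G: "linear_map n G" "injective_map n G" "lie_hom n G \<beta>' \<beta>''"
    using assms(2) by (auto simp: lie_iso_def)
  have "lie_hom n (\<lambda>u. G (F u)) \<beta> \<beta>''"
    unfolding lie_hom_def
  proof (intro allI impI)
    fix u v i assume i: "i < n"
    have "G (F (\<beta> u v)) i = G (\<beta>' (F u) (F v)) i"
      by (rule linear_map_cong[OF G(1) i]) (use F(3) in \<open>simp add: lie_hom_def\<close>)
    then show "G (F (\<beta> u v)) i = \<beta>'' (G (F u)) (G (F v)) i"
      using G(3) i by (simp add: lie_hom_def)
  qed
  moreover have "injective_map n (\<lambda>u. G (F u))"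
    using F(2) G(2) unfolding injective_map_def by blast
  ultimately show ?thesis unfolding lie_iso_def using linear_map_compose[OF F(1) G(1)] by blast
qed

lemma lie_hom_inverse:
  assumes b: "bracket n \<beta>" and F: "linear_map n F" "injective_map n F" "lie_hom n F \<beta> \<beta>'"
    and b': "bracket n \<beta>'" and G: "linear_map n G"
    and FG: "\<And>u i. i < n \<Longrightarrow> F (G u) i = u i" and GF: "\<And>u i. i < n \<Longrightarrow> G (F u) i = u i"
  shows "lie_hom n G \<beta>' \<beta>"
  unfolding lie_hom_def
proof (intro allI impI)
  fix u v i assume i: "i < n"
  have "G (\<beta>' u v) i = G (\<beta>' (F (G u)) (F (G v))) i"
    by (intro linear_map_cong[OF G i] bracket_cong[OF b']) (auto simp: FG)
  also have "\<dots> = G (F (\<beta> (G u) (G v))) i"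
    by (rule linear_map_cong[OF G i]) (use F(3) in \<open>simp add: lie_hom_def\<close>)
  finally show "G (\<beta>' u v) i = \<beta> (G u) (G v) i" by (simp add: GF i)
qed

lemma lie_iso_sym:
  assumes "bracket n \<beta>" "bracket n \<beta>'" "lie_iso n \<beta> \<beta>'"
  shows "lie_iso n \<beta>' \<beta>"
proof -
  obtain F where F: "linear_map n F" "injective_map n F" "lie_hom n F \<beta> \<beta>'"
    using assms(3) by (auto simp: lie_iso_def)
  obtain G where G: "linear_map n G" "injective_map n G" "\<And>u i. i < n \<Longrightarrow> F (G u) i = u i"
    "\<And>u i. i < n \<Longrightarrow> G (F u) i = u i" using injective_map_inverse[OF F(1,2)] by blast
  show ?thesis unfolding lie_iso_def
    using G(1,2) lie_hom_inverse[OF assms(1) F assms(2) G(1,3,4)] by blast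
qed

lemma bracket_post:
  assumes b: "bracket n \<beta>" and F: "linear_map n F"
  shows "bracket n (\<lambda>u v. F (\<beta> u v))"
  unfolding bracket_def alternating_def
proof (intro allI impI conjI)
  fix i u v assume i: "i < n"
  have Fi: "linear_form n (\<lambda>u. F u i)" using F i by (simp add: linear_map_def)
  show "linear_form n (\<lambda>u. F (\<beta> u v) i)"
    unfolding linear_form_def
  proof (intro conjI allI impI)
    fix c :: 'a and u u' :: "nat \<Rightarrow> 'a"
    have "F (\<beta> (\<lambda>k. c * u k + u' k) v) i = F (\<lambda>k. c * \<beta> u v k + \<beta> u' v k) i"
      by (rule linear_map_cong[OF F i]) (rule linear_formD(1)[OF bracketD(1)[OF b]])
    then show "F (\<beta> (\<lambda>k. c * u k + u' k) v) i = c * F (\<beta> u v) i + F (\<beta> u' v) i"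
      by (simp add: linear_formD(1)[OF Fi])
  next
    fix u :: "nat \<Rightarrow> 'a" assume "\<forall>k<n. u k = 0"
    then show "F (\<beta> u v) i = 0" using linear_formD(2)[OF Fi] linear_formD(2)[OF bracketD(1)[OF b]] by simp
  qed
  have "F (\<beta> v u) i = F (\<lambda>k. - \<beta> u v k) i" by (rule linear_map_cong[OF F i]) (rule bracketD(3)[OF b])
  then show "F (\<beta> v u) i = - F (\<beta> u v) i" by (simp add: linear_form_minus[OF Fi])
  show "F (\<beta> u u) i = 0" by (rule linear_formD(2)[OF Fi]) (rule bracketD(4)[OF b])
qed

lemma bracket_pre:
  assumes b: "bracket n \<beta>" and G: "linear_map n G"
  shows "bracket n (\<lambda>u v. \<beta> (G u) (G v))"
  unfolding bracket_def alternating_def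
proof (intro allI impI conjI)
  fix i u v assume i: "i < n"
  have Gk: "linear_form n (\<lambda>u. G u k)" if "k < n" for k using G that by (simp add: linear_map_def)
  show "linear_form n (\<lambda>u. \<beta> (G u) (G v) i)"
    unfolding linear_form_def
  proof (intro conjI allI impI)
    fix c :: 'a and u u' :: "nat \<Rightarrow> 'a"
    have "\<beta> (G (\<lambda>k. c * u k + u' k)) (G v) i = \<beta> (\<lambda>k. c * G u k + G u' k) (G v) i"
      by (rule bracket_cong[OF b i]) (rule linear_formD(1)[OF Gk], simp_all)
    then show "\<beta> (G (\<lambda>k. c * u k + u' k)) (G v) i = c * \<beta> (G u) (G v) i + \<beta> (G u') (G v) i"
      by (simp add: linear_formD(1)[OF bracketD(1)[OF b i]])
  next
    fix u :: "nat \<Rightarrow> 'a" assume "\<forall>k<n. u k = 0"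
    then show "\<beta> (G u) (G v) i = 0"
      using linear_formD(2)[OF Gk] linear_formD(2)[OF bracketD(1)[OF b i]] by simp
  qed
  show "\<beta> (G v) (G u) i = - \<beta> (G u) (G v) i" by (rule bracketD(3)[OF b i])
  show "\<beta> (G u) (G u) i = 0" by (rule bracketD(4)[OF b i])
qed

text \<open>Inside the nested bracket G after F cancels, so the new Jacobi sum is F applied to the
  old one.\<close>

lemma jacobi_transport:
  assumes b: "bracket n \<beta>" and j: "jacobi n \<beta>" and F: "linear_map n F" and G: "linear_map n G"
    and GF: "\<And>u i. i < n \<Longrightarrow> G (F u) i = u i"
  shows "jacobi n (\<lambda>u v. F (\<beta> (G u) (G v)))"
  unfolding jacobi_def
proof (intro allI impI)
  fix u v w i assume i: "i < n"
  have Fi: "linear_form n (\<lambda>u. F u i)" using F i by (simp add: linear_map_def)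
  have t: "F (\<beta> (G (F (\<beta> (G u) (G v)))) (G w)) i = F (\<beta> (\<beta> (G u) (G v)) (G w)) i" for u v w
    by (intro linear_map_cong[OF F i] bracket_cong[OF b]) (simp_all add: GF)
  have "F (\<beta> (\<beta> (G u) (G v)) (G w)) i + F (\<beta> (\<beta> (G v) (G w)) (G u)) i + F (\<beta> (\<beta> (G w) (G u)) (G v)) i
    = F (\<lambda>k. \<beta> (\<beta> (G u) (G v)) (G w) k + \<beta> (\<beta> (G v) (G w)) (G u) k + \<beta> (\<beta> (G w) (G u)) (G v) k) i"
    by (simp add: linear_form_add[OF Fi])
  also have "\<dots> = 0" by (rule linear_formD(2)[OF Fi]) (use j in \<open>simp add: jacobi_def\<close>)
  finally show "F (\<beta> (G (F (\<beta> (G u) (G v)))) (G w)) i + F (\<beta> (G (F (\<beta> (G v) (G w)))) (G u)) i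
    + F (\<beta> (G (F (\<beta> (G w) (G u)))) (G v)) i = 0" unfolding t .
qed

lemma lie_hom_transport:
  assumes b: "bracket n \<beta>" and F: "linear_map n F" and GF: "\<And>u i. i < n \<Longrightarrow> G (F u) i = u i"
  shows "lie_hom n F \<beta> (\<lambda>u v. F (\<beta> (G u) (G v)))"
  unfolding lie_hom_def
  by (intro allI impI linear_map_cong[OF F] bracket_cong[OF b]) (simp_all add: GF)

lemma alternating_unit_eqI:
  assumes "alternating n \<omega>" "alternating n \<omega>'"
    and "\<And>p q. p < q \<Longrightarrow> q < n \<Longrightarrow> \<omega> (unit_vec p) (unit_vec q) = \<omega>' (unit_vec p) (unit_vec q)"
  shows "\<omega> u v = \<omega>' u v"
  unfolding alternating_expand[OF assms(1), of u v] alternating_expand[OF assms(2), of u v]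
  using assms(3) by (intro sum.cong) auto

lemma lie_hom_unitI:
  assumes b: "bracket n \<beta>" and b': "bracket n \<beta>'" and F: "linear_map n F"
    and eq: "\<And>i p q. i < n \<Longrightarrow> p < q \<Longrightarrow> q < n \<Longrightarrow>
      F (\<beta> (unit_vec p) (unit_vec q)) i = \<beta>' (F (unit_vec p)) (F (unit_vec q)) i"
  shows "lie_hom n F \<beta> \<beta>'"
  unfolding lie_hom_def
proof (intro allI impI)
  fix u v i assume i: "i < n"
  show "F (\<beta> u v) i = \<beta>' (F u) (F v) i"
    by (rule alternating_unit_eqI[where n = n and \<omega> = "\<lambda>u v. F (\<beta> u v) i" and \<omega>' = "\<lambda>u v. \<beta>' (F u) (F v) i"])
       (use bracket_post[OF b F] bracket_pre[OF b' F] i eq in \<open>auto simp: bracket_def\<close>)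
qed

text \<open>The Jacobi sum is cyclic, changes sign under a swap and vanishes when two arguments
  agree. It is therefore an alternating trilinear form, determined by increasing triples of unit
  vectors.\<close>

lemma jacobi_unitI:
  fixes \<beta> :: "'k::field bracket"
  assumes b: "bracket n \<beta>"
    and J: "\<And>i p q r. i < n \<Longrightarrow> p < q \<Longrightarrow> q < r \<Longrightarrow> r < n \<Longrightarrow>
      \<beta> (\<beta> (unit_vec p) (unit_vec q)) (unit_vec r) i + \<beta> (\<beta> (unit_vec q) (unit_vec r)) (unit_vec p) i
      + \<beta> (\<beta> (unit_vec r) (unit_vec p)) (unit_vec q) i = 0"
  shows "jacobi n \<beta>"
  unfolding jacobi_def
proof (intro allI impI)
  fix u v w :: "nat \<Rightarrow> 'k" and i assume i: "i < n"
  define T where "T u v w = \<beta> (\<beta> u v) w i + \<beta> (\<beta> v w) u i + \<beta> (\<beta> w u) v i" for u v w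
  have l1: "linear_form n (\<lambda>u. \<beta> u x i)" and l2: "linear_form n (\<lambda>u. \<beta> x u i)" for x
    using bracketD(1,2)[OF b i] .
  have lin: "linear_form n (\<lambda>u. \<beta> (\<beta> u x) y i)" "linear_form n (\<lambda>u. \<beta> (\<beta> x u) y i)" for x y
  proof -
    have 1: "linear_map n (\<lambda>u. \<beta> u x)" "linear_map n (\<lambda>u. \<beta> x u)" "linear_map n (\<lambda>u. \<beta> u y)"
      using bracketD(1,2)[OF b] by (simp_all add: linear_map_def)
    show "linear_form n (\<lambda>u. \<beta> (\<beta> u x) y i)" "linear_form n (\<lambda>u. \<beta> (\<beta> x u) y i)"
      using linear_map_compose[OF 1(1) 1(3)] linear_map_compose[OF 1(2) 1(3)] i by (simp_all add: linear_map_def)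
  qed
  have linT: "linear_form n (\<lambda>u. T u x y)" for x y
    using lin(1)[of x y] l2[of "\<beta> x y"] lin(2)[of y x] unfolding T_def linear_form_def
    by (simp add: algebra_simps)
  have cyc: "T x y z = T y z x" for x y z by (simp add: T_def)
  have swap: "T y x z = - T x y z" for x y z
  proof -
    have n: "\<beta> (\<beta> p q) r i = - \<beta> (\<beta> q p) r i" for p q r
    proof -
      have "\<beta> (\<beta> p q) r i = \<beta> (\<lambda>k. - \<beta> q p k) r i"
        by (rule bracket_cong[OF b i]) (simp_all add: bracketD(3)[OF b, of _ p q])
      then show ?thesis by (simp add: linear_form_minus[OF l1])
    qed
    show ?thesis using n[of y x z] n[of x z y] n[of z y x] by (simp add: T_def)
  qed
  have diag: "T x x z = 0" for x z
  proof -
    have "\<beta> (\<beta> x x) z i = 0" by (rule linear_formD(2)[OF l1]) (rule bracketD(4)[OF b])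
    moreover have "\<beta> (\<beta> x z) x i = \<beta> (\<lambda>k. - \<beta> z x k) x i"
      by (rule bracket_cong[OF b i]) (simp_all add: bracketD(3)[OF b, of _ x z])
    ultimately show ?thesis by (simp add: T_def linear_form_minus[OF l1])
  qed
  have sorted: "T (unit_vec p) (unit_vec q) (unit_vec r) = 0" if "p < q" "q < r" "r < n" for p q r
    using J[OF i that] by (simp add: T_def)
  have units: "T (unit_vec p) (unit_vec q) (unit_vec r) = 0" if "p < n" "q < n" "r < n" for p q r
  proof -
    have ord: "T (unit_vec p) (unit_vec q) (unit_vec r) = 0" if "p < q" "p < n" "q < n" "r < n" for p q r
    proof -
      consider "r < p" | "r = p" | "p < r" "r < q" | "r = q" | "q < r" by linarith
      then show ?thesis
      proof cases
        case 1 then show ?thesis using sorted[of r p q] that cyc by metis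
      next
        case 2 then show ?thesis using diag cyc by metis
      next
        case 3 then show ?thesis using sorted[of p r q] that cyc swap by (metis neg_equal_0_iff_equal)
      next
        case 4 then show ?thesis using diag cyc by metis
      next
        case 5 then show ?thesis using sorted that by simp
      qed
    qed
    consider "p < q" | "p = q" | "q < p" by linarith
    then show ?thesis
    proof cases
      case 1 then show ?thesis using ord that by simp
    next
      case 2 then show ?thesis using diag by simp
    next
      case 3 then show ?thesis using ord[of q p r] swap[of "unit_vec q" "unit_vec p"] that by simp
    qed
  qed
  have expand: "T x y z = (\<Sum>j<n. x j * T (unit_vec j) y z)" for x y z
    by (rule linear_form_expand[OF linT])
  have 1: "T x (unit_vec q) (unit_vec r) = 0" if "q < n" "r < n" for x q r
    using expand[of x] units that by simp
  have 2: "T x y (unit_vec r) = 0" if "r < n" for x y r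
  proof -
    have "T x y (unit_vec r) = T y (unit_vec r) x" by (rule cyc)
    also have "\<dots> = (\<Sum>j<n. y j * T (unit_vec j) (unit_vec r) x)" by (rule expand)
    also have "\<dots> = 0" using 1 that by (simp add: cyc[of x, symmetric])
    finally show ?thesis .
  qed
  have "T u v w = T w u v" by (rule cyc[symmetric])
  also have "\<dots> = (\<Sum>j<n. w j * T (unit_vec j) u v)" by (rule expand)
  also have "\<dots> = 0" using 2 by (simp add: cyc[of _ u v])
  finally have "T u v w = 0" .
  then show "\<beta> (\<beta> u v) w i + \<beta> (\<beta> v w) u i + \<beta> (\<beta> w u) v i = 0" by (simp add: T_def)
qed

section \<open>Normal forms\<close>

text \<open>Row i of the list encodes dx_i: an entry (c, p, q) stands for the summand c x_p
  x_q.\<close>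

definition form_bracket :: "('k::field \<times> nat \<times> nat) list list \<Rightarrow> 'k bracket" where
  "form_bracket L u v i =
     (if i < length L then \<Sum>(c, p, q)\<leftarrow>L ! i. c * (u p * v q - u q * v p) else 0)"

text \<open>A sparse matrix, each row a list of pairs of coefficient and column. Coordinates beyond
  its length stay fixed, so a short matrix acts on an initial segment of the coordinates
  only.\<close>

definition row_map :: "('k::field \<times> nat) list list \<Rightarrow> (nat \<Rightarrow> 'k) \<Rightarrow> nat \<Rightarrow> 'k" where
  "row_map R u i = (if i < length R then \<Sum>(c, j)\<leftarrow>R ! i. c * u j else u i)"

text \<open>dx_0 and dx_1 are always 0, so the table gives dx_2, ..., dx_5. From 0 to 21 the entries
  are grouped by the number of closed coordinate functions, in the order 6, 5, 4, 3, 2. The first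
  entry of a nonempty row always has coefficient 1; it is the witness consulted by
  \<open>adapted_list\<close>.\<close>

definition normal_form :: "nat \<Rightarrow> 'k::field \<Rightarrow> ('k \<times> nat \<times> nat) list list" where
  "normal_form k \<epsilon> = [] # [] # [
     [[], [], [], []],
     [[], [], [], [(1, 0, 1)]],
     [[], [], [], [(1, 0, 1), (1, 2, 3)]],
     [[], [], [(1, 0, 1)], [(1, 0, 2)]],
     [[], [], [(1, 0, 1)], [(1, 0, 4)]],
     [[], [], [(1, 0, 1)], [(1, 0, 4), (1, 1, 3)]],
     [[], [], [(1, 0, 1)], [(1, 0, 4), (1, 2, 3)]],
     [[], [(1, 0, 1)], [(1, 0, 2)], [(1, 1, 2)]],
     [[], [(1, 0, 1)], [(1, 0, 2)], [(1, 0, 3)]],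
     [[], [(1, 0, 1)], [(1, 0, 2)], [(1, 0, 3), (1, 1, 2)]],
     [[], [(1, 0, 1)], [(1, 0, 2)], [(1, 0, 4), (1, 1, 3)]],
     [[], [(1, 0, 1)], [(1, 0, 3)], [(1, 1, 3)]],
     [[], [(1, 0, 1)], [(1, 0, 3)], [(1, 0, 4)]],
     [[], [(1, 0, 1)], [(1, 0, 3)], [(1, 0, 4), (1, 1, 2)]],
     [[], [(1, 0, 1)], [(1, 0, 3)], [(1, 0, 4), (1, 1, 3)]],
     [[], [(1, 0, 1)], [(1, 0, 3)], [(1, 0, 4), (1, 1, 2), (1, 1, 3)]],
     [[], [(1, 0, 1)], [(1, 0, 3), (1, 1, 2)], [(1, 0, 4), (-1, 2, 3)]],
     [[(1, 0, 1)], [(1, 0, 2)], [(1, 0, 3)], [(1, 0, 4)]],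
     [[(1, 0, 1)], [(1, 0, 2)], [(1, 0, 3)], [(1, 0, 4), (1, 1, 2)]],
     [[(1, 0, 1)], [(1, 0, 2)], [(1, 0, 3)], [(1, 1, 4), (-1, 2, 3)]],
     [[(1, 0, 1)], [(1, 0, 2)], [(1, 0, 3), (1, 1, 2)], [(1, 0, 4), (1, 1, 3)]],
     [[(1, 0, 1)], [(1, 0, 2)], [(1, 0, 3), (1, 1, 2)], [(1, 1, 4), (-1, 2, 3)]],
     [[], [], [(1, 0, 3), (1, 1, 2)], [(1, 1, 3), (\<epsilon>, 0, 2)]],
     [[], [(1, 0, 1)], [(1, 0, 2)], [(1, 1, 3), (\<epsilon>, 2, 4)]],
     [[], [(1, 0, 1)], [(1, 0, 3), (1, 1, 2)], [(1, 1, 3), (\<epsilon>, 0, 2)]],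
     [[(1, 0, 1)], [(1, 0, 2)], [(1, 1, 2)], [(1, 0, 3), (\<epsilon>, 1, 4)]]] ! k"

definition classified :: "'k::field bracket \<Rightarrow> bool" where
  "classified \<beta> \<longleftrightarrow> (\<exists>k<26. \<exists>\<epsilon>. lie_iso 6 \<beta> (form_bracket (normal_form k \<epsilon>)))"

section \<open>Certificates for changes of coordinates\<close>

lemma all_less_numeral:
  "(\<forall>i<0. P i) \<longleftrightarrow> True"
  "(\<forall>i<Suc n. P i) \<longleftrightarrow> (\<forall>i<n. P i) \<and> P n"
  "(\<forall>i<numeral k. P i) \<longleftrightarrow> (\<forall>i<pred_numeral k. P i) \<and> P (pred_numeral k)"
  by (auto simp: less_Suc_eq numeral_eq_Suc)

lemma linear_form_row: "\<forall>(c, j)\<in>set r. j < n \<Longrightarrow> linear_form n (\<lambda>u. \<Sum>(c, j)\<leftarrow>r. c * u j)"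
  by (induction r) (auto simp: linear_form_def algebra_simps)

lemma linear_map_row_map:
  assumes "\<forall>r\<in>set R. \<forall>(c, j)\<in>set r. j < length R"
  shows "linear_map (length R) (row_map R)"
  unfolding linear_map_def
proof (intro allI impI)
  fix i assume i: "i < length R"
  have "\<forall>(c, j)\<in>set (R ! i). j < length R" using assms i by (metis nth_mem)
  from linear_form_row[OF this] show "linear_form (length R) (\<lambda>u. row_map R u i)"
    using i by (simp add: row_map_def)
qed

lemma alternating_add:
  assumes a: "alternating n \<omega>" and b: "alternating n \<omega>'"
  shows "alternating n (\<lambda>u v. \<omega> u v + \<omega>' u v)"
  unfolding alternating_def
proof (intro conjI allI)
  fix u v
  show "linear_form n (\<lambda>u. \<omega> u v + \<omega>' u v)"
    using alternatingD(1)[OF a] alternatingD(1)[OF b] by (simp add: linear_form_def algebra_simps)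
  show "\<omega> v u + \<omega>' v u = - (\<omega> u v + \<omega>' u v)"
    by (simp add: alternatingD(3)[OF a, of u v] alternatingD(3)[OF b, of u v])
  show "\<omega> u u + \<omega>' u u = 0" by (simp add: alternatingD(4)[OF a] alternatingD(4)[OF b])
qed

lemma alternating_form:
  "\<forall>(c, p, q)\<in>set r. p < n \<and> q < n \<Longrightarrow> alternating n (\<lambda>u v. \<Sum>(c, p, q)\<leftarrow>r. c * (u p * v q - u q * v p))"
proof (induction r)
  case Nil
  show ?case by (simp add: alternating_def linear_form_def)
next
  case (Cons t r)
  obtain c p q where t: "t = (c, p, q)" by (cases t)
  have "alternating n (\<lambda>u v. c * (u p * v q - u q * v p))"
    using Cons.prems t by (auto simp: alternating_def linear_form_def algebra_simps)
  then have "alternating n (\<lambda>u v. c * (u p * v q - u q * v p) + (\<Sum>(c, p, q)\<leftarrow>r. c * (u p * v q - u q * v p)))"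
    by (rule alternating_add) (use Cons in auto)
  then show ?case by (simp add: t)
qed

text \<open>An isomorphism is certified by the rows of its matrix. The kernel condition and the six
  coordinates of the homomorphism equation are separate premises, so that each becomes a small
  polynomial problem.\<close>

lemma classifiedI:
  fixes \<beta> :: "'k::field bracket"
  assumes "k < 26" "length R = 6" "\<forall>r\<in>set R. \<forall>(c, j)\<in>set r. j < 6"
    and inj: "\<And>u. row_map R u 0 = 0 \<Longrightarrow> row_map R u 1 = 0 \<Longrightarrow> row_map R u 2 = 0 \<Longrightarrow>
      row_map R u 3 = 0 \<Longrightarrow> row_map R u 4 = 0 \<Longrightarrow> row_map R u 5 = 0 \<Longrightarrow>
      u 0 = 0 \<and> u 1 = 0 \<and> u 2 = 0 \<and> u 3 = 0 \<and> u 4 = 0 \<and> u 5 = 0"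
    and "\<And>u v. row_map R (\<beta> u v) 0 = form_bracket (normal_form k \<epsilon>) (row_map R u) (row_map R v) 0"
      "\<And>u v. row_map R (\<beta> u v) 1 = form_bracket (normal_form k \<epsilon>) (row_map R u) (row_map R v) 1"
      "\<And>u v. row_map R (\<beta> u v) 2 = form_bracket (normal_form k \<epsilon>) (row_map R u) (row_map R v) 2"
      "\<And>u v. row_map R (\<beta> u v) 3 = form_bracket (normal_form k \<epsilon>) (row_map R u) (row_map R v) 3"
      "\<And>u v. row_map R (\<beta> u v) 4 = form_bracket (normal_form k \<epsilon>) (row_map R u) (row_map R v) 4"
      "\<And>u v. row_map R (\<beta> u v) 5 = form_bracket (normal_form k \<epsilon>) (row_map R u) (row_map R v) 5"
  shows "classified \<beta>"
proof -
  have all6: "(\<forall>i<6. P i) \<longleftrightarrow> P 0 \<and> P 1 \<and> P 2 \<and> P 3 \<and> P 4 \<and> P (5::nat)" for P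
    by (auto simp: all_less_numeral)
  have "linear_map 6 (row_map R)" using linear_map_row_map[of R] assms(2,3) by simp
  moreover have "injective_map 6 (row_map R)"
    unfolding injective_map_def all6 using inj by blast
  moreover have "lie_hom 6 (row_map R) \<beta> (form_bracket (normal_form k \<epsilon>))"
    unfolding lie_hom_def all6 using assms(5-10) by blast
  ultimately show ?thesis unfolding classified_def lie_iso_def using \<open>k < 26\<close> by blast
qed

lemma lie_iso_classified: "lie_iso 6 \<beta> \<beta>' \<Longrightarrow> classified \<beta>' \<Longrightarrow> classified \<beta>"
  unfolding classified_def by (meson lie_iso_trans)

text \<open>F rewrites the first n coordinates and fixes the others. The transported bracket keeps
  the flag condition: below n it is the prescribed \<open>\<gamma>\<close>, and for i from n on F
  and its inverse preserve the vectors whose first i coordinates vanish. This is what allows one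
  coordinate to be normalised after another.\<close>

lemma change_coordinates:
  fixes \<beta> \<gamma> :: "'k::field bracket"
  assumes nil: "nilpotent m \<beta>" and "n \<le> m"
    and lin: "linear_map n F" and inj: "injective_map n F"
    and high: "\<And>u i. n \<le> i \<Longrightarrow> F u i = u i"
    and hom: "\<And>u v i. i < n \<Longrightarrow> F (\<beta> u v) i = \<gamma> (F u) (F v) i"
    and alt: "\<And>i. i < n \<Longrightarrow> alternating i (\<lambda>u v. \<gamma> u v i)"
  shows "\<exists>\<beta>'. nilpotent m \<beta>' \<and> lie_hom m F \<beta> \<beta>' \<and> lie_iso m \<beta> \<beta>' \<and>
    (\<forall>u v. \<forall>i<n. \<beta>' u v i = \<gamma> u v i)"
proof -
  have br: "bracket m \<beta>" using nil by (rule nilpotent_imp_bracket)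
  have Fn: "linear_form n (\<lambda>u. F u i)" if "i < n" for i using lin that by (simp add: linear_map_def)
  have Fi: "linear_form (max n (Suc i)) (\<lambda>u. F u i)" for i
  proof (cases "i < n")
    case True then show ?thesis using linear_form_mono[OF Fn] by simp
  next
    case False
    then have "(\<lambda>u. F u i) = (\<lambda>u. u i)" using high by auto
    then show ?thesis by (auto simp: linear_form_def)
  qed
  have Fm: "linear_form m (\<lambda>u. F u i)" if "i < m" for i
    by (rule linear_form_mono[OF Fi]) (use that \<open>n \<le> m\<close> in auto)
  have linm: "linear_map m F" using Fm by (simp add: linear_map_def)
  have injm: "injective_map m F"
    unfolding injective_map_def
  proof (intro allI impI)
    fix u i assume u: "\<forall>i<m. F u i = 0" and i: "i < m"
    show "u i = 0"
    proof (cases "i < n")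
      case True
      then show ?thesis using inj u \<open>n \<le> m\<close> unfolding injective_map_def by (meson less_le_trans)
    next
      case False
      then show ?thesis using high[of i u] u i by simp
    qed
  qed
  obtain G where G: "linear_map m G" "injective_map m G" and FG: "\<And>u i. i < m \<Longrightarrow> F (G u) i = u i"
    and GF: "\<And>u i. i < m \<Longrightarrow> G (F u) i = u i"
    using injective_map_inverse[OF linm injm] by blast
  define \<beta>' where "\<beta>' u v = F (\<beta> (G u) (G v))" for u v
  have hom': "lie_hom m F \<beta> \<beta>'" unfolding \<beta>'_def by (rule lie_hom_transport[OF br linm GF])
  have pre: "\<beta>' u v i = \<gamma> u v i" if "i < n" for u v i
  proof -
    have "\<beta>' u v i = \<gamma> (F (G u)) (F (G v)) i" unfolding \<beta>'_def using hom that by simp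
    also have "\<dots> = \<gamma> u v i"
      using linear_form_cong[OF alternatingD(1)[OF alt[OF that]], of "F (G u)" u "F (G v)"]
        linear_form_cong[OF alternatingD(2)[OF alt[OF that]], of "F (G v)" v u] FG that \<open>n \<le> m\<close>
      by (metis (no_types, lifting) less_le_trans less_trans)
    finally show ?thesis .
  qed
  \<comment> \<open>For j below n this is injectivity of F on the first n coordinates; from n on F
    is the identity.\<close>
  have Glow: "G u j = 0" if u: "\<forall>k<i. u k = 0" and i: "n \<le> i" "i < m" and j: "j < i" for u i j
  proof (cases "j < n")
    case True
    have "\<forall>k<n. F (G u) k = 0" using FG u i by simp
    then show ?thesis using inj True unfolding injective_map_def by blast
  next
    case False
    then show ?thesis using high[of j "G u"] FG[of j u] u i j by simp
  qed
  have br': "bracket m \<beta>'" unfolding \<beta>'_def by (intro bracket_post[OF _ linm] bracket_pre[OF br G(1)])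
  have flag: "alternating i (\<lambda>u v. \<beta>' u v i)" if i: "i < m" for i
  proof (cases "i < n")
    case True
    then have "(\<lambda>u v. \<beta>' u v i) = (\<lambda>u v. \<gamma> u v i)" using pre by blast
    then show ?thesis using alt[OF True] by simp
  next
    case False
    have "\<beta>' u v i = 0" if u: "\<forall>k<i. u k = 0" for u v
    proof -
      have "\<beta>' u v i = \<beta> (G u) (G v) i" unfolding \<beta>'_def using high False by simp
      moreover have "alternating i (\<lambda>u v. \<beta> u v i)" using nil i by (simp add: nilpotent_def)
      ultimately show ?thesis
        using linear_formD(2)[OF alternatingD(1), of i "\<lambda>u v. \<beta> u v i" "G u" "G v"] Glow[OF u] False i
        by simp
    qed
    then have "linear_form i (\<lambda>u. \<beta>' u v i)" for v
      using bracketD(1)[OF br' i, of v] unfolding linear_form_def by simp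
    then show ?thesis unfolding alternating_def using bracketD(3,4)[OF br' i] by blast
  qed
  have "jacobi m \<beta>'" unfolding \<beta>'_def
    by (rule jacobi_transport[OF br _ linm G(1) GF]) (use nil in \<open>simp_all add: nilpotent_def\<close>)
  then have "nilpotent m \<beta>'" using flag by (simp add: nilpotent_def)
  moreover have "lie_iso m \<beta> \<beta>'" using linm injm hom' unfolding lie_iso_def by blast
  ultimately show ?thesis using hom' pre by blast
qed

lemma nilpotent_prefix:
  fixes \<beta> :: "'k::field bracket"
  assumes "nilpotent m \<beta>" "n \<le> m" and R: "length R = n" "\<forall>r\<in>set R. \<forall>(c, j)\<in>set r. j < n"
    and L: "length L = n" "\<forall>i<n. \<forall>(c, p, q)\<in>set (L ! i). p < i \<and> q < i"
    and inj: "\<And>u. \<forall>i<n. row_map R u i = 0 \<Longrightarrow> \<forall>i<n. u i = 0"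
    and hom: "\<And>u v. \<forall>i<n. row_map R (\<beta> u v) i = form_bracket L (row_map R u) (row_map R v) i"
  shows "\<exists>\<beta>'. nilpotent m \<beta>' \<and> lie_iso m \<beta> \<beta>' \<and> (\<forall>u v. \<forall>i<n. \<beta>' u v i = form_bracket L u v i)"
proof -
  have "\<exists>\<beta>'. nilpotent m \<beta>' \<and> lie_hom m (row_map R) \<beta> \<beta>' \<and> lie_iso m \<beta> \<beta>' \<and>
    (\<forall>u v. \<forall>i<n. \<beta>' u v i = form_bracket L u v i)"
  proof (rule change_coordinates[OF assms(1,2)])
    show "linear_map n (row_map R)" using linear_map_row_map[of R] R by simp
    show "injective_map n (row_map R)" unfolding injective_map_def using inj by blast
    show "row_map R u i = u i" if "n \<le> i" for u i using that R by (simp add: row_map_def)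
    show "row_map R (\<beta> u v) i = form_bracket L (row_map R u) (row_map R v) i" if "i < n" for u v i
      using hom that by blast
    show "alternating i (\<lambda>u v. form_bracket L u v i)" if "i < n" for i
      unfolding form_bracket_def using alternating_form[of "L ! i" i] L that by auto
  qed
  then show ?thesis by blast
qed

section \<open>Coefficients of a 2-form in at most five variables\<close>

lemma sum_less_numeral:
  "sum f {..<numeral k} = sum f {..<pred_numeral k} + f (pred_numeral k)"
  by (simp add: numeral_eq_Suc)

lemma alternating_3E:
  assumes "alternating 3 \<omega>"
  obtains w01 w02 w12 where
    "\<And>u v. \<omega> u v = w01 * (u 0 * v 1 - u 1 * v 0)
      + w02 * (u 0 * v 2 - u 2 * v 0)
      + w12 * (u 1 * v 2 - u 2 * v 1)"
proof -
  have "\<omega> u v = \<omega> (unit_vec 0) (unit_vec 1) * (u 0 * v 1 - u 1 * v 0)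
      + \<omega> (unit_vec 0) (unit_vec 2) * (u 0 * v 2 - u 2 * v 0)
      + \<omega> (unit_vec 1) (unit_vec 2) * (u 1 * v 2 - u 2 * v 1)" for u v
    unfolding alternating_expand[OF assms, of u v] by (simp add: sum_less_numeral)
  then show thesis by (rule that)
qed

lemma alternating_4E:
  assumes "alternating 4 \<omega>"
  obtains w01 w02 w03 w12 w13 w23 where
    "\<And>u v. \<omega> u v = w01 * (u 0 * v 1 - u 1 * v 0)
      + w02 * (u 0 * v 2 - u 2 * v 0)
      + w03 * (u 0 * v 3 - u 3 * v 0)
      + w12 * (u 1 * v 2 - u 2 * v 1)
      + w13 * (u 1 * v 3 - u 3 * v 1)
      + w23 * (u 2 * v 3 - u 3 * v 2)"
proof -
  have "\<omega> u v = \<omega> (unit_vec 0) (unit_vec 1) * (u 0 * v 1 - u 1 * v 0)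
      + \<omega> (unit_vec 0) (unit_vec 2) * (u 0 * v 2 - u 2 * v 0)
      + \<omega> (unit_vec 0) (unit_vec 3) * (u 0 * v 3 - u 3 * v 0)
      + \<omega> (unit_vec 1) (unit_vec 2) * (u 1 * v 2 - u 2 * v 1)
      + \<omega> (unit_vec 1) (unit_vec 3) * (u 1 * v 3 - u 3 * v 1)
      + \<omega> (unit_vec 2) (unit_vec 3) * (u 2 * v 3 - u 3 * v 2)" for u v
    unfolding alternating_expand[OF assms, of u v] by (simp add: sum_less_numeral)
  then show thesis by (rule that)
qed

lemma alternating_5E:
  assumes "alternating 5 \<omega>"
  obtains w01 w02 w03 w04 w12 w13 w14 w23 w24 w34 where
    "\<And>u v. \<omega> u v = w01 * (u 0 * v 1 - u 1 * v 0)
      + w02 * (u 0 * v 2 - u 2 * v 0)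
      + w03 * (u 0 * v 3 - u 3 * v 0)
      + w04 * (u 0 * v 4 - u 4 * v 0)
      + w12 * (u 1 * v 2 - u 2 * v 1)
      + w13 * (u 1 * v 3 - u 3 * v 1)
      + w14 * (u 1 * v 4 - u 4 * v 1)
      + w23 * (u 2 * v 3 - u 3 * v 2)
      + w24 * (u 2 * v 4 - u 4 * v 2)
      + w34 * (u 3 * v 4 - u 4 * v 3)"
proof -
  have "\<omega> u v = \<omega> (unit_vec 0) (unit_vec 1) * (u 0 * v 1 - u 1 * v 0)
      + \<omega> (unit_vec 0) (unit_vec 2) * (u 0 * v 2 - u 2 * v 0)
      + \<omega> (unit_vec 0) (unit_vec 3) * (u 0 * v 3 - u 3 * v 0)
      + \<omega> (unit_vec 0) (unit_vec 4) * (u 0 * v 4 - u 4 * v 0)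
      + \<omega> (unit_vec 1) (unit_vec 2) * (u 1 * v 2 - u 2 * v 1)
      + \<omega> (unit_vec 1) (unit_vec 3) * (u 1 * v 3 - u 3 * v 1)
      + \<omega> (unit_vec 1) (unit_vec 4) * (u 1 * v 4 - u 4 * v 1)
      + \<omega> (unit_vec 2) (unit_vec 3) * (u 2 * v 3 - u 3 * v 2)
      + \<omega> (unit_vec 2) (unit_vec 4) * (u 2 * v 4 - u 4 * v 2)
      + \<omega> (unit_vec 3) (unit_vec 4) * (u 3 * v 4 - u 4 * v 3)" for u v
    unfolding alternating_expand[OF assms, of u v] by (simp add: sum_less_numeral)
  then show thesis by (rule that)
qed

text \<open>\<open>wpq\<close> is the coefficient of x_p x_q in dx_5. As a predicate it can be
  assumed by the locale in which all extensions of a five-dimensional form are treated.\<close>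

definition top_form :: "'k::field bracket \<Rightarrow> 'k \<Rightarrow> 'k \<Rightarrow> 'k \<Rightarrow> 'k \<Rightarrow> 'k \<Rightarrow> 'k \<Rightarrow> 'k \<Rightarrow> 'k \<Rightarrow> 'k \<Rightarrow> 'k \<Rightarrow> bool" where
  "top_form \<beta> w01 w02 w03 w04 w12 w13 w14 w23 w24 w34 \<longleftrightarrow>
    (\<forall>u v. \<beta> u v 5 = w01 * (u 0 * v 1 - u 1 * v 0) + w02 * (u 0 * v 2 - u 2 * v 0)
      + w03 * (u 0 * v 3 - u 3 * v 0) + w04 * (u 0 * v 4 - u 4 * v 0)
      + w12 * (u 1 * v 2 - u 2 * v 1) + w13 * (u 1 * v 3 - u 3 * v 1)
      + w14 * (u 1 * v 4 - u 4 * v 1) + w23 * (u 2 * v 3 - u 3 * v 2)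
      + w24 * (u 2 * v 4 - u 4 * v 2) + w34 * (u 3 * v 4 - u 4 * v 3))"

lemma top_formE:
  assumes "nilpotent 6 \<beta>"
  obtains w01 w02 w03 w04 w12 w13 w14 w23 w24 w34 where
    "top_form \<beta> w01 w02 w03 w04 w12 w13 w14 w23 w24 w34"
proof -
  have "alternating 5 (\<lambda>u v. \<beta> u v 5)" using assms by (simp add: nilpotent_def)
  from alternating_5E[OF this] show thesis using that unfolding top_form_def by blast
qed

lemma nilpotentD_jacobi:
  "nilpotent n \<beta> \<Longrightarrow> i < n \<Longrightarrow> \<beta> (\<beta> u v) w i + \<beta> (\<beta> v w) u i + \<beta> (\<beta> w u) v i = 0"
  by (simp add: nilpotent_def jacobi_def)

section \<open>Every nilpotent bracket has a normal form\<close>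

locale six_dim =
  fixes \<beta> :: "'k::field bracket" and w01 w02 w03 w04 w12 w13 w14 w23 w24 w34 :: 'k
  assumes two: "(2::'k) \<noteq> 0" and nil: "nilpotent 6 \<beta>"
    and top: "top_form \<beta> w01 w02 w03 w04 w12 w13 w14 w23 w24 w34"
begin

lemma jac: "\<beta> (\<beta> u v) w 5 + \<beta> (\<beta> v w) u 5 + \<beta> (\<beta> w u) v 5 = 0"
  using nilpotentD_jacobi[OF nil] by simp

lemma double_eq_0: "x + x = 0 \<longleftrightarrow> x = (0::'k)" "(4::'k) \<noteq> 0"
proof -
  have "x + x = 2 * x" "(4::'k) = 2 * 2" by simp_all
  then show "x + x = 0 \<longleftrightarrow> x = 0" "(4::'k) \<noteq> 0" using two by (metis mult_eq_0_iff)+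
qed

end

text \<open>By Jacobi x_4 can only be multiplied by x_0 and x_1. If x_4 does not occur, dx_5 forms a
  pencil with the decomposable x_0 x_1: without an x_2 x_3 term the rank of the mixed 2 by 2
  coefficient block decides, with such a term the pencil has two decomposable members. If x_4
  occurs, its linear factor becomes the new x_0 and the rest of dx_5 is reduced by it.\<close>

lemma (in six_dim) classify_B:
  assumes pre: "\<And>u v i. i < 5 \<Longrightarrow> \<beta> u v i = form_bracket [[], [], [], [], [(1, 0, 1)]] u v i"
  shows "classified \<beta>"
proof -
  note b = pre form_bracket_def top[unfolded top_form_def, rule_format]
  have z: "w24 = 0" "w34 = 0"
    using jac[of "unit_vec 0" "unit_vec 1" "unit_vec 2"] jac[of "unit_vec 0" "unit_vec 1" "unit_vec 3"]
    by (simp_all add: b unit_vec_def eq_neg_iff_add_eq_0 ac_simps)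
  note simps = all_less_numeral row_map_def normal_form_def b two double_eq_0 z
  show ?thesis
  proof (cases "w04 = 0")
    case w04: True
    show ?thesis
    proof (cases "w14 = 0")
      case w14: True
      show ?thesis
      proof (cases "w23 = 0")
        case w23: True
        show ?thesis
        proof (cases "w02 * w13 - w03 * w12 = 0")
          case det: True
          show ?thesis
          proof (cases "w02 = 0")
            case w02: True
            show ?thesis
            proof (cases "w03 = 0")
              case w03: True
              show ?thesis
              proof (cases "w12 = 0")
                case w12: True
                show ?thesis
                proof (cases "w13 = 0")
                  case w13: True
                  show ?thesis
                    by (rule classifiedI[where k = 1 and R = "[[(1, 0)], [(1, 1)], [(1, 2)], [(1, 3)], [(1, 5), (-w01, 4)], [(1, 4)]]"];
                        simp add: simps w04 w14 w23 w02 w03 w12 w13 field_simps; algebra)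
                next
                  case w13: False
                  show ?thesis
                    by (rule classifiedI[where k = 3 and R = "[[(1, 1)], [(-1, 0)], [(w13, 3)], [(1, 2)], [(1, 4)], [(1, 5), (-w01, 4)]]"];
                        simp add: simps w04 w14 w23 w02 w03 w12 w13 field_simps; algebra)
                qed
              next
                case w12: False
                show ?thesis
                  by (rule classifiedI[where k = 3 and R = "[[(1, 1)], [(-1, 0)], [(w12, 2), (w13, 3)], [(1, 3)], [(1, 4)],
          [(1, 5), (-w01, 4)]]"];
                      simp add: simps w04 w14 w23 w02 w03 w12 field_simps; algebra)
              qed
            next
              case w03: False
              have w12: "w12 = 0"
                using det w02 w03 by simp
              show ?thesis
                by (rule classifiedI[where k = 3 and R = "[[(1, 0), (w13 / w03, 1)], [(1, 1)], [(w03, 3)], [(1, 2)], [(1, 4)],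
          [(1, 5), (-w01, 4)]]"];
                    simp add: simps w04 w14 w23 w02 w03 w12 field_simps; algebra)
            qed
          next
            case w02: False
            have w13_eq: "w13 = w03 * w12 / w02"
              using det w02 by (simp add: field_simps)
            show ?thesis
              by (rule classifiedI[where k = 3 and R = "[[(1, 0), (w12 / w02, 1)], [(1, 1)], [(w02, 2), (w03, 3)], [(1, 3)], [(1, 4)],
          [(1, 5), (-w01, 4)]]"];
                  simp add: simps w04 w14 w23 w02 w13_eq field_simps; algebra)
          qed
        next
          case det: False
          show ?thesis
            by (rule classifiedI[where k = 22 and \<epsilon> = "0" and R = "[[(-w12, 2), (-w13, 3)], [(1, 0)], [(w02, 2), (w03, 3)], [(1, 1)],
          [(1, 5), (-w01, 4)], [(1, 4)]]"];
                simp add: simps w04 w14 w23 field_simps; insert det; algebra)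
        qed
      next
        case w23: False
        \<comment> \<open>The Pfaffian of dx_5 divided by w23, so that dx_5 - g dx_4 is
          decomposable. Together with x_0 x_1 it spans the two isotropic lines of the Pfaffian,
          whence \<epsilon> = 1.\<close>
        define g where "g = w01 + (w03 * w12 - w13 * w02) / w23"
        have w01_eq: "w01 = g - (w03 * w12 - w13 * w02) / w23"
          using w04 w14 w23 two by (simp add: g_def field_simps)
        show ?thesis
          by (rule classifiedI[where k = 22 and \<epsilon> = "1" and R = "[[(1 - w03, 0), (-w13, 1), (-w23, 2)], [(1 + w03, 0), (w13, 1), (w23, 2)],
          [(1 + w12 / w23, 1), (w02 / w23, 0), (-1, 3)],
          [(1 - w12 / w23, 1), (-(w02 / w23), 0), (1, 3)], [(2 + 2 * g, 4), (-2, 5)],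
          [(2 - 2 * g, 4), (2, 5)]]"];
              simp add: simps w04 w14 w23 w01_eq field_simps; (intro conjI)?; insert two double_eq_0(2) w23; algebra)
      qed
    next
      case w14: False
      define m2 where "m2 = - w02"
      have w02_eq: "w02 = - m2"
        using w04 w14 two by (simp add: m2_def field_simps)
      define m3 where "m3 = - w03"
      have w03_eq: "w03 = - m3"
        using w04 w14 two by (simp add: m3_def field_simps)
      show ?thesis
      proof (cases "w23 = 0")
        case w23: True
        show ?thesis
        proof (cases "m3 = 0")
          case m3: True
          show ?thesis
          proof (cases "m2 = 0")
            case m2: True
            show ?thesis
              by (rule classifiedI[where k = 4 and R = "[[(w14, 1)], [(-1, 0)], [(1, 2)], [(1, 3)], [(w14, 4), (w12, 2), (w13, 3)],
          [(w14, 5), (-(w14 * w01), 4)]]"];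
                  simp add: simps w04 w14 w02_eq w03_eq w23 m3 m2 field_simps; algebra)
          next
            case m2: False
            show ?thesis
              by (rule classifiedI[where k = 5 and R = "[[(w14, 1)], [(-1, 0)], [(1, 3)], [(w14 * m2, 2)],
          [(w14, 4), (w12, 2), (w13, 3)], [(w14, 5), (-(w14 * w01), 4)]]"];
                  simp add: simps w04 w14 w02_eq w03_eq w23 m3 m2 field_simps; algebra)
          qed
        next
          case m3: False
          show ?thesis
            by (rule classifiedI[where k = 5 and R = "[[(w14, 1)], [(-1, 0)], [(1, 2)], [(w14 * m2, 2), (w14 * m3, 3)],
          [(w14, 4), (w12, 2), (w13, 3)], [(w14, 5), (-(w14 * w01), 4)]]"];
                simp add: simps w04 w14 w02_eq w03_eq w23 m3 field_simps; algebra)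
        qed
      next
        case w23: False
        show ?thesis
          by (rule classifiedI[where k = 6 and R = "[[(w14, 1)], [(-1, 0)], [(w14 * w23, 2), (-(w14 * m3), 0)],
          [(1, 3), (m2 / w23, 0)], [(w14, 4), (w12, 2), (w13, 3)],
          [(w14, 5), (-(w14 * w01), 4)]]"];
              simp add: simps w04 w14 w02_eq w03_eq w23 field_simps; algebra)
      qed
    qed
  next
    case w04: False
    \<comment> \<open>\<open>m2\<close> and the following \<open>m3\<close> are the coefficients of
      x_1 x_2 and x_1 x_3 that remain once the product of w04 x_0 + w14 x_1 with w04 x_4 + w02 x_2 +
      w03 x_3, divided by w04, is split off.\<close>
    define m2 where "m2 = w12 - w14 * w02 / w04"
    have w12_eq: "w12 = m2 + w14 * w02 / w04"
      using w04 two by (simp add: m2_def field_simps)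
    define m3 where "m3 = w13 - w14 * w03 / w04"
    have w13_eq: "w13 = m3 + w14 * w03 / w04"
      using w04 two by (simp add: m3_def field_simps)
    show ?thesis
    proof (cases "w23 = 0")
      case w23: True
      show ?thesis
      proof (cases "m3 = 0")
        case m3: True
        show ?thesis
        proof (cases "m2 = 0")
          case m2: True
          show ?thesis
            by (rule classifiedI[where k = 4 and R = "[[(w04, 0), (w14, 1)], [(1, 1)], [(1, 2)], [(1, 3)],
          [(w04, 4), (w02, 2), (w03, 3)], [(w04, 5), (-(w04 * w01), 4)]]"];
                simp add: simps w04 w12_eq w13_eq w23 m3 m2 field_simps; algebra)
        next
          case m2: False
          show ?thesis
            by (rule classifiedI[where k = 5 and R = "[[(w04, 0), (w14, 1)], [(1, 1)], [(1, 3)], [(w04 * m2, 2)],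
          [(w04, 4), (w02, 2), (w03, 3)], [(w04, 5), (-(w04 * w01), 4)]]"];
                simp add: simps w04 w12_eq w13_eq w23 m3 m2 field_simps; algebra)
        qed
      next
        case m3: False
        show ?thesis
          by (rule classifiedI[where k = 5 and R = "[[(w04, 0), (w14, 1)], [(1, 1)], [(1, 2)], [(w04 * m2, 2), (w04 * m3, 3)],
          [(w04, 4), (w02, 2), (w03, 3)], [(w04, 5), (-(w04 * w01), 4)]]"];
              simp add: simps w04 w12_eq w13_eq w23 m3 field_simps; algebra)
      qed
    next
      case w23: False
      show ?thesis
        by (rule classifiedI[where k = 6 and R = "[[(w04, 0), (w14, 1)], [(1, 1)], [(w04 * w23, 2), (w04 * m3, 1)],
          [(1, 3), (-(m2 / w23), 1)], [(w04, 4), (w02, 2), (w03, 3)],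
          [(w04, 5), (-(w04 * w01), 4)]]"];
            simp add: simps w04 w12_eq w13_eq w23 field_simps; algebra)
    qed
  qed
qed

text \<open>dx_4 is nondegenerate in x_0, ..., x_3, so Jacobi excludes x_4 from dx_5 and the pencil
  of dx_4 and dx_5 decides. Up to a square, \<epsilon> is minus the Pfaffian of the part of dx_5
  orthogonal to dx_4; form 2 is the case where that part is 0.\<close>

lemma (in six_dim) classify_C:
  assumes pre: "\<And>u v i. i < 5 \<Longrightarrow> \<beta> u v i = form_bracket [[], [], [], [], [(1, 0, 1), (1, 2, 3)]] u v i"
  shows "classified \<beta>"
proof -
  note b = pre form_bracket_def top[unfolded top_form_def, rule_format]
  have z: "w04 = 0" "w14 = 0" "w24 = 0" "w34 = 0"
    using jac[of "unit_vec 0" "unit_vec 2" "unit_vec 3"] jac[of "unit_vec 1" "unit_vec 2" "unit_vec 3"]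
      jac[of "unit_vec 0" "unit_vec 1" "unit_vec 2"] jac[of "unit_vec 0" "unit_vec 1" "unit_vec 3"]
    by (simp_all add: b unit_vec_def eq_neg_iff_add_eq_0 ac_simps)
  note simps = all_less_numeral row_map_def normal_form_def b two double_eq_0 z
  \<comment> \<open>Subtracting (w01 + w23)/2 times dx_4 makes dx_5 orthogonal to dx_4 and leaves h
    x_0 x_1 - h x_2 x_3 beside the mixed terms.\<close>
  define h where "h = (w01 - w23) / 2"
  have w01_eq: "w01 = 2 * h + w23"
    using two by (simp add: h_def field_simps)
  show ?thesis
  proof (cases "w03 = 0")
    case w03: True
    show ?thesis
    proof (cases "w02 = 0")
      case w02: True
      show ?thesis
      proof (cases "w13 = 0")
        case w13: True
        show ?thesis
        proof (cases "w12 = 0")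
          case w12: True
          show ?thesis
          proof (cases "h = 0")
            case h: True
            show ?thesis
              by (rule classifiedI[where k = 2 and R = "[[(1, 0)], [(1, 1)], [(1, 2)], [(1, 3)], [(1, 5), (-w23, 4)], [(1, 4)]]"];
                  simp add: simps w01_eq w03 w02 w13 w12 h field_simps; algebra)
          next
            case h: False
            show ?thesis
              by (rule classifiedI[where k = 22 and \<epsilon> = "1" and R = "[[(1, 0), (-1, 2)], [(1, 0), (1, 2)], [(1, 1), (-1, 3)], [(1, 1), (1, 3)],
          [(2 / h, 5), (-2 - 2 * w23 / h, 4)], [(2, 4)]]"];
                  simp add: simps w01_eq w03 w02 w13 w12 h field_simps; algebra)
          qed
        next
          case w12: False
          show ?thesis
            by (rule classifiedI[where k = 22 and \<epsilon> = "h ^ 2" and R = "[[(-(1 / w12), 3)], [(1, 1), (h / w12, 3)], [(-1, 0)], [(w12, 2), (-h, 0)],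
          [(1, 4)], [(1, 5), (-w23 - h, 4)]]"];
                simp add: simps w01_eq w03 w02 w13 w12 field_simps; algebra)
        qed
      next
        case w13: False
        show ?thesis
          by (rule classifiedI[where k = 22 and \<epsilon> = "h ^ 2" and R = "[[(1 / w13, 2)], [(1, 1), (-(h / w13), 2)], [(-1, 0)],
          [(w12, 2), (w13, 3), (-h, 0)], [(1, 4)], [(1, 5), (-w23 - h, 4)]]"];
              simp add: simps w01_eq w03 w02 w13 field_simps; algebra)
      qed
    next
      case w02: False
      show ?thesis
        by (rule classifiedI[where k = 22 and \<epsilon> = "h ^ 2 + w13 * w02" and R = "[[(-(1 / w02), 3)], [(1, 0), (w12 / w02, 1), (h / w02, 3)], [(1, 1)],
          [(w02, 2), (h, 1)], [(1, 4)], [(1, 5), (-w23 - h, 4)]]"];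
            simp add: simps w01_eq w03 w02 field_simps; algebra)
    qed
  next
    case w03: False
    show ?thesis
      by (rule classifiedI[where k = 22 and \<epsilon> = "h ^ 2 - (w12 * w03 - w13 * w02)" and R = "[[(1 / w03, 2)], [(1, 0), (w13 / w03, 1), (-(h / w03), 2)], [(1, 1)],
          [(w02, 2), (w03, 3), (h, 1)], [(1, 4)], [(1, 5), (-w23 - h, 4)]]"];
          simp add: simps w01_eq w03 field_simps; algebra)
  qed
qed

text \<open>Since w23 = w14, the terms pairing x_1, x_2 with x_3, x_4 form the quadratic form w13
  X^2 + 2 w14 XY + w24 Y^2, on which simultaneous changes of (x_1, x_2) and (x_3, x_4) act by
  congruence. The cases follow its rank.\<close>

lemma (in six_dim) classify_D:
  assumes pre: "\<And>u v i. i < 5 \<Longrightarrow> \<beta> u v i = form_bracket [[], [], [], [(1, 0, 1)], [(1, 0, 2)]] u v i"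
  shows "classified \<beta>"
proof -
  note b = pre form_bracket_def top[unfolded top_form_def, rule_format]
  have z: "w34 = 0" "w23 = w14"
    using jac[of "unit_vec 0" "unit_vec 1" "unit_vec 4"] jac[of "unit_vec 0" "unit_vec 1" "unit_vec 2"]
    by (simp_all add: b unit_vec_def eq_neg_iff_add_eq_0 ac_simps)
  note simps = all_less_numeral row_map_def normal_form_def b two double_eq_0 z
  show ?thesis
  proof (cases "w13 = 0")
    case w13: True
    show ?thesis
    proof (cases "w24 = 0")
      case w24: True
      show ?thesis
      proof (cases "w14 = 0")
        case w14: True
        show ?thesis
        proof (cases "w03 = 0")
          case w03: True
          show ?thesis
          proof (cases "w04 = 0")
            case w04: True
            show ?thesis
            proof (cases "w12 = 0")
              case w12: True
              show ?thesis
                by (rule classifiedI[where k = 3 and R = "[[(1, 0)], [(1, 1)], [(1, 2)], [(1, 5), (-w01, 3), (-w02, 4)], [(1, 3)], [(1, 4)]]"];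
                    simp add: simps w13 w24 w14 w03 w04 w12 field_simps; algebra)
            next
              case w12: False
              show ?thesis
                by (rule classifiedI[where k = 7 and R = "[[(1, 0)], [(w12, 1)], [(1, 2)], [(w12, 3)], [(1, 4)],
          [(1, 5), (-w01, 3), (-w02, 4)]]"];
                    simp add: simps w13 w24 w14 w03 w04 w12 field_simps; algebra)
            qed
          next
            case w04: False
            show ?thesis
            proof (cases "w12 = 0")
              case w12: True
              show ?thesis
                by (rule classifiedI[where k = 8 and R = "[[(1, 0)], [(w04, 2)], [(1, 1)], [(w04, 4)], [(1, 3)],
          [(1, 5), (-w01, 3), (-w02, 4)]]"];
                    simp add: simps w13 w24 w14 w03 w04 w12 field_simps; algebra)
            next
              case w12: False
              show ?thesis
                by (rule classifiedI[where k = 9 and R = "[[(1, 0)], [(w04, 2)], [(-(w12 / w04), 1)], [(w04, 4)], [(-(w12 / w04), 3)],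
          [(1, 5), (-w01, 3), (-w02, 4)]]"];
                    simp add: simps w13 w24 w14 w03 w04 w12 field_simps; algebra)
            qed
          qed
        next
          case w03: False
          show ?thesis
          proof (cases "w12 = 0")
            case w12: True
            show ?thesis
              by (rule classifiedI[where k = 8 and R = "[[(1, 0)], [(w03, 1), (w04, 2)], [(1, 2)], [(w03, 3), (w04, 4)], [(1, 4)],
          [(1, 5), (-w01, 3), (-w02, 4)]]"];
                  simp add: simps w13 w24 w14 w03 w12 field_simps; algebra)
          next
            case w12: False
            show ?thesis
              by (rule classifiedI[where k = 9 and R = "[[(1, 0)], [(w03, 1), (w04, 2)], [(w12 / w03, 2)], [(w03, 3), (w04, 4)],
          [(w12 / w03, 4)], [(1, 5), (-w01, 3), (-w02, 4)]]"];
                  simp add: simps w13 w24 w14 w03 w12 field_simps; algebra)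
          qed
        qed
      next
        case w14: False
        \<comment> \<open>Hyperbolic case: 2 w14 XY is diagonalised by x_1 + x_2 and x_1 - x_2,
          giving \<epsilon> = -1. The shifts s and t along x_0 absorb w03 and w04, and r absorbs
          w12.\<close>
        define s where "s = (w03 + w04) / w14 / 2"
        have w03_eq: "w03 = 2 * s * w14 - w04"
          using w13 w24 w14 two by (simp add: s_def field_simps)
        define t where "t = w04 / w14 - s"
        have w04_eq: "w04 = (s + t) * w14"
          using w13 w24 w14 two by (simp add: t_def field_simps)
        define r where "r = w12 / w14"
        have w12_eq: "w12 = r * w14"
          using w13 w24 w14 two by (simp add: r_def field_simps)
        show ?thesis
          by (rule classifiedI[where k = 23 and \<epsilon> = "-1" and R = "[[(1, 0)], [(1, 1), (1, 2), (2 * s, 0)], [(1, 1), (-1, 2), (2 * t, 0)],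
          [(1, 3), (1, 4), (2 * r, 2)], [(1, 3), (-1, 4)],
          [(2 / w14, 5), (-(2 * w01 / w14), 3), (4 * s * r - 2 * w02 / w14, 4)]]"];
              simp add: simps w13 w24 w14 w03_eq w04_eq w12_eq field_simps; algebra)
      qed
    next
      case w24: False
      define \<kappa> where "\<kappa> = w24 * w03 - w04 * w14"
      have w03_eq: "w03 = (\<kappa> + w04 * w14) / w24"
        using w13 w24 two by (simp add: \<kappa>_def field_simps)
      show ?thesis
      proof (cases "w14 = 0")
        case w14: True
        show ?thesis
        proof (cases "\<kappa> = 0")
          case kappa: True
          show ?thesis
            by (rule classifiedI[where k = 23 and \<epsilon> = "0" and R = "[[(1, 0)], [(w24, 2), (w14, 1), (w04, 0)], [(1, 1)],
          [(w24, 4), (w14, 3), (-w12, 1)], [(1, 3)],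
          [(w24, 5), (-(w24 * w02), 4), (-(w24 * w01) - w04 * w12, 3)]]"];
                simp add: simps w13 w24 w03_eq w14 kappa field_simps; algebra)
        next
          case kappa: False
          show ?thesis
            by (rule classifiedI[where k = 10 and R = "[[(1, 0)], [(w24, 2), (w14, 1), (w04, 0)], [(\<kappa>, 1)],
          [(w24, 4), (w14, 3), (-w12, 1)], [(\<kappa>, 3)],
          [(w24, 5), (-(w24 * w02), 4), (-(w24 * w01) - w04 * w12, 3)]]"];
                simp add: simps w13 w24 w03_eq w14 kappa field_simps; algebra)
        qed
      next
        case w14: False
        show ?thesis
          by (rule classifiedI[where k = 23 and \<epsilon> = "- (w14 ^ 2)" and R = "[[(1, 0)], [(w24, 2), (w14, 1), (w04, 0)], [(1, 1), (-(\<kappa> / w14 ^ 2), 0)],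
          [(w24, 4), (w14, 3), (-w12, 1)], [(1, 3)],
          [(w24, 5), (-(w24 * w02), 4), (-(w24 * w01) - w04 * w12, 3)]]"];
              simp add: simps w13 w24 w03_eq w14 field_simps; algebra)
      qed
    qed
  next
    case w13: False
    \<comment> \<open>The determinant of the quadratic form. \<open>\<kappa>\<close> is the part
      along x_0 that is left after completing the square: if D is nonzero, a shift of x_2 along x_0
      removes it; if D = 0, it separates form 10 from form 23 with \<epsilon> = 0.\<close>
    define D where "D = w13 * w24 - w14 ^ 2"
    have w24_eq: "w24 = (D + w14 ^ 2) / w13"
      using w13 two by (simp add: D_def field_simps)
    define \<kappa> where "\<kappa> = w13 * w04 - w03 * w14"
    have w04_eq: "w04 = (\<kappa> + w03 * w14) / w13"
      using w13 two by (simp add: \<kappa>_def field_simps)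
    show ?thesis
    proof (cases "D = 0")
      case D: True
      show ?thesis
      proof (cases "\<kappa> = 0")
        case kappa: True
        show ?thesis
          by (rule classifiedI[where k = 23 and \<epsilon> = "0" and R = "[[(1, 0)], [(w13, 1), (w14, 2), (w03, 0)], [(1, 2)],
          [(w13, 3), (w14, 4), (w12, 2)], [(1, 4)],
          [(w13, 5), (-(w13 * w01), 3), (w03 * w12 - w13 * w02, 4)]]"];
              simp add: simps w13 w24_eq w04_eq D kappa field_simps; algebra)
      next
        case kappa: False
        show ?thesis
          by (rule classifiedI[where k = 10 and R = "[[(1, 0)], [(w13, 1), (w14, 2), (w03, 0)], [(\<kappa>, 2)],
          [(w13, 3), (w14, 4), (w12, 2)], [(\<kappa>, 4)],
          [(w13, 5), (-(w13 * w01), 3), (w03 * w12 - w13 * w02, 4)]]"];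
              simp add: simps w13 w24_eq w04_eq D kappa field_simps; algebra)
      qed
    next
      case D: False
      show ?thesis
        by (rule classifiedI[where k = 23 and \<epsilon> = "D" and R = "[[(1, 0)], [(w13, 1), (w14, 2), (w03, 0)], [(1, 2), (\<kappa> / D, 0)],
          [(w13, 3), (w14, 4), (w12, 2)], [(1, 4)],
          [(w13, 5), (-(w13 * w01), 3), (w03 * w12 - w13 * w02, 4)]]"];
            simp add: simps w13 w24_eq w04_eq D field_simps; algebra)
    qed
  qed
qed

text \<open>Multiples of dx_3 and dx_4 clear w01 and w03. If x_4 occurs, w02 is absorbed into x_4,
  and after rescaling only the vanishing of w12 and w13 matters: forms 12 to 15.\<close>

lemma (in six_dim) classify_E:
  assumes pre: "\<And>u v i. i < 5 \<Longrightarrow> \<beta> u v i = form_bracket [[], [], [], [(1, 0, 1)], [(1, 0, 3)]] u v i"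
  shows "classified \<beta>"
proof -
  note b = pre form_bracket_def top[unfolded top_form_def, rule_format]
  have z: "w14 = 0" "w24 = 0" "w34 = 0" "w23 = 0"
    using jac[of "unit_vec 0" "unit_vec 1" "unit_vec 3"] jac[of "unit_vec 0" "unit_vec 2" "unit_vec 3"]
      jac[of "unit_vec 0" "unit_vec 1" "unit_vec 4"] jac[of "unit_vec 0" "unit_vec 1" "unit_vec 2"]
    by (simp_all add: b unit_vec_def eq_neg_iff_add_eq_0 ac_simps)
  note simps = all_less_numeral row_map_def normal_form_def b two double_eq_0 z
  show ?thesis
  proof (cases "w04 = 0")
    case w04: True
    show ?thesis
    proof (cases "w13 = 0")
      case w13: True
      show ?thesis
      proof (cases "w12 = 0")
        case w12: True
        show ?thesis
        proof (cases "w02 = 0")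
          case w02: True
          show ?thesis
            by (rule classifiedI[where k = 4 and R = "[[(1, 0)], [(1, 1)], [(1, 2)], [(1, 5), (-w01, 3), (-w03, 4)], [(1, 3)], [(1, 4)]]"];
                simp add: simps w04 w13 w12 w02 field_simps; algebra)
        next
          case w02: False
          show ?thesis
            by (rule classifiedI[where k = 8 and R = "[[(1, 0)], [(1, 1)], [(w02, 2)], [(1, 3)], [(1, 5), (-w01, 3), (-w03, 4)],
          [(1, 4)]]"];
                simp add: simps w04 w13 w12 w02 field_simps; algebra)
        qed
      next
        case w12: False
        show ?thesis
          by (rule classifiedI[where k = 23 and \<epsilon> = "0" and R = "[[(w02, 0), (w12, 1)], [(1, 0)], [(1, 2)], [(-w12, 3)],
          [(1, 5), (-w01, 3), (-w03, 4)], [(-w12, 4)]]"];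
              simp add: simps w04 w13 w12 field_simps; algebra)
      qed
    next
      case w13: False
      \<comment> \<open>Up to multiples of dx_3 and dx_4 and a scale, dx_5 is p x_0 x_2 + 2h x_1 x_2
        + x_1 x_3, and the Pfaffian of a dx_4 + b dx_5 is 2h ab - p b^2. Its discriminant is the
        square h^2, and it vanishes identically just for form 11.\<close>
      define p where "p = w02 / w13"
      have w02_eq: "w02 = p * w13"
        using w04 w13 two by (simp add: p_def field_simps)
      define h where "h = w12 / w13 / 2"
      have w12_eq: "w12 = 2 * h * w13"
        using w04 w13 two by (simp add: h_def field_simps)
      show ?thesis
      proof (cases "p = 0")
        case p: True
        show ?thesis
        proof (cases "h = 0")
          case h: True
          show ?thesis
            by (rule classifiedI[where k = 11 and R = "[[(1, 0)], [(1, 1)], [(1, 2)], [(1, 3)], [(1, 4)],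
          [(1 / w13, 5), (-(w01 / w13), 3), (-(w03 / w13), 4)]]"];
                simp add: simps w04 w13 w02_eq w12_eq p h field_simps; algebra)
        next
          case h: False
          show ?thesis
            by (rule classifiedI[where k = 24 and \<epsilon> = "h ^ 2" and R = "[[(1, 0), (1, 1)], [(-h, 0), (h, 1)], [(2 * h, 2)],
          [(2 * h, 3), (2 * h * h, 2)],
          [(2 * h / w13, 5), (-(2 * h * w01 / w13), 3), (2 * h - 2 * h * w03 / w13, 4)],
          [(2 * h * h / w13, 5), (-(2 * h * h * w01 / w13), 3), (-(2 * h * h) - 2 * h * h * w03 / w13, 4)]]"];
                simp add: simps w04 w13 w02_eq w12_eq p h field_simps; (intro conjI)?; insert two w13 h; algebra)
        qed
      next
        case p: False
        show ?thesis
          by (rule classifiedI[where k = 24 and \<epsilon> = "h ^ 2" and R = "[[(1, 1)], [(p, 0), (h, 1)], [(-p, 2)], [(-p, 3), (-(p * h), 2)],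
          [(-(p / w13), 5), (p * w01 / w13, 3), (p * w03 / w13, 4)],
          [(-(p * h / w13), 5), (p * h * w01 / w13, 3), (p * h * w03 / w13 - p * p, 4)]]"];
              simp add: simps w04 w13 w02_eq w12_eq p field_simps; algebra)
      qed
    qed
  next
    case w04: False
    show ?thesis
    proof (cases "w13 = 0")
      case w13: True
      show ?thesis
      proof (cases "w12 = 0")
        case w12: True
        show ?thesis
          by (rule classifiedI[where k = 12 and R = "[[(1, 0)], [(w04, 1)], [(1, 2)], [(w04, 3)], [(w04, 4), (w02, 2)],
          [(1, 5), (-w01, 3), (-w03, 4)]]"];
              simp add: simps w04 w13 w12 field_simps; algebra)
      next
        case w12: False
        show ?thesis
          by (rule classifiedI[where k = 13 and R = "[[(1, 0)], [(w04, 1)], [(w12 / w04, 2)], [(w04, 3)], [(w04, 4), (w02, 2)],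
          [(1, 5), (-w01, 3), (-w03, 4)]]"];
              simp add: simps w04 w13 w12 field_simps; algebra)
      qed
    next
      case w13: False
      show ?thesis
      proof (cases "w12 = 0")
        case w12: True
        show ?thesis
          \<comment> \<open>The scale factors of x_3, x_4 and x_5 are forced by dx_3, dx_4 and the
            x_0 x_4 term; those of x_0 and x_1 are chosen so that the x_1 x_3 term also gets
            coefficient 1.\<close>
          by (rule classifiedI[where k = 14 and R = "[[(w04, 0)], [(w04 * w13, 1)], [(1, 2)], [(w04 ^ 2 * w13, 3)],
          [(w04 ^ 3 * w13, 4), (w04 ^ 2 * w13 * w02, 2)],
          [(w04 ^ 3 * w13, 5), (-(w04 ^ 3 * w13 * w01), 3), (-(w04 ^ 3 * w13 * w03), 4)]]"];
              simp add: simps w04 w13 w12 field_simps; algebra)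
      next
        case w12: False
        show ?thesis
          by (rule classifiedI[where k = 15 and R = "[[(w04, 0)], [(w04 * w13, 1)], [(w04 ^ 2 * w12, 2)], [(w04 ^ 2 * w13, 3)],
          [(w04 ^ 3 * w13, 4), (w04 ^ 2 * w13 * w02, 2)],
          [(w04 ^ 3 * w13, 5), (-(w04 ^ 3 * w13 * w01), 3), (-(w04 ^ 3 * w13 * w03), 4)]]"];
              simp add: simps w04 w13 w12 field_simps; algebra)
      qed
    qed
  qed
qed

text \<open>A multiple of dx_4 = x_0 x_3 + x_1 x_2 clears w03, and g is the coefficient of x_1 x_2
  that remains. If x_4 occurs, Jacobi couples x_0 x_4 with - x_2 x_3, and every other term can be
  absorbed.\<close>

lemma (in six_dim) classify_F:
  assumes pre: "\<And>u v i. i < 5 \<Longrightarrow> \<beta> u v i = form_bracket [[], [], [], [(1, 0, 1)], [(1, 0, 3), (1, 1, 2)]] u v i"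
  shows "classified \<beta>"
proof -
  note b = pre form_bracket_def top[unfolded top_form_def, rule_format]
  have z: "w23 = - w04" "w14 = 0" "w24 = 0" "w34 = 0"
    using jac[of "unit_vec 0" "unit_vec 1" "unit_vec 2"] jac[of "unit_vec 0" "unit_vec 1" "unit_vec 3"]
      jac[of "unit_vec 0" "unit_vec 2" "unit_vec 3"] jac[of "unit_vec 0" "unit_vec 1" "unit_vec 4"]
    by (simp_all add: b unit_vec_def eq_neg_iff_add_eq_0 ac_simps)
  note simps = all_less_numeral row_map_def normal_form_def b two double_eq_0 z
  define g where "g = w12 - w03"
  have w12_eq: "w12 = g + w03"
    using two by (simp add: g_def field_simps)
  show ?thesis
  proof (cases "w04 = 0")
    case w04: True
    show ?thesis
    proof (cases "w13 = 0")
      case w13: True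
      show ?thesis
      proof (cases "g = 0")
        case g: True
        show ?thesis
        proof (cases "w02 = 0")
          case w02: True
          show ?thesis
            by (rule classifiedI[where k = 5 and R = "[[(1, 0)], [(1, 1)], [(1, 5), (-w01, 3), (-w03, 4)], [(1, 2)], [(1, 3)], [(1, 4)]]"];
                simp add: simps w12_eq w04 w13 g w02 field_simps; algebra)
        next
          case w02: False
          show ?thesis
            by (rule classifiedI[where k = 9 and R = "[[(1, 0)], [(1, 1)], [(1, 2)], [(1, 3)],
          [(1 / w02, 5), (-(w01 / w02), 3), (-(w03 / w02), 4)], [(1, 4)]]"];
                simp add: simps w12_eq w04 w13 g w02 field_simps; algebra)
        qed
      next
        case g: False
        show ?thesis
          by (rule classifiedI[where k = 23 and \<epsilon> = "0" and R = "[[(w02, 0), (g, 1)], [(1, 0)], [(1, 2)], [(-g, 3), (w02, 2)],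
          [(1, 5), (-w01, 3), (-w03, 4)], [(1, 5), (-w01, 3), (-w03 - g, 4)]]"];
              simp add: simps w12_eq w04 w13 g field_simps; algebra)
      qed
    next
      case w13: False
      \<comment> \<open>After clearing w01 and w03 and dividing by w13, the Pfaffian of a dx_4 + b
        dx_5 is a^2 + 2h ab - p b^2 = (a + hb)^2 - (h^2 + p) b^2, with h as defined below.\<close>
      define p where "p = w02 / w13"
      have w02_eq: "w02 = p * w13"
        using w04 w13 two by (simp add: p_def field_simps)
      define h where "h = g / w13 / 2"
      have g_eq: "g = 2 * h * w13"
        using w04 w13 two by (simp add: h_def field_simps)
      show ?thesis
        by (rule classifiedI[where k = 24 and \<epsilon> = "h ^ 2 + p" and R = "[[(1, 0)], [(-h, 0), (1, 1)], [(1, 2)], [(1, 3), (h, 2)], [(1, 4)],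
          [(1 / w13, 5), (-(w01 / w13), 3), (-(w03 / w13) - h, 4)]]"];
            simp add: simps w12_eq w04 w13 w02_eq g_eq field_simps; algebra)
    qed
  next
    case w04: False
    define s where "s = g / w04 / 2"
    have g_eq: "g = 2 * s * w04"
      using w04 two by (simp add: s_def field_simps)
    show ?thesis
      by (rule classifiedI[where k = 16 and R = "[[(1, 0)], [(1, 1)], [(1, 2), (s, 0), (-(w13 / w04), 1)], [(1, 3)],
          [(1, 4), (-s, 3), (w02 / w04, 2)],
          [(1 / w04, 5), (-(2 * s + w03 / w04), 4), (-(w01 / w04), 3)]]"];
          simp add: simps w12_eq w04 g_eq field_simps; algebra)
  qed
qed

text \<open>As w13 = w04, dx_5 amounts to the quadratic form w03 X^2 + 2 w04 XY + w14 Y^2 on the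
  span of x_0 and x_1. Up to a square its determinant is \<epsilon>; form 11 is the case of the zero
  form.\<close>

lemma (in six_dim) classify_G:
  assumes pre: "\<And>u v i. i < 5 \<Longrightarrow> \<beta> u v i = form_bracket [[], [], [(1, 0, 1)], [(1, 0, 2)], [(1, 1, 2)]] u v i"
  shows "classified \<beta>"
proof -
  note b = pre form_bracket_def top[unfolded top_form_def, rule_format]
  have z: "w13 = w04" "w23 = 0" "w24 = 0" "w34 = 0"
    using jac[of "unit_vec 0" "unit_vec 1" "unit_vec 2"] jac[of "unit_vec 0" "unit_vec 1" "unit_vec 3"]
      jac[of "unit_vec 0" "unit_vec 1" "unit_vec 4"] jac[of "unit_vec 0" "unit_vec 2" "unit_vec 4"]
    by (simp_all add: b unit_vec_def eq_neg_iff_add_eq_0 ac_simps)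
  note simps = all_less_numeral row_map_def normal_form_def b two double_eq_0 z
  show ?thesis
  proof (cases "w03 = 0")
    case w03: True
    show ?thesis
    proof (cases "w14 = 0")
      case w14: True
      show ?thesis
      proof (cases "w04 = 0")
        case w04: True
        show ?thesis
          by (rule classifiedI[where k = 11 and R = "[[(1, 0)], [(1, 1)], [(1, 5), (-w01, 2), (-w02, 3), (-w12, 4)], [(1, 2)],
          [(1, 3)], [(1, 4)]]"];
              simp add: simps w03 w14 w04 field_simps; algebra)
      next
        case w04: False
        show ?thesis
          by (rule classifiedI[where k = 25 and \<epsilon> = "-1" and R = "[[(1, 0), (1, 1)], [(1, 1), (-1, 0)], [(2, 2)], [(2, 3), (2, 4)],
          [(2, 4), (-2, 3)],
          [(4 / w04, 5), (-(4 / w04 * w01), 2), (-(4 / w04 * w02), 3), (-(4 / w04 * w12), 4)]]"];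
              simp add: simps w03 w14 w04 field_simps; algebra)
      qed
    next
      case w14: False
      show ?thesis
        by (rule classifiedI[where k = 25 and \<epsilon> = "- (w04 ^ 2)" and R = "[[(w14, 1), (w04, 0)], [(-1, 0)], [(w14, 2)], [(w14 ^ 2, 4), (w14 * w04, 3)],
          [(-w14, 3)],
          [(w14 ^ 2, 5), (-(w14 ^ 2 * w01), 2), (-(w14 ^ 2 * w02), 3), (-(w14 ^ 2 * w12), 4)]]"];
            simp add: simps w03 w14 field_simps; algebra)
    qed
  next
    case w03: False
    show ?thesis
      by (rule classifiedI[where k = 25 and \<epsilon> = "w03 * w14 - w04 ^ 2" and R = "[[(w03, 0), (w04, 1)], [(1, 1)], [(w03, 2)], [(w03 ^ 2, 3), (w03 * w04, 4)],
          [(w03, 4)],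
          [(w03 ^ 2, 5), (-(w03 ^ 2 * w01), 2), (-(w03 ^ 2 * w02), 3), (-(w03 ^ 2 * w12), 4)]]"];
          simp add: simps w03 field_simps; algebra)
  qed
qed

text \<open>dx_2, dx_3, dx_4 clear w01, w02, w03. An x_1 x_4 term is accompanied by - x_2 x_3 and
  leads to form 19; otherwise it only matters which of w04 and w12 vanish.\<close>

lemma (in six_dim) classify_H:
  assumes pre: "\<And>u v i. i < 5 \<Longrightarrow> \<beta> u v i = form_bracket [[], [], [(1, 0, 1)], [(1, 0, 2)], [(1, 0, 3)]] u v i"
  shows "classified \<beta>"
proof -
  note b = pre form_bracket_def top[unfolded top_form_def, rule_format]
  have z: "w13 = 0" "w23 = - w14" "w24 = 0" "w34 = 0"
    using jac[of "unit_vec 0" "unit_vec 1" "unit_vec 2"] jac[of "unit_vec 0" "unit_vec 1" "unit_vec 3"]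
      jac[of "unit_vec 0" "unit_vec 1" "unit_vec 4"] jac[of "unit_vec 0" "unit_vec 2" "unit_vec 4"]
    by (simp_all add: b unit_vec_def eq_neg_iff_add_eq_0 ac_simps)
  note simps = all_less_numeral row_map_def normal_form_def b two double_eq_0 z
  show ?thesis
  proof (cases "w14 = 0")
    case w14: True
    show ?thesis
    proof (cases "w04 = 0")
      case w04: True
      show ?thesis
      proof (cases "w12 = 0")
        case w12: True
        show ?thesis
          by (rule classifiedI[where k = 12 and R = "[[(1, 0)], [(1, 1)], [(1, 5), (-w01, 2), (-w02, 3), (-w03, 4)], [(1, 2)],
          [(1, 3)], [(1, 4)]]"];
              simp add: simps w14 w04 w12 field_simps; algebra)
      next
        case w12: False
        show ?thesis
          by (rule classifiedI[where k = 25 and \<epsilon> = "0" and R = "[[(1, 0)], [(1, 1)], [(1, 2)], [(1, 3)],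
          [(1 / w12, 5), (-(w01 / w12), 2), (-(w02 / w12), 3), (-(w03 / w12), 4)],
          [(1, 4)]]"];
              simp add: simps w14 w04 w12 field_simps; algebra)
      qed
    next
      case w04: False
      show ?thesis
      proof (cases "w12 = 0")
        case w12: True
        show ?thesis
          by (rule classifiedI[where k = 17 and R = "[[(1, 0)], [(1, 1)], [(1, 2)], [(1, 3)], [(1, 4)],
          [(1 / w04, 5), (-(w01 / w04), 2), (-(w02 / w04), 3), (-(w03 / w04), 4)]]"];
              simp add: simps w14 w04 w12 field_simps; algebra)
      next
        case w12: False
        show ?thesis
          by (rule classifiedI[where k = 18 and R = "[[(w04, 0)], [(w04 ^ 2 * w12, 1)], [(w04 ^ 3 * w12, 2)], [(w04 ^ 4 * w12, 3)],
          [(w04 ^ 5 * w12, 4)],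
          [(w04 ^ 5 * w12, 5), (-(w04 ^ 5 * w12 * w01), 2), (-(w04 ^ 5 * w12 * w02), 3), (-(w04 ^ 5 * w12 * w03), 4)]]"];
              simp add: simps w14 w04 w12 field_simps; algebra)
      qed
    qed
  next
    case w14: False
    define a where "a = w04 / w14"
    have w04_eq: "w04 = a * w14"
      using w14 two by (simp add: a_def field_simps)
    \<comment> \<open>The shifts x_3 + t x_1 and x_4 + t x_2 both contribute to the x_1 x_2 term of
      x_1 x_4 - x_2 x_3, hence the division by 2.\<close>
    define t where "t = w12 / w14 / 2"
    have w12_eq: "w12 = 2 * t * w14"
      using w14 two by (simp add: t_def field_simps)
    show ?thesis
      by (rule classifiedI[where k = 19 and R = "[[(1, 0)], [(1, 1), (a, 0)], [(1, 2)], [(1, 3), (t, 1)], [(1, 4), (t, 2)],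
          [(1 / w14, 5), (-(w01 / w14), 2), (a * t - w02 / w14, 3), (-(w03 / w14), 4)]]"];
          simp add: simps w14 w04_eq w12_eq field_simps; algebra)
  qed
qed

lemma (in six_dim) classify_I:
  assumes pre: "\<And>u v i. i < 5 \<Longrightarrow> \<beta> u v i = form_bracket [[], [], [(1, 0, 1)], [(1, 0, 2)], [(1, 0, 3), (1, 1, 2)]] u v i"
  shows "classified \<beta>"
proof -
  note b = pre form_bracket_def top[unfolded top_form_def, rule_format]
  have z: "w13 = w04" "w23 = - w14" "w24 = 0" "w34 = 0"
    using jac[of "unit_vec 0" "unit_vec 1" "unit_vec 2"] jac[of "unit_vec 0" "unit_vec 1" "unit_vec 3"]
      jac[of "unit_vec 0" "unit_vec 1" "unit_vec 4"] jac[of "unit_vec 0" "unit_vec 2" "unit_vec 4"]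
    by (simp_all add: b unit_vec_def eq_neg_iff_add_eq_0 ac_simps)
  note simps = all_less_numeral row_map_def normal_form_def b two double_eq_0 z
  define g where "g = w12 - w03"
  have w12_eq: "w12 = g + w03"
    using two by (simp add: g_def field_simps)
  show ?thesis
  proof (cases "w14 = 0")
    case w14: True
    show ?thesis
    proof (cases "w04 = 0")
      case w04: True
      show ?thesis
      proof (cases "g = 0")
        case g: True
        show ?thesis
          by (rule classifiedI[where k = 14 and R = "[[(1, 0)], [(1, 1)], [(1, 5), (-w01, 2), (-w02, 3), (-w03, 4)], [(1, 2)],
          [(1, 3)], [(1, 4)]]"];
              simp add: simps w12_eq w14 w04 g field_simps; algebra)
      next
        case g: False
        show ?thesis
          by (rule classifiedI[where k = 25 and \<epsilon> = "0" and R = "[[(1, 0)], [(1, 1)], [(1, 2)], [(1, 3)],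
          [(1 / g, 5), (-(w01 / g), 2), (-(w02 / g), 3), (-(w03 / g), 4)],
          [(-(1 / g), 5), (w01 / g, 2), (w02 / g, 3), (1 + w03 / g, 4)]]"];
              simp add: simps w12_eq w14 w04 g field_simps; algebra)
      qed
    next
      case w04: False
      define a where "a = -(g / w04 / 2)"
      have g_eq: "g = - (2 * a * w04)"
        using w14 w04 two by (simp add: a_def field_simps)
      show ?thesis
        by (rule classifiedI[where k = 20 and R = "[[(1, 0)], [(1, 1), (a, 0)], [(1, 2)], [(1, 3)], [(1, 4), (a, 3)],
          [(1 / w04, 5), (-(w01 / w04), 2), (-(w02 / w04), 3), (2 * a - w03 / w04, 4)]]"];
            simp add: simps w12_eq w14 w04 g_eq field_simps; algebra)
    qed
  next
    case w14: False
    define a where "a = w04 / w14"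
    have w04_eq: "w04 = a * w14"
      using w14 two by (simp add: a_def field_simps)
    \<comment> \<open>The shift of x_1 by a x_0 creates a^2 x_0 x_3. Matching it with a multiple of
      dx_4 adds a^2 to the coefficient of x_1 x_2, which r then absorbs, again with multiplicity
      two.\<close>
    define r where "r = (g / w14 + a ^ 2) / 2"
    have g_eq: "g = (2 * r - a ^ 2) * w14"
      using w14 two by (simp add: r_def field_simps)
    show ?thesis
      by (rule classifiedI[where k = 21 and R = "[[(1, 0)], [(1, 1), (a, 0)], [(1, 2)], [(1, 3), (r, 1)],
          [(1, 4), (a, 3), (r, 2)],
          [(1 / w14, 5), (-(w01 / w14), 2), (a * r - w02 / w14, 3), (a ^ 2 - w03 / w14, 4)]]"];
          simp add: simps w12_eq w14 w04_eq g_eq field_simps; algebra)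
  qed
qed

text \<open>The nine nilpotent Lie algebras of dimension five, in the order of the letters A to I
  above; \<open>four_dim_form\<close> lists the three of dimension four.\<close>

definition five_dim_form :: "nat \<Rightarrow> ('k::field \<times> nat \<times> nat) list list" where
  "five_dim_form k = [] # [] # [
     [[], [], []],
     [[], [], [(1, 0, 1)]],
     [[], [], [(1, 0, 1), (1, 2, 3)]],
     [[], [(1, 0, 1)], [(1, 0, 2)]],
     [[], [(1, 0, 1)], [(1, 0, 3)]],
     [[], [(1, 0, 1)], [(1, 0, 3), (1, 1, 2)]],
     [[(1, 0, 1)], [(1, 0, 2)], [(1, 1, 2)]],
     [[(1, 0, 1)], [(1, 0, 2)], [(1, 0, 3)]],
     [[(1, 0, 1)], [(1, 0, 2)], [(1, 0, 3), (1, 1, 2)]]] ! k"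

definition four_dim_form :: "nat \<Rightarrow> ('k::field \<times> nat \<times> nat) list list" where
  "four_dim_form k = [] # [] # [[[], []], [[], [(1, 0, 1)]], [[(1, 0, 1)], [(1, 0, 2)]]] ! k"

text \<open>While the earlier rows vanish, every permutation of the first n coordinates is an
  admissible change, so a nonzero coefficient can be moved to x_0 x_1.\<close>

lemma abelian_prefix_swap:
  fixes \<beta> :: "'k::field bracket"
  assumes nil: "nilpotent m \<beta>" and "n < m" and ab: "\<And>u v i. i < n \<Longrightarrow> \<beta> u v i = 0"
    and pq: "p < n" "q < n" "p \<noteq> q" and nz: "\<beta> (unit_vec p) (unit_vec q) n \<noteq> 0"
  obtains \<beta>' where "nilpotent m \<beta>'" "lie_iso m \<beta> \<beta>'" "\<And>u v i. i < n \<Longrightarrow> \<beta>' u v i = 0"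
    "\<beta>' (unit_vec 0) (unit_vec 1) n \<noteq> 0"
proof -
  define s where "s a b i = (if i = a then b else if i = b then a else i)" for a b i :: nat
  \<comment> \<open>r is where the transposition of 0 and p puts q. Composing it with the
    transposition of 1 and r sends 0 to p and 1 to q, even if p or q is itself 0 or 1.\<close>
  define r where "r = s 0 p q"
  define \<sigma> where "\<sigma> i = s 0 p (s 1 r i)" for i
  have ss: "s a b (s a b i) = i" for a b i by (simp add: s_def)
  have r: "r < n" "r \<noteq> 0" and n: "0 < n" "1 < n" using pq by (auto simp: r_def s_def)
  have s_less: "s a b i < n" if "a < n" "b < n" "i < n" for a b i using that by (simp add: s_def)
  have \<sigma>: "\<sigma> 0 = p" "\<sigma> 1 = q" using r pq by (auto simp: \<sigma>_def s_def r_def)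
  have \<sigma>_less: "\<sigma> i < n" if "i < n" for i using s_less that pq r n by (simp add: \<sigma>_def)
  have \<sigma>_eq: "\<sigma> i = \<sigma> j \<longleftrightarrow> i = j" for i j unfolding \<sigma>_def by (metis ss)
  define F :: "(nat \<Rightarrow> 'k) \<Rightarrow> nat \<Rightarrow> 'k" where "F u i = (if i < n then u (\<sigma> i) else u i)" for u i
  have "\<exists>\<beta>'. nilpotent m \<beta>' \<and> lie_hom m F \<beta> \<beta>' \<and> lie_iso m \<beta> \<beta>' \<and> (\<forall>u v. \<forall>i<n. \<beta>' u v i = (\<lambda>_ _ _. 0) u v i)"
  proof (rule change_coordinates[OF nil])
    show "linear_map n F" unfolding linear_map_def linear_form_def F_def using \<sigma>_less by auto
    show "injective_map n F"
      unfolding injective_map_def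
    proof (intro allI impI)
      fix u :: "nat \<Rightarrow> 'k" and i assume u: "\<forall>i<n. F u i = 0" and i: "i < n"
      have "s 1 r (s 0 p i) < n" using s_less pq r n i by simp
      moreover have "\<sigma> (s 1 r (s 0 p i)) = i" by (simp add: \<sigma>_def ss)
      ultimately show "u i = 0" using u unfolding F_def by metis
    qed
    show "F (\<beta> u v) i = 0" if "i < n" for u v i using that ab \<sigma>_less by (simp add: F_def)
    show "alternating i (\<lambda>(u::nat \<Rightarrow> 'k) v. 0)" for i by (simp add: alternating_def linear_form_def)
  qed (use \<open>n < m\<close> in \<open>auto simp: F_def\<close>)
  then obtain \<beta>' where \<beta>': "nilpotent m \<beta>'" "lie_hom m F \<beta> \<beta>'" "lie_iso m \<beta> \<beta>'"
    "\<And>u v i. i < n \<Longrightarrow> \<beta>' u v i = 0" by auto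
  have F_unit: "F (unit_vec (\<sigma> k)) = unit_vec k" if "k < n" for k
    using that \<sigma>_less[OF that] by (auto simp: F_def unit_vec_def fun_eq_iff \<sigma>_eq)
  have "F (\<beta> (unit_vec p) (unit_vec q)) n = \<beta>' (F (unit_vec p)) (F (unit_vec q)) n"
    using \<beta>'(2) \<open>n < m\<close> by (simp add: lie_hom_def)
  moreover have "F (unit_vec p) = unit_vec 0" "F (unit_vec q) = unit_vec 1"
    using F_unit[OF n(1)] F_unit[OF n(2)] unfolding \<sigma> .
  ultimately have "\<beta>' (unit_vec 0) (unit_vec 1) n \<noteq> 0" using nz by (simp add: F_def)
  with \<beta>' show thesis using that by blast
qed

lemma abelian_prefix_swap_or_zero:
  fixes \<beta> :: "'k::field bracket"
  assumes nil: "nilpotent m \<beta>" and "n < m" and ab: "\<And>u v i. i < n \<Longrightarrow> \<beta> u v i = 0"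
  obtains "\<And>u v. \<beta> u v n = 0"
  | \<beta>' where "nilpotent m \<beta>'" "lie_iso m \<beta> \<beta>'" "\<And>u v i. i < n \<Longrightarrow> \<beta>' u v i = 0"
    "\<beta>' (unit_vec 0) (unit_vec 1) n \<noteq> 0"
proof (cases "\<forall>q<n. \<forall>p<q. \<beta> (unit_vec p) (unit_vec q) n = 0")
  case True
  have "alternating n (\<lambda>u v. \<beta> u v n)" using nil \<open>n < m\<close> by (simp add: nilpotent_def)
  from alternating_expand[OF this] show thesis using True that(1) by simp
next
  case False
  then obtain p q where "p < q" "q < n" "\<beta> (unit_vec p) (unit_vec q) n \<noteq> 0" by blast
  then show thesis using abelian_prefix_swap[OF assms, of p q] that(2) by fastforce
qed

text \<open>A hyperbolic plane is split off: new x_0 and x_1 absorb all terms containing them. What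
  remains is p x_2 x_3 + q x_2 x_4 + r x_3 x_4, and a 2-form in three variables is decomposable, so
  the rank is two or four: forms 1 and 2.\<close>

lemma (in six_dim) classify_A_nonzero:
  assumes pre: "\<And>u v i. i < 5 \<Longrightarrow> \<beta> u v i = 0" and w01: "w01 \<noteq> 0"
  shows "classified \<beta>"
proof -
  note simps = all_less_numeral row_map_def normal_form_def pre form_bracket_def
    top[unfolded top_form_def, rule_format]
  define p where "p = w23 + (w03 * w12 - w13 * w02) / w01"
  have w23_eq: "w23 = p - (w03 * w12 - w13 * w02) / w01"
    using w01 two by (simp add: p_def field_simps)
  define q where "q = w24 + (w12 * w04 - w14 * w02) / w01"
  have w24_eq: "w24 = q - (w12 * w04 - w14 * w02) / w01"
    using w01 two by (simp add: q_def field_simps)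
  define r where "r = w34 + (w13 * w04 - w14 * w03) / w01"
  have w34_eq: "w34 = r - (w13 * w04 - w14 * w03) / w01"
    using w01 two by (simp add: r_def field_simps)
  show ?thesis
  proof (cases "p = 0")
    case p: True
    show ?thesis
    proof (cases "q = 0")
      case q: True
      show ?thesis
      proof (cases "r = 0")
        case r: True
        show ?thesis
          by (rule classifiedI[where k = 1 and R = "[[(w01, 0), (-w12, 2), (-w13, 3), (-w14, 4)],
          [(1, 1), (w02 / w01, 2), (w03 / w01, 3), (w04 / w01, 4)], [(1, 2)], [(1, 3)],
          [(1, 4)], [(1, 5)]]"];
              simp add: simps w01 w23_eq w24_eq w34_eq p q r field_simps; algebra)
      next
        case r: False
        show ?thesis
          by (rule classifiedI[where k = 2 and R = "[[(w01, 0), (-w12, 2), (-w13, 3), (-w14, 4)],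
          [(1, 1), (w02 / w01, 2), (w03 / w01, 3), (w04 / w01, 4)], [(r, 3)], [(1, 4)],
          [(1, 2)], [(1, 5)]]"];
              simp add: simps w01 w23_eq w24_eq w34_eq p q r field_simps; algebra)
      qed
    next
      case q: False
      show ?thesis
        by (rule classifiedI[where k = 2 and R = "[[(w01, 0), (-w12, 2), (-w13, 3), (-w14, 4)],
          [(1, 1), (w02 / w01, 2), (w03 / w01, 3), (w04 / w01, 4)], [(q, 2), (r, 3)],
          [(1, 4)], [(1, 3)], [(1, 5)]]"];
            simp add: simps w01 w23_eq w24_eq w34_eq p q field_simps; algebra)
    qed
  next
    case p: False
    show ?thesis
      by (rule classifiedI[where k = 2 and R = "[[(w01, 0), (-w12, 2), (-w13, 3), (-w14, 4)],
          [(1, 1), (w02 / w01, 2), (w03 / w01, 3), (w04 / w01, 4)], [(p, 2), (-r, 4)],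
          [(1, 3), (q / p, 4)], [(1, 4)], [(1, 5)]]"];
          simp add: simps w01 w23_eq w24_eq w34_eq p field_simps; algebra)
  qed
qed

lemma classify_five:
  fixes \<beta> :: "'k::field bracket"
  assumes two: "(2::'k) \<noteq> 0" and nil: "nilpotent 6 \<beta>"
    and pre: "\<And>u v i. i < 5 \<Longrightarrow> \<beta> u v i = form_bracket (five_dim_form k) u v i" and "k < 9"
  shows "classified \<beta>"
proof -
  obtain w01 w02 w03 w04 w12 w13 w14 w23 w24 w34 where
    "top_form \<beta> w01 w02 w03 w04 w12 w13 w14 w23 w24 w34" using top_formE[OF nil] by blast
  then interpret six_dim \<beta> w01 w02 w03 w04 w12 w13 w14 w23 w24 w34
    using two nil by unfold_locales
  consider "k = 0" | "k = 1" | "k = 2" | "k = 3" | "k = 4" | "k = 5" | "k = 6" | "k = 7" | "k = 8"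
    using \<open>k < 9\<close> by linarith
  then show ?thesis
  proof cases
    case 1
    have ab: "\<beta> u v i = 0" if "i < 5" for u v i
    proof -
      have "i \<in> {0, 1, 2, 3, 4}" using that by auto
      then show ?thesis by (auto simp: pre 1 form_bracket_def five_dim_form_def)
    qed
    show ?thesis
    proof (rule abelian_prefix_swap_or_zero[OF nil _ ab])
      assume "\<And>u v. \<beta> u v 5 = 0"
      then show ?thesis
        by (intro classifiedI[where k = 0 and R = "[[(1, 0)], [(1, 1)], [(1, 2)], [(1, 3)], [(1, 4)], [(1, 5)]]"])
           (simp_all add: ab row_map_def normal_form_def form_bracket_def)
    next
      fix \<beta>' :: "'k bracket"
      assume \<beta>': "nilpotent 6 \<beta>'" "lie_iso 6 \<beta> \<beta>'" "\<And>u v i. i < 5 \<Longrightarrow> \<beta>' u v i = 0"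
        "\<beta>' (unit_vec 0) (unit_vec 1) 5 \<noteq> 0"
      obtain w01 w02 w03 w04 w12 w13 w14 w23 w24 w34 where
        w: "top_form \<beta>' w01 w02 w03 w04 w12 w13 w14 w23 w24 w34" using top_formE[OF \<beta>'(1)] by blast
      have "w01 \<noteq> 0" using \<beta>'(4) w by (simp add: top_form_def unit_vec_def)
      moreover have "six_dim \<beta>' w01 w02 w03 w04 w12 w13 w14 w23 w24 w34"
        using two \<beta>'(1) w by unfold_locales
      ultimately show ?thesis
        using six_dim.classify_A_nonzero \<beta>'(3) lie_iso_classified[OF \<beta>'(2)] by blast
    qed simp_all
  next
    case 2
    show ?thesis by (rule classify_B) (use pre in \<open>simp add: 2 five_dim_form_def\<close>)
  next
    case 3
    show ?thesis by (rule classify_C) (use pre in \<open>simp add: 3 five_dim_form_def\<close>)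
  next
    case 4
    show ?thesis by (rule classify_D) (use pre in \<open>simp add: 4 five_dim_form_def\<close>)
  next
    case 5
    show ?thesis by (rule classify_E) (use pre in \<open>simp add: 5 five_dim_form_def\<close>)
  next
    case 6
    show ?thesis by (rule classify_F) (use pre in \<open>simp add: 6 five_dim_form_def\<close>)
  next
    case 7
    show ?thesis by (rule classify_G) (use pre in \<open>simp add: 7 five_dim_form_def\<close>)
  next
    case 8
    show ?thesis by (rule classify_H) (use pre in \<open>simp add: 8 five_dim_form_def\<close>)
  next
    case 9
    show ?thesis by (rule classify_I) (use pre in \<open>simp add: 9 five_dim_form_def\<close>)
  qed
qed

lemma five_dim_form_nilpotent:
  assumes "k < 9"
  shows "length (five_dim_form k) = 5" "\<forall>i<5. \<forall>(c, p, q)\<in>set (five_dim_form k ! i). p < i \<and> q < i"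
proof -
  have "\<forall>k<9. length (five_dim_form k) = 5 \<and> (\<forall>i<5. \<forall>(c, p, q)\<in>set (five_dim_form k ! i). p < i \<and> q < i)"
    by (simp add: all_less_numeral five_dim_form_def)
  then show "length (five_dim_form k) = 5" "\<forall>i<5. \<forall>(c, p, q)\<in>set (five_dim_form k ! i). p < i \<and> q < i"
    using assms by blast+
qed

text \<open>The counterpart of \<open>classifiedI\<close> one dimension lower: a matrix on the first
  five coordinates suffices, because the new coefficients of the sixth need not be known for
  \<open>classify_five\<close> to apply.\<close>

lemma five_dim_formI:
  fixes \<beta> :: "'k::field bracket"
  assumes two: "(2::'k) \<noteq> 0" and nil: "nilpotent 6 \<beta>"
    and k: "k < 9" and R: "length R = 5" "\<forall>r\<in>set R. \<forall>(c, j)\<in>set r. j < 5"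
    and inj: "\<And>u. row_map R u 0 = 0 \<Longrightarrow> row_map R u 1 = 0 \<Longrightarrow> row_map R u 2 = 0 \<Longrightarrow> row_map R u 3 = 0 \<Longrightarrow> row_map R u 4 = 0 \<Longrightarrow>
      u 0 = 0 \<and> u 1 = 0 \<and> u 2 = 0 \<and> u 3 = 0 \<and> u 4 = 0"
    and "\<And>u v. row_map R (\<beta> u v) 0 = form_bracket (five_dim_form k) (row_map R u) (row_map R v) 0"
      "\<And>u v. row_map R (\<beta> u v) 1 = form_bracket (five_dim_form k) (row_map R u) (row_map R v) 1"
      "\<And>u v. row_map R (\<beta> u v) 2 = form_bracket (five_dim_form k) (row_map R u) (row_map R v) 2"
      "\<And>u v. row_map R (\<beta> u v) 3 = form_bracket (five_dim_form k) (row_map R u) (row_map R v) 3"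
      "\<And>u v. row_map R (\<beta> u v) 4 = form_bracket (five_dim_form k) (row_map R u) (row_map R v) 4"
  shows "classified \<beta>"
proof -
  have all: "(\<forall>i<5. P i) \<longleftrightarrow> P 0 \<and> P 1 \<and> P 2 \<and> P 3 \<and> P (4::nat)" for P
    by (auto simp: all_less_numeral)
  have "\<exists>\<beta>'. nilpotent 6 \<beta>' \<and> lie_iso 6 \<beta> \<beta>' \<and> (\<forall>u v. \<forall>i<5. \<beta>' u v i = form_bracket (five_dim_form k) u v i)"
  proof (rule nilpotent_prefix[OF nil _ R five_dim_form_nilpotent[OF k]])
    show "\<forall>i<5. row_map R (\<beta> u v) i = form_bracket (five_dim_form k) (row_map R u) (row_map R v) i" for u v
      unfolding all using assms(7-11) by blast
    show "\<forall>i<5. row_map R u i = 0 \<Longrightarrow> \<forall>i<5. u i = 0" for u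
      unfolding all using inj by blast
  qed simp
  then show ?thesis using classify_five[OF two _ _ k] lie_iso_classified by blast
qed

section \<open>Normalising the first coordinates up to dimension five\<close>

lemma classify_4A_nonzero:
  fixes \<beta> :: "'k::field bracket"
  assumes two: "(2::'k) \<noteq> 0" and nil: "nilpotent 6 \<beta>"
    and pre: "\<And>u v i. i < 4 \<Longrightarrow> \<beta> u v i = 0" and nz: "\<beta> (unit_vec 0) (unit_vec 1) 4 \<noteq> 0"
  shows "classified \<beta>"
proof -
  have "alternating 4 (\<lambda>u v. \<beta> u v 4)" using nil by (simp add: nilpotent_def)
  then obtain w01 w02 w03 w12 w13 w23 where w: "\<And>u v. \<beta> u v 4 =
      w01 * (u 0 * v 1 - u 1 * v 0) + w02 * (u 0 * v 2 - u 2 * v 0) + w03 * (u 0 * v 3 - u 3 * v 0)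
      + w12 * (u 1 * v 2 - u 2 * v 1) + w13 * (u 1 * v 3 - u 3 * v 1) + w23 * (u 2 * v 3 - u 3 * v 2)"
    by (rule alternating_4E) blast
  have w01: "w01 \<noteq> 0" using nz by (simp add: w unit_vec_def)
  note simps = all_less_numeral row_map_def five_dim_form_def pre form_bracket_def w
  define p where "p = w23 + (w03 * w12 - w13 * w02) / w01"
  have w23_eq: "w23 = p - (w03 * w12 - w13 * w02) / w01"
    using w01 two by (simp add: p_def field_simps)
  show ?thesis
  proof (cases "p = 0")
    case p: True
    show ?thesis
      by (rule five_dim_formI[OF two nil, where k = 1 and R = "[[(w01, 0), (-w12, 2), (-w13, 3)], [(1, 1), (w02 / w01, 2), (w03 / w01, 3)],
          [(1, 2)], [(1, 3)], [(1, 4)]]"];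
          simp add: simps w01 w23_eq p field_simps; algebra)
  next
    case p: False
    show ?thesis
      by (rule five_dim_formI[OF two nil, where k = 2 and R = "[[(w01, 0), (-w12, 2), (-w13, 3)], [(1, 1), (w02 / w01, 2), (w03 / w01, 3)],
          [(p, 2)], [(1, 3)], [(1, 4)]]"];
          simp add: simps w01 w23_eq p field_simps; algebra)
  qed
qed

lemma classify_4B:
  fixes \<beta> :: "'k::field bracket"
  assumes two: "(2::'k) \<noteq> 0" and nil: "nilpotent 6 \<beta>"
    and pre: "\<And>u v i. i < 4 \<Longrightarrow> \<beta> u v i = form_bracket [[], [], [], [(1, 0, 1)]] u v i"
  shows "classified \<beta>"
proof -
  have "alternating 4 (\<lambda>u v. \<beta> u v 4)" using nil by (simp add: nilpotent_def)
  then obtain w01 w02 w03 w12 w13 w23 where w: "\<And>u v. \<beta> u v 4 = w01 * (u 0 * v 1 - u 1 * v 0) + w02 * (u 0 * v 2 - u 2 * v 0) + w03 * (u 0 * v 3 - u 3 * v 0)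
      + w12 * (u 1 * v 2 - u 2 * v 1) + w13 * (u 1 * v 3 - u 3 * v 1) + w23 * (u 2 * v 3 - u 3 * v 2)"
    by (rule alternating_4E) blast
  note b = pre form_bracket_def w
  have jac: "\<beta> (\<beta> u v) w 4 + \<beta> (\<beta> v w) u 4 + \<beta> (\<beta> w u) v 4 = 0" for u v w
    using nilpotentD_jacobi[OF nil] by simp
  have z: "w23 = 0"
    using jac[of "unit_vec 0" "unit_vec 1" "unit_vec 2"]
    by (simp_all add: b unit_vec_def)
  note simps = all_less_numeral row_map_def five_dim_form_def four_dim_form_def b two z
  show ?thesis
  proof (cases "w03 = 0")
    case w03: True
    show ?thesis
    proof (cases "w13 = 0")
      case w13: True
      show ?thesis
      proof (cases "w02 = 0")
        case w02: True
        show ?thesis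
        proof (cases "w12 = 0")
          case w12: True
          show ?thesis
            by (rule five_dim_formI[OF two nil, where k = 1 and R = "[[(1, 0)], [(1, 1)], [(1, 2)], [(1, 4), (-w01, 3)], [(1, 3)]]"];
                simp add: simps w03 w13 w02 w12 field_simps; algebra)
        next
          case w12: False
          show ?thesis
            by (rule five_dim_formI[OF two nil, where k = 3 and R = "[[(w12, 1)], [(-1, 0)], [(1, 2)], [(w12, 3)], [(1, 4), (-w01, 3)]]"];
                simp add: simps w03 w13 w02 w12 field_simps; algebra)
        qed
      next
        case w02: False
        show ?thesis
          by (rule five_dim_formI[OF two nil, where k = 3 and R = "[[(w02, 0), (w12, 1)], [(1, 1)], [(1, 2)], [(w02, 3)], [(1, 4), (-w01, 3)]]"];
              simp add: simps w03 w13 w02 field_simps; algebra)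
      qed
    next
      case w13: False
      show ?thesis
      proof (cases "w02 = 0")
        case w02: True
        show ?thesis
          by (rule five_dim_formI[OF two nil, where k = 4 and R = "[[(w13, 1)], [(-1, 0)], [(1, 2)], [(w13, 3), (w12, 2)],
          [(w13, 4), (-(w13 * w01), 3)]]"];
              simp add: simps w03 w13 w02 field_simps; algebra)
      next
        case w02: False
        show ?thesis
          by (rule five_dim_formI[OF two nil, where k = 5 and R = "[[(w13, 1)], [(-1, 0)], [(-(w13 * w02), 2)], [(w13, 3), (w12, 2)],
          [(w13, 4), (-(w13 * w01), 3)]]"];
              simp add: simps w03 w13 w02 field_simps; algebra)
      qed
    qed
  next
    case w03: False
    define t where "t = w12 - w13 * w02 / w03"
    have w12_eq: "w12 = t + w13 * w02 / w03"
      using w03 two by (simp add: t_def field_simps)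
    show ?thesis
    proof (cases "t = 0")
      case t: True
      show ?thesis
        by (rule five_dim_formI[OF two nil, where k = 4 and R = "[[(w03, 0), (w13, 1)], [(1, 1)], [(1, 2)], [(w03, 3), (w02, 2)],
          [(w03, 4), (-(w03 * w01), 3)]]"];
            simp add: simps w03 w12_eq t field_simps; algebra)
    next
      case t: False
      show ?thesis
        by (rule five_dim_formI[OF two nil, where k = 5 and R = "[[(w03, 0), (w13, 1)], [(1, 1)], [(w03 * t, 2)], [(w03, 3), (w02, 2)],
          [(w03, 4), (-(w03 * w01), 3)]]"];
            simp add: simps w03 w12_eq t field_simps; algebra)
    qed
  qed
qed

lemma classify_4C:
  fixes \<beta> :: "'k::field bracket"
  assumes two: "(2::'k) \<noteq> 0" and nil: "nilpotent 6 \<beta>"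
    and pre: "\<And>u v i. i < 4 \<Longrightarrow> \<beta> u v i = form_bracket [[], [], [(1, 0, 1)], [(1, 0, 2)]] u v i"
  shows "classified \<beta>"
proof -
  have "alternating 4 (\<lambda>u v. \<beta> u v 4)" using nil by (simp add: nilpotent_def)
  then obtain w01 w02 w03 w12 w13 w23 where w: "\<And>u v. \<beta> u v 4 = w01 * (u 0 * v 1 - u 1 * v 0) + w02 * (u 0 * v 2 - u 2 * v 0) + w03 * (u 0 * v 3 - u 3 * v 0)
      + w12 * (u 1 * v 2 - u 2 * v 1) + w13 * (u 1 * v 3 - u 3 * v 1) + w23 * (u 2 * v 3 - u 3 * v 2)"
    by (rule alternating_4E) blast
  note b = pre form_bracket_def w
  have jac: "\<beta> (\<beta> u v) w 4 + \<beta> (\<beta> v w) u 4 + \<beta> (\<beta> w u) v 4 = 0" for u v w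
    using nilpotentD_jacobi[OF nil] by simp
  have z: "w13 = 0" "w23 = 0"
    using jac[of "unit_vec 0" "unit_vec 1" "unit_vec 2"] jac[of "unit_vec 0" "unit_vec 1" "unit_vec 3"]
    by (simp_all add: b unit_vec_def)
  note simps = all_less_numeral row_map_def five_dim_form_def four_dim_form_def b two z
  show ?thesis
  proof (cases "w03 = 0")
    case w03: True
    show ?thesis
    proof (cases "w12 = 0")
      case w12: True
      show ?thesis
        by (rule five_dim_formI[OF two nil, where k = 4 and R = "[[(1, 0)], [(1, 1)], [(1, 4), (-w01, 2), (-w02, 3)], [(1, 2)], [(1, 3)]]"];
            simp add: simps w03 w12 field_simps; algebra)
    next
      case w12: False
      show ?thesis
        by (rule five_dim_formI[OF two nil, where k = 6 and R = "[[(1, 0)], [(w12, 1)], [(w12, 2)], [(w12, 3)],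
          [(w12, 4), (-(w12 * w01), 2), (-(w12 * w02), 3)]]"];
            simp add: simps w03 w12 field_simps; algebra)
    qed
  next
    case w03: False
    show ?thesis
    proof (cases "w12 = 0")
      case w12: True
      show ?thesis
        by (rule five_dim_formI[OF two nil, where k = 7 and R = "[[(1, 0)], [(w03, 1)], [(w03, 2)], [(w03, 3)], [(1, 4), (-w01, 2), (-w02, 3)]]"];
            simp add: simps w03 w12 field_simps; algebra)
    next
      case w12: False
      show ?thesis
        by (rule five_dim_formI[OF two nil, where k = 8 and R = "[[(w03, 0)], [(w03 * w12, 1)], [(w03 ^ 2 * w12, 2)], [(w03 ^ 3 * w12, 3)],
          [(w03 ^ 3 * w12, 4), (-(w03 ^ 3 * w12 * w01), 2), (-(w03 ^ 3 * w12 * w02), 3)]]"];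
            simp add: simps w03 w12 field_simps; algebra)
    qed
  qed
qed

lemma classify_four:
  fixes \<beta> :: "'k::field bracket"
  assumes two: "(2::'k) \<noteq> 0" and nil: "nilpotent 6 \<beta>"
    and pre: "\<And>u v i. i < 4 \<Longrightarrow> \<beta> u v i = form_bracket (four_dim_form k) u v i" and "k < 3"
  shows "classified \<beta>"
proof -
  consider "k = 0" | "k = 1" | "k = 2" using \<open>k < 3\<close> by linarith
  then show ?thesis
  proof cases
    case 1
    have ab: "\<beta> u v i = 0" if "i < 4" for u v i
    proof -
      have "i \<in> {0, 1, 2, 3}" using that by auto
      then show ?thesis by (auto simp: pre 1 form_bracket_def four_dim_form_def)
    qed
    show ?thesis
    proof (rule abelian_prefix_swap_or_zero[OF nil _ ab])
      assume z: "\<And>u v. \<beta> u v 4 = 0"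
      show ?thesis
      proof (rule classify_five[OF two nil, where k = 0])
        fix u v i assume "i < (5::nat)"
        then have "i \<in> {0, 1, 2, 3, 4}" by auto
        then show "\<beta> u v i = form_bracket (five_dim_form 0) u v i"
          by (auto simp: ab z form_bracket_def five_dim_form_def)
      qed simp
    qed (use classify_4A_nonzero[OF two] lie_iso_classified in \<open>blast | simp\<close>)+
  next
    case 2
    show ?thesis by (rule classify_4B[OF two nil]) (use pre in \<open>simp add: 2 four_dim_form_def\<close>)
  next
    case 3
    show ?thesis by (rule classify_4C[OF two nil]) (use pre in \<open>simp add: 3 four_dim_form_def\<close>)
  qed
qed

lemma four_dim_form_nilpotent:
  assumes "k < 3"
  shows "length (four_dim_form k) = 4" "\<forall>i<4. \<forall>(c, p, q)\<in>set (four_dim_form k ! i). p < i \<and> q < i"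
proof -
  have "\<forall>k<3. length (four_dim_form k) = 4 \<and> (\<forall>i<4. \<forall>(c, p, q)\<in>set (four_dim_form k ! i). p < i \<and> q < i)"
    by (simp add: all_less_numeral four_dim_form_def)
  then show "length (four_dim_form k) = 4" "\<forall>i<4. \<forall>(c, p, q)\<in>set (four_dim_form k ! i). p < i \<and> q < i"
    using assms by blast+
qed

lemma four_dim_formI:
  fixes \<beta> :: "'k::field bracket"
  assumes two: "(2::'k) \<noteq> 0" and nil: "nilpotent 6 \<beta>"
    and k: "k < 3" and R: "length R = 4" "\<forall>r\<in>set R. \<forall>(c, j)\<in>set r. j < 4"
    and inj: "\<And>u. row_map R u 0 = 0 \<Longrightarrow> row_map R u 1 = 0 \<Longrightarrow> row_map R u 2 = 0 \<Longrightarrow> row_map R u 3 = 0 \<Longrightarrow>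
      u 0 = 0 \<and> u 1 = 0 \<and> u 2 = 0 \<and> u 3 = 0"
    and "\<And>u v. row_map R (\<beta> u v) 0 = form_bracket (four_dim_form k) (row_map R u) (row_map R v) 0"
      "\<And>u v. row_map R (\<beta> u v) 1 = form_bracket (four_dim_form k) (row_map R u) (row_map R v) 1"
      "\<And>u v. row_map R (\<beta> u v) 2 = form_bracket (four_dim_form k) (row_map R u) (row_map R v) 2"
      "\<And>u v. row_map R (\<beta> u v) 3 = form_bracket (four_dim_form k) (row_map R u) (row_map R v) 3"
  shows "classified \<beta>"
proof -
  have all: "(\<forall>i<4. P i) \<longleftrightarrow> P 0 \<and> P 1 \<and> P 2 \<and> P (3::nat)" for P
    by (auto simp: all_less_numeral)
  have "\<exists>\<beta>'. nilpotent 6 \<beta>' \<and> lie_iso 6 \<beta> \<beta>' \<and> (\<forall>u v. \<forall>i<4. \<beta>' u v i = form_bracket (four_dim_form k) u v i)"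
  proof (rule nilpotent_prefix[OF nil _ R four_dim_form_nilpotent[OF k]])
    show "\<forall>i<4. row_map R (\<beta> u v) i = form_bracket (four_dim_form k) (row_map R u) (row_map R v) i" for u v
      unfolding all using assms(7-10) by blast
    show "\<forall>i<4. row_map R u i = 0 \<Longrightarrow> \<forall>i<4. u i = 0" for u
      unfolding all using inj by blast
  qed simp
  then show ?thesis using classify_four[OF two _ _ k] lie_iso_classified by blast
qed

lemma classify_3A:
  fixes \<beta> :: "'k::field bracket"
  assumes two: "(2::'k) \<noteq> 0" and nil: "nilpotent 6 \<beta>"
    and pre: "\<And>u v i. i < 3 \<Longrightarrow> \<beta> u v i = form_bracket [[], [], []] u v i"
  shows "classified \<beta>"
proof -
  have "alternating 3 (\<lambda>u v. \<beta> u v 3)" using nil by (simp add: nilpotent_def)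
  then obtain w01 w02 w12 where w: "\<And>u v. \<beta> u v 3 = w01 * (u 0 * v 1 - u 1 * v 0) + w02 * (u 0 * v 2 - u 2 * v 0) + w12 * (u 1 * v 2 - u 2 * v 1)"
    by (rule alternating_3E) blast
  note b = pre form_bracket_def w
  note simps = all_less_numeral row_map_def five_dim_form_def four_dim_form_def b two
  show ?thesis
  proof (cases "w01 = 0")
    case w01: True
    show ?thesis
    proof (cases "w02 = 0")
      case w02: True
      show ?thesis
      proof (cases "w12 = 0")
        case w12: True
        show ?thesis
          by (rule four_dim_formI[OF two nil, where k = 0 and R = "[[(1, 0)], [(1, 1)], [(1, 2)], [(1, 3)]]"];
              simp add: simps w01 w02 w12 field_simps; algebra)
      next
        case w12: False
        show ?thesis
          by (rule four_dim_formI[OF two nil, where k = 1 and R = "[[(w12, 1)], [(1, 2)], [(1, 0)], [(1, 3)]]"];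
              simp add: simps w01 w02 w12 field_simps; algebra)
      qed
    next
      case w02: False
      show ?thesis
        by (rule four_dim_formI[OF two nil, where k = 1 and R = "[[(w02, 0), (w12, 1)], [(1, 2)], [(1, 1)], [(1, 3)]]"];
            simp add: simps w01 w02 field_simps; algebra)
    qed
  next
    case w01: False
    show ?thesis
      by (rule four_dim_formI[OF two nil, where k = 1 and R = "[[(w01, 0), (-w12, 2)], [(1, 1), (w02 / w01, 2)], [(1, 2)], [(1, 3)]]"];
          simp add: simps w01 field_simps; algebra)
  qed
qed

lemma classify_3B:
  fixes \<beta> :: "'k::field bracket"
  assumes two: "(2::'k) \<noteq> 0" and nil: "nilpotent 6 \<beta>"
    and pre: "\<And>u v i. i < 3 \<Longrightarrow> \<beta> u v i = form_bracket [[], [], [(1, 0, 1)]] u v i"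
  shows "classified \<beta>"
proof -
  have "alternating 3 (\<lambda>u v. \<beta> u v 3)" using nil by (simp add: nilpotent_def)
  then obtain w01 w02 w12 where w: "\<And>u v. \<beta> u v 3 = w01 * (u 0 * v 1 - u 1 * v 0) + w02 * (u 0 * v 2 - u 2 * v 0) + w12 * (u 1 * v 2 - u 2 * v 1)"
    by (rule alternating_3E) blast
  note b = pre form_bracket_def w
  note simps = all_less_numeral row_map_def five_dim_form_def four_dim_form_def b two
  show ?thesis
  proof (cases "w02 = 0")
    case w02: True
    show ?thesis
    proof (cases "w12 = 0")
      case w12: True
      show ?thesis
        by (rule four_dim_formI[OF two nil, where k = 1 and R = "[[(1, 0)], [(1, 1)], [(1, 3), (-w01, 2)], [(1, 2)]]"];
            simp add: simps w02 w12 field_simps; algebra)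
    next
      case w12: False
      show ?thesis
        by (rule four_dim_formI[OF two nil, where k = 2 and R = "[[(w12, 1)], [(-1, 0)], [(w12, 2)], [(w12, 3), (-(w12 * w01), 2)]]"];
            simp add: simps w02 w12 field_simps; algebra)
    qed
  next
    case w02: False
    show ?thesis
      by (rule four_dim_formI[OF two nil, where k = 2 and R = "[[(w02, 0), (w12, 1)], [(1, 1)], [(w02, 2)], [(w02, 3), (-(w02 * w01), 2)]]"];
          simp add: simps w02 field_simps; algebra)
  qed
qed

lemma nilpotent_classified:
  fixes \<beta> :: "'k::field bracket"
  assumes two: "(2::'k) \<noteq> 0" and nil: "nilpotent 6 \<beta>"
  shows "classified \<beta>"
proof -
  have flag: "\<beta> u v i = (\<Sum>q<i. \<Sum>p<q. \<beta> (unit_vec p) (unit_vec q) i * (u p * v q - u q * v p))"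
    if "i < 6" for u v i
  proof -
    have "alternating i (\<lambda>u v. \<beta> u v i)" using nil that by (simp add: nilpotent_def)
    then show ?thesis by (rule alternating_expand)
  qed
  \<comment> \<open>There is no 2-form in fewer than two variables, and dx_2 can only be a multiple
    of x_0 x_1.\<close>
  define a where "a = \<beta> (unit_vec 0) (unit_vec 1) 2"
  have b: "\<beta> u v 0 = 0" "\<beta> u v (Suc 0) = 0" "\<beta> u v 2 = a * (u 0 * v 1 - u 1 * v 0)" for u v
    using flag[of 0 u v] flag[of 1 u v] flag[of 2 u v] by (simp_all add: a_def eval_nat_numeral)
  show ?thesis
  proof (cases "a = 0")
    case True
    show ?thesis
    proof (rule classify_3A[OF two nil])
      fix u v i assume "i < (3::nat)"
      then have "i \<in> {0, 1, 2}" by auto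
      then show "\<beta> u v i = form_bracket [[], [], []] u v i" by (auto simp: b True form_bracket_def)
    qed
  next
    case False
    have "\<exists>\<beta>'. nilpotent 6 \<beta>' \<and> lie_iso 6 \<beta> \<beta>' \<and>
      (\<forall>u v. \<forall>i<3. \<beta>' u v i = form_bracket [[], [], [(1, 0, 1)]] u v i)"
      by (rule nilpotent_prefix[OF nil, where R = "[[(a, 0)], [(1, 1)], [(1, 2)]]"])
         (simp_all add: b False all_less_numeral row_map_def form_bracket_def algebra_simps)
    then show ?thesis using classify_3B[OF two] lie_iso_classified by blast
  qed
qed

section \<open>Normal forms are pairwise non-isomorphic\<close>

text \<open>\<open>adapted \<beta> p q\<close> says that, if \<open>W\<close> is the span of the first \<open>p\<close> coordinate functions \<open>x\<^sub>j\<close>, then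
  the functionals \<open>x\<close> with \<open>dx \<in> \<Lambda>\<^sup>2W\<close> are the span of the first \<open>q\<close> of them.\<close>
definition adapted :: "'k::field bracket \<Rightarrow> nat \<Rightarrow> nat \<Rightarrow> bool" where
  "adapted \<beta> p q \<longleftrightarrow> p \<le> q \<and> q \<le> 6 \<and>
     (\<forall>f. (\<forall>u v. (\<forall>j<p. u j = 0) \<longrightarrow> (\<Sum>i<6. f i * \<beta> u v i) = 0) \<longleftrightarrow> (\<forall>j<6. q \<le> j \<longrightarrow> f j = 0))"

text \<open>The list records the dimensions of successive terms of the filtration and asserts that
  each term is spanned by an initial segment of the coordinate functions.\<close>

fun levels :: "'k::field bracket \<Rightarrow> nat \<Rightarrow> nat list \<Rightarrow> bool" where
  "levels \<beta> p [] \<longleftrightarrow> True"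
| "levels \<beta> p (q # qs) \<longleftrightarrow> adapted \<beta> p q \<and> levels \<beta> q qs"

section \<open>Isomorphisms are block triangular\<close>

definition preserves :: "((nat \<Rightarrow> 'k::field) \<Rightarrow> nat \<Rightarrow> 'k) \<Rightarrow> nat \<Rightarrow> bool" where
  "preserves G p \<longleftrightarrow> (\<forall>u. (\<forall>j<p. u j = 0) \<longrightarrow> (\<forall>j<p. G u j = 0))"

text \<open>Let f be the i-th coordinate function pulled back along G. On a bracket it is the i-th
  coordinate of the bracket of the images, which vanishes when the first p coordinates of one
  argument do. Adaptedness of the source then confines f to the first q coordinate
  functions.\<close>

lemma lie_hom_adapted:
  assumes G: "linear_map 6 G" "lie_hom 6 G \<beta> \<beta>'" "preserves G p"
    and a: "adapted \<beta> p q" and a': "adapted \<beta>' p q'" and ij: "i < q'" "q \<le> j" "j < 6"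
  shows "G (unit_vec j) i = 0"
proof -
  have i: "i < 6" using ij a' by (simp add: adapted_def)
  define f where "f j = G (unit_vec j) i" for j
  have "(\<Sum>j<6. f j * \<beta> u v j) = 0" if u: "\<forall>j<p. u j = 0" for u v
  proof -
    have "(\<Sum>j<6. f j * \<beta> u v j) = G (\<beta> u v) i"
      using linear_form_expand[of 6 "\<lambda>u. G u i" "\<beta> u v"] G(1) i
      by (simp add: linear_map_def f_def mult.commute)
    also have "\<dots> = \<beta>' (G u) (G v) i" using G(2) i by (simp add: lie_hom_def)
    also have "\<dots> = (\<Sum>k<6. unit_vec i k * \<beta>' (G u) (G v) k)"
      using i by (simp add: unit_vec_def if_distrib[of "\<lambda>x. x * _"] cong: if_cong)
    also have "\<dots> = 0"
    proof -
      have "\<forall>j<6. q' \<le> j \<longrightarrow> unit_vec i j = (0::'a)" using ij by (simp add: unit_vec_def)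
      moreover have "\<forall>j<p. G u j = 0" using G(3) u by (simp add: preserves_def)
      ultimately show ?thesis using a' unfolding adapted_def by blast
    qed
    finally show ?thesis .
  qed
  then have "\<forall>j<6. q \<le> j \<longrightarrow> f j = 0" using a unfolding adapted_def by blast
  then show ?thesis using ij by (simp add: f_def)
qed

text \<open>If q' exceeded q, the first q' rows of G would be supported on q columns and hence
  dependent, although G has a right inverse.\<close>

lemma adapted_le:
  fixes G H :: "(nat \<Rightarrow> 'k::field) \<Rightarrow> nat \<Rightarrow> 'k"
  assumes G: "linear_map 6 G" and GH: "\<And>u i. i < 6 \<Longrightarrow> G (H u) i = u i"
    and z: "\<And>i j. i < q' \<Longrightarrow> q \<le> j \<Longrightarrow> j < 6 \<Longrightarrow> G (unit_vec j) i = 0" and "q' \<le> 6"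
  shows "q' \<le> q"
proof (rule ccontr)
  assume "\<not> q' \<le> q"
  then obtain c where c: "\<exists>i\<in>{..<q'}. c i \<noteq> 0"
    "\<forall>j<q. (\<Sum>i\<in>{..<q'}. c i * G (unit_vec j) i) = 0"
    using underdetermined_system[of "{..<q'}" q "\<lambda>i j. G (unit_vec j) i"] by auto
  have zero: "(\<Sum>i<q'. c i * G (unit_vec j) i) = 0" if "j < 6" for j
  proof (cases "j < q")
    case True
    then show ?thesis using c(2) by simp
  next
    case False
    then show ?thesis using z that by (intro sum.neutral) auto
  qed
  have comb: "(\<Sum>i<q'. c i * G u i) = 0" for u
  proof -
    have "(\<Sum>i<q'. c i * G u i) = (\<Sum>i<q'. \<Sum>j<6. u j * (c i * G (unit_vec j) i))"
    proof (rule sum.cong)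
      fix i assume "i \<in> {..<q'}"
      then have "linear_form 6 (\<lambda>u. G u i)" using G \<open>q' \<le> 6\<close> by (simp add: linear_map_def)
      from linear_form_expand[OF this, of u]
      show "c i * G u i = (\<Sum>j<6. u j * (c i * G (unit_vec j) i))"
        by (simp add: sum_distrib_left mult.left_commute)
    qed simp
    also have "\<dots> = (\<Sum>j<6. u j * (\<Sum>i<q'. c i * G (unit_vec j) i))"
      by (subst sum.swap) (simp add: sum_distrib_left)
    also have "\<dots> = 0" using zero by simp
    finally show ?thesis .
  qed
  have "c i = 0" if "i < q'" for i
  proof -
    have "(\<Sum>k<q'. c k * G (H (unit_vec i)) k) = (\<Sum>k<q'. c k * unit_vec i k)"
      using GH \<open>q' \<le> 6\<close> by (intro sum.cong) auto
    also have "\<dots> = c i"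
      using that by (simp add: unit_vec_def if_distrib[of "\<lambda>x. _ * x"] cong: if_cong)
    finally show ?thesis using comb by simp
  qed
  then show False using c(1) by auto
qed

lemma preservesI:
  fixes G :: "(nat \<Rightarrow> 'k::field) \<Rightarrow> nat \<Rightarrow> 'k"
  assumes G: "linear_map 6 G" and "q \<le> 6"
    and z: "\<And>i j. i < q \<Longrightarrow> q \<le> j \<Longrightarrow> j < 6 \<Longrightarrow> G (unit_vec j) i = 0"
  shows "preserves G q"
  unfolding preserves_def
proof (intro allI impI)
  fix u :: "nat \<Rightarrow> 'k" and i assume u: "\<forall>j<q. u j = 0" and i: "i < q"
  have "linear_form 6 (\<lambda>u. G u i)" using G i \<open>q \<le> 6\<close> by (simp add: linear_map_def)
  from linear_form_expand[OF this, of u] show "G u i = 0"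
    using u z[OF i] by (auto intro!: sum.neutral) (metis not_le)
qed

text \<open>At each level the two preceding lemmas, applied to G and to H, give equal dimensions and
  vanishing blocks. The vanishing blocks are the invariance required at the next level.\<close>

lemma levels_unique:
  assumes G: "linear_map 6 G" "lie_hom 6 G \<beta> \<beta>'" and H: "linear_map 6 H" "lie_hom 6 H \<beta>' \<beta>"
    and GH: "\<And>u i. i < 6 \<Longrightarrow> G (H u) i = u i" and HG: "\<And>u i. i < 6 \<Longrightarrow> H (G u) i = u i"
    and "levels \<beta> p qs" "levels \<beta>' p qs'" "length qs = length qs'" "preserves G p" "preserves H p"
  shows "qs = qs' \<and> (\<forall>q\<in>set qs. \<forall>i<q. \<forall>j<6. q \<le> j \<longrightarrow> G (unit_vec j) i = 0 \<and> H (unit_vec j) i = 0)"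
  using assms(7-11)
proof (induction qs arbitrary: p qs')
  case (Cons q qs)
  obtain q' qs'' where qs': "qs' = q' # qs''" using Cons.prems(3) by (cases qs') auto
  have a: "adapted \<beta> p q" "adapted \<beta>' p q'" using Cons.prems qs' by auto
  have q6: "q \<le> 6" "q' \<le> 6" using a by (auto simp: adapted_def)
  have zG: "G (unit_vec j) i = 0" if "i < q'" "q \<le> j" "j < 6" for i j
    using lie_hom_adapted[OF G Cons.prems(4) a that] .
  have zH: "H (unit_vec j) i = 0" if "i < q" "q' \<le> j" "j < 6" for i j
    using lie_hom_adapted[OF H Cons.prems(5) a(2,1) that] .
  have eq: "q' = q"
    using adapted_le[where q = q and q' = q', OF G(1) GH zG q6(2)]
      adapted_le[where q = q' and q' = q, OF H(1) HG zH q6(1)] by simp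
  have "preserves G q" "preserves H q"
    using preservesI[OF G(1) q6(1)] preservesI[OF H(1) q6(1)] zG zH eq by auto
  then have "qs = qs'' \<and> (\<forall>q\<in>set qs. \<forall>i<q. \<forall>j<6. q \<le> j \<longrightarrow> G (unit_vec j) i = 0 \<and> H (unit_vec j) i = 0)"
    using Cons.IH[of q qs''] Cons.prems qs' eq by auto
  then show ?case using qs' eq zG zH by auto
qed simp

text \<open>The inverse matrix is carried along with its own zero blocks and bracket equations. The
  notion is thus symmetric, and each comparison of two forms can be used in both directions.\<close>

definition iso_matrix ::
  "nat list \<Rightarrow> 'k::field bracket \<Rightarrow> 'k bracket \<Rightarrow> (nat \<Rightarrow> nat \<Rightarrow> 'k) \<Rightarrow> (nat \<Rightarrow> nat \<Rightarrow> 'k) \<Rightarrow> bool" where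
  "iso_matrix qs \<beta> \<beta>' m n \<longleftrightarrow>
     (\<forall>q\<in>set qs. \<forall>i<q. \<forall>j<6. q \<le> j \<longrightarrow> m i j = 0 \<and> n i j = 0) \<and>
     (\<forall>i<6. \<forall>k<6. (\<Sum>j<6. m i j * n j k) = unit_vec k i) \<and>
     (\<forall>i<6. \<forall>k<6. (\<Sum>j<6. n i j * m j k) = unit_vec k i) \<and>
     (\<forall>i<6. \<forall>p q. (\<Sum>j<6. m i j * \<beta> (unit_vec p) (unit_vec q) j) = \<beta>' (\<lambda>a. m a p) (\<lambda>a. m a q) i) \<and>
     (\<forall>i<6. \<forall>p q. (\<Sum>j<6. n i j * \<beta>' (unit_vec p) (unit_vec q) j) = \<beta> (\<lambda>a. n a p) (\<lambda>a. n a q) i)"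

lemma iso_matrix_sym: "iso_matrix qs \<beta> \<beta>' m n \<Longrightarrow> iso_matrix qs \<beta>' \<beta> n m"
  unfolding iso_matrix_def by blast

lemma iso_matrixD:
  assumes "iso_matrix qs \<beta> \<beta>' m n"
  shows "\<And>q i j. q \<in> set qs \<Longrightarrow> i < q \<Longrightarrow> q \<le> j \<Longrightarrow> j < 6 \<Longrightarrow> m i j = 0"
    "\<And>q i j. q \<in> set qs \<Longrightarrow> i < q \<Longrightarrow> q \<le> j \<Longrightarrow> j < 6 \<Longrightarrow> n i j = 0"
    "\<And>i k. i < 6 \<Longrightarrow> k < 6 \<Longrightarrow> (\<Sum>j<6. m i j * n j k) = unit_vec k i"
    "\<And>i k. i < 6 \<Longrightarrow> k < 6 \<Longrightarrow> (\<Sum>j<6. n i j * m j k) = unit_vec k i"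
    "\<And>i p q. i < 6 \<Longrightarrow>
      (\<Sum>j<6. m i j * \<beta> (unit_vec p) (unit_vec q) j) = \<beta>' (\<lambda>a. m a p) (\<lambda>a. m a q) i"
  using assms unfolding iso_matrix_def by simp_all

lemma lie_iso_matrix:
  assumes b: "bracket 6 \<beta>" and b': "bracket 6 \<beta>'" and iso: "lie_iso 6 \<beta> \<beta>'"
    and lev: "levels \<beta> 0 qs" "levels \<beta>' 0 qs'" "length qs = length qs'"
  shows "qs = qs' \<and> (\<exists>m n. iso_matrix qs \<beta> \<beta>' m n)"
proof -
  obtain G where G: "linear_map 6 G" "injective_map 6 G" "lie_hom 6 G \<beta> \<beta>'"
    using iso by (auto simp: lie_iso_def)
  obtain H where H: "linear_map 6 H" "injective_map 6 H" and GH: "\<And>u i. i < 6 \<Longrightarrow> G (H u) i = u i"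
    and HG: "\<And>u i. i < 6 \<Longrightarrow> H (G u) i = u i"
    using injective_map_inverse[OF G(1,2)] by blast
  have hom: "lie_hom 6 H \<beta>' \<beta>" using lie_hom_inverse[OF b G b' H(1) GH HG] .
  have *: "qs = qs' \<and> (\<forall>q\<in>set qs. \<forall>i<q. \<forall>j<6. q \<le> j \<longrightarrow> G (unit_vec j) i = 0 \<and> H (unit_vec j) i = 0)"
    by (rule levels_unique[OF G(1,3) H(1) hom GH HG lev]) (simp_all add: preserves_def)
  have expand: "F u i = (\<Sum>j<6. F (unit_vec j) i * u j)" if "linear_map 6 F" "i < 6"
    for F :: "(nat \<Rightarrow> 'a) \<Rightarrow> nat \<Rightarrow> 'a" and u i
    using linear_form_expand[of 6 "\<lambda>u. F u i" u] that by (simp add: linear_map_def mult.commute)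
  define m where "m i j = G (unit_vec j) i" for i j
  define n where "n i j = H (unit_vec j) i" for i j
  have mn: "(\<Sum>j<6. m i j * n j k) = unit_vec k i" if "i < 6" for i k
    using expand[OF G(1) that, of "H (unit_vec k)"] GH[OF that] by (simp add: m_def n_def)
  have nm: "(\<Sum>j<6. n i j * m j k) = unit_vec k i" if "i < 6" for i k
    using expand[OF H(1) that, of "G (unit_vec k)"] HG[OF that] by (simp add: m_def n_def)
  have hm: "(\<Sum>j<6. m i j * \<beta> (unit_vec p) (unit_vec q) j) = \<beta>' (\<lambda>a. m a p) (\<lambda>a. m a q) i"
    if "i < 6" for i p q
    using expand[OF G(1) that, of "\<beta> (unit_vec p) (unit_vec q)"] G(3) that by (simp add: m_def lie_hom_def)
  have hn: "(\<Sum>j<6. n i j * \<beta>' (unit_vec p) (unit_vec q) j) = \<beta> (\<lambda>a. n a p) (\<lambda>a. n a q) i"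
    if "i < 6" for i p q
    using expand[OF H(1) that, of "\<beta>' (unit_vec p) (unit_vec q)"] hom that by (simp add: n_def lie_hom_def)
  have "iso_matrix qs \<beta> \<beta>' m n"
    unfolding iso_matrix_def using * mn nm hm hn by (simp add: m_def n_def)
  then show ?thesis using * by blast
qed

text \<open>A criterion that can be evaluated on the list. A row j from q on must exhibit a pair a,
  b with b at least p whose bracket is e_j up to sign, so that a functional killing such brackets
  has j-th coefficient 0. The value is -1 because the arguments come in the order e_b, e_a.\<close>

definition adapted_list :: "('k::field \<times> nat \<times> nat) list list \<Rightarrow> nat \<Rightarrow> nat \<Rightarrow> bool" where
  "adapted_list L p q \<longleftrightarrow> p \<le> q \<and> q \<le> 6 \<and> length L = 6 \<and>
     (\<forall>i<q. \<forall>(c, a, b)\<in>set (L ! i). a < p \<and> b < p) \<and>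
     (\<forall>j<6. q \<le> j \<longrightarrow> (case L ! j of [] \<Rightarrow> False
        | (c, a, b) # _ \<Rightarrow> p \<le> b \<and> (\<forall>i<6. form_bracket L (unit_vec b) (unit_vec a) i = (if i = j then -1 else 0))))"

lemma adapted_form_bracket:
  fixes L :: "('k::field \<times> nat \<times> nat) list list"
  assumes L: "adapted_list L p q"
  shows "adapted (form_bracket L) p q"
  unfolding adapted_def
proof (intro conjI allI iffI impI)
  show "p \<le> q" "q \<le> 6" using L by (auto simp: adapted_list_def)
next
  fix f :: "nat \<Rightarrow> 'k" and j assume f: "\<forall>u v. (\<forall>j<p. u j = 0) \<longrightarrow> (\<Sum>i<6. f i * form_bracket L u v i) = 0"
    and j: "j < 6" "q \<le> j"
  obtain a b where ab: "p \<le> b"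
    "\<forall>i<6. form_bracket L (unit_vec b) (unit_vec a) i = (if i = j then -1 else 0)"
  proof (cases "L ! j")
    case Nil
    then show ?thesis using L j unfolding adapted_list_def by auto
  next
    case (Cons t ts)
    obtain c a b where t: "t = (c, a, b)" by (cases t)
    have "case L ! j of [] \<Rightarrow> False | (c, a, b) # _ \<Rightarrow> p \<le> b \<and>
      (\<forall>i<6. form_bracket L (unit_vec b) (unit_vec a) i = (if i = j then -1 else 0))"
      using L j unfolding adapted_list_def by blast
    then show ?thesis using that[of b a] unfolding Cons t by simp
  qed
  have "(\<Sum>i<6. f i * form_bracket L (unit_vec b) (unit_vec a) i) = 0"
    using f ab(1) by (simp add: unit_vec_def)
  moreover have "(\<Sum>i<6. f i * form_bracket L (unit_vec b) (unit_vec a) i) = (\<Sum>i<6. if i = j then - f j else 0)"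
    by (rule sum.cong) (use ab(2) in auto)
  ultimately show "f j = 0" using j by simp
next
  fix f u v :: "nat \<Rightarrow> 'k" assume f: "\<forall>j<6. q \<le> j \<longrightarrow> f j = 0" and u: "\<forall>j<p. u j = 0"
  have "f i * form_bracket L u v i = 0" if "i < 6" for i
  proof (cases "i < q")
    case True
    then have "\<forall>(c, a, b)\<in>set (L ! i). a < p \<and> b < p" using L by (simp add: adapted_list_def)
    moreover have "\<forall>(c, a, b)\<in>set r. a < p \<and> b < p \<Longrightarrow> (\<Sum>(c, a, b)\<leftarrow>r. c * (u a * v b - u b * v a)) = 0" for r
      using u by (induction r) auto
    ultimately show ?thesis by (simp add: form_bracket_def)
  next
    case False
    then show ?thesis using f that by simp
  qed
  then show "(\<Sum>i<6. f i * form_bracket L u v i) = 0" by (intro sum.neutral) blast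
qed

text \<open>Padded with 6 to a common length, since \<open>levels_unique\<close> compares lists of
  equal length.\<close>

definition level_list :: "nat \<Rightarrow> nat list" where
  "level_list k = [[6, 6, 6, 6, 6], [5, 6, 6, 6, 6], [5, 6, 6, 6, 6], [4, 6, 6, 6, 6], [4, 5, 6, 6, 6],
     [4, 5, 6, 6, 6], [4, 5, 6, 6, 6], [3, 6, 6, 6, 6], [3, 5, 6, 6, 6], [3, 5, 6, 6, 6], [3, 5, 6, 6, 6],
     [3, 4, 6, 6, 6], [3, 4, 5, 6, 6], [3, 4, 5, 6, 6], [3, 4, 5, 6, 6], [3, 4, 5, 6, 6], [3, 4, 5, 6, 6],
     [2, 3, 4, 5, 6], [2, 3, 4, 5, 6], [2, 3, 4, 5, 6], [2, 3, 4, 5, 6], [2, 3, 4, 5, 6],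
     [4, 6, 6, 6, 6], [3, 5, 6, 6, 6], [3, 4, 6, 6, 6], [2, 3, 5, 6, 6]] ! k"

lemma levels_normal_form:
  assumes "k < 26"
  shows "levels (form_bracket (normal_form k \<epsilon>)) 0 (level_list k)" "length (level_list k) = 5"
proof -
  have "\<forall>k<26. levels (form_bracket (normal_form k \<epsilon>)) 0 (level_list k) \<and> length (level_list k) = 5"
    unfolding all_less_numeral
    by (simp add: level_list_def normal_form_def adapted_form_bracket adapted_list_def all_less_numeral
        form_bracket_def unit_vec_def)
  then show "levels (form_bracket (normal_form k \<epsilon>)) 0 (level_list k)" "length (level_list k) = 5"
    using assms by blast+
qed

section \<open>Discriminants of pencils of 2-forms\<close>

declare One_nat_def [simp del]

lemma sum_less_one: "sum f {..<1} = f (0::nat)"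
  by (simp add: One_nat_def)

lemma nth_Cons_one: "(x # xs) ! 1 = xs ! 0"
  by (simp add: One_nat_def)

lemmas eval_coeff = sum_less_numeral sum_less_one nth_Cons_one form_bracket_def unit_vec_def

text \<open>The identity computes the Gram determinant of (a, b) and (c, e) for X^2 - \<epsilon>
  Y^2. For a totally isotropic pair it is 0, so a e = b c unless \<epsilon> = 0, and in that case a
  = c = 0.\<close>

lemma pencil_contradiction:
  fixes a b c e \<epsilon> :: "'k::field"
  assumes "a ^ 2 = \<epsilon> * b ^ 2" "c ^ 2 = \<epsilon> * e ^ 2" "a * c = \<epsilon> * b * e"
  shows "a * e - b * c = 0"
proof -
  have "\<epsilon> * (a * e - b * c) ^ 2 = (a * c - \<epsilon> * b * e) ^ 2 - (a ^ 2 - \<epsilon> * b ^ 2) * (c ^ 2 - \<epsilon> * e ^ 2)"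
    by algebra
  then have "\<epsilon> * (a * e - b * c) ^ 2 = 0" using assms by simp
  then show ?thesis using assms by auto
qed

text \<open>Gram determinants in two bases, the second with diagonal values l and - \<epsilon>' l,
  give \<epsilon> (a e - b c)^2 = \<epsilon>' l^2. If l were 0, the pair would be totally
  isotropic.\<close>

lemma pencil_discriminant:
  fixes a b c e l \<epsilon> \<epsilon>' :: "'k::field"
  assumes 1: "a ^ 2 - \<epsilon> * b ^ 2 = l" and 2: "c ^ 2 - \<epsilon> * e ^ 2 = - (\<epsilon>' * l)"
    and 3: "a * c = \<epsilon> * b * e" and det: "a * e - b * c \<noteq> 0"
  shows "\<exists>t. \<epsilon>' = t ^ 2 * \<epsilon>"
proof -
  have "\<epsilon> * (a * e - b * c) ^ 2 = (a * c - \<epsilon> * b * e) ^ 2 - (a ^ 2 - \<epsilon> * b ^ 2) * (c ^ 2 - \<epsilon> * e ^ 2)"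
    by algebra
  then have eq: "\<epsilon> * (a * e - b * c) ^ 2 = \<epsilon>' * l ^ 2"
    unfolding 1 2 3 by (simp add: power2_eq_square)
  have "l \<noteq> 0"
  proof
    assume "l = 0"
    then show False using pencil_contradiction[of a \<epsilon> b c e] 1 2 3 det by simp
  qed
  then have "\<epsilon>' = ((a * e - b * c) / l) ^ 2 * \<epsilon>"
    using eq by (simp add: field_simps power2_eq_square)
  then show ?thesis by blast
qed

definition minor :: "(nat \<Rightarrow> nat \<Rightarrow> 'k::field) \<Rightarrow> nat \<Rightarrow> nat \<Rightarrow> nat \<Rightarrow> nat \<Rightarrow> 'k" where
  "minor m i j p q = m i p * m j q - m i q * m j p"

text \<open>The polarization of the Pfaffian of a \<open>2\<close>-form in four variables, as a function of the six coefficients.\<close>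
definition polar :: "(nat \<Rightarrow> nat \<Rightarrow> 'k::field) \<Rightarrow> (nat \<Rightarrow> nat \<Rightarrow> 'k) \<Rightarrow> 'k" where
  "polar x y = x 0 1 * y 2 3 - x 0 2 * y 1 3 + x 0 3 * y 1 2 + x 1 2 * y 0 3 - x 1 3 * y 0 2 + x 2 3 * y 0 1"

text \<open>With y_i the 1-form given by row i of m, \<open>minor m i j\<close> is y_i y_j, and
  \<open>polar\<close> extracts the coefficient of x_0 x_1 x_2 x_3 in the product of two 2-forms. It
  vanishes when a factor repeats; y_1 y_3 y_0 y_2 differs from y_0 y_3 y_1 y_2 by one
  transposition.\<close>

lemma polar_minor:
  fixes m :: "nat \<Rightarrow> nat \<Rightarrow> 'k::field"
  shows "polar (minor m i j) (minor m i k) = 0" "polar (minor m j i) (minor m k i) = 0"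
    "polar (minor m i j) (minor m k i) = 0" "polar (minor m i j) (minor m j k) = 0"
    "polar (minor m 1 3) (minor m 0 2) = - polar (minor m 0 3) (minor m 1 2)"
  unfolding polar_def minor_def by algebra+

lemma polar_bilinear:
  "polar (\<lambda>p q. x p q + c * y p q) z = polar x z + c * polar y z"
  "polar z (\<lambda>p q. x p q + c * y p q) = polar z x + c * polar z y"
  unfolding polar_def by algebra+

lemma polar_sym: "polar x y = polar y x"
  unfolding polar_def by algebra

text \<open>Two bases \<open>\<omega>\<^sub>4, \<omega>\<^sub>5\<close> and \<open>z\<^sub>0z\<^sub>3 + z\<^sub>1z\<^sub>2, z\<^sub>1z\<^sub>3 + \<epsilon>'z\<^sub>0z\<^sub>2\<close> of a pencil on which the Pfaffian is
  proportional to \<open>a\<^sup>2 - \<epsilon>b\<^sup>2\<close> and \<open>a\<^sup>2 - \<epsilon>'b\<^sup>2\<close>.\<close>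
lemma pencil_iso:
  fixes m :: "nat \<Rightarrow> nat \<Rightarrow> 'k::field"
  assumes two: "(2::'k) \<noteq> 0" and det: "a * e - b * c \<noteq> 0"
    and w4: "minor m 0 3 0 2 + minor m 1 2 0 2 = b * \<epsilon>" "minor m 0 3 0 3 + minor m 1 2 0 3 = a"
      "minor m 0 3 1 2 + minor m 1 2 1 2 = a" "minor m 0 3 1 3 + minor m 1 2 1 3 = b"
      "minor m 0 3 2 3 + minor m 1 2 2 3 = 0"
    and w5: "minor m 1 3 0 2 + \<epsilon>' * minor m 0 2 0 2 = e * \<epsilon>" "minor m 1 3 0 3 + \<epsilon>' * minor m 0 2 0 3 = c"
      "minor m 1 3 1 2 + \<epsilon>' * minor m 0 2 1 2 = c" "minor m 1 3 1 3 + \<epsilon>' * minor m 0 2 1 3 = e"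
      "minor m 1 3 2 3 + \<epsilon>' * minor m 0 2 2 3 = 0"
  shows "\<exists>t. \<epsilon>' = t ^ 2 * \<epsilon>"
proof -
  \<comment> \<open>x and y are the pullbacks of the target basis. Their polarizations are computed
    twice: from the minors, where only the pairing l survives, and from the given coefficients. The
    common factor 2 is cancelled at the end.\<close>
  define x where "x p q = minor m 0 3 p q + 1 * minor m 1 2 p q" for p q
  define y where "y p q = minor m 1 3 p q + \<epsilon>' * minor m 0 2 p q" for p q
  define l where "l = polar (minor m 0 3) (minor m 1 2)"
  have xx: "polar x x = 2 * l" and yy: "polar y y = - (2 * \<epsilon>' * l)" and xy: "polar x y = 0"
    unfolding x_def y_def polar_bilinear l_def
    by (simp_all add: polar_minor polar_sym[of "minor m 1 2" "minor m 0 3"]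
        polar_sym[of "minor m 0 2" "minor m 1 3"] polar_sym[of "minor m 1 2" "minor m 1 3"]
        polar_sym[of "minor m 1 2" "minor m 0 2"] algebra_simps)
  have h: "polar x x = 2 * (a ^ 2 - \<epsilon> * b ^ 2)" "polar y y = 2 * (c ^ 2 - \<epsilon> * e ^ 2)"
    "polar x y = 2 * (a * c - \<epsilon> * b * e)"
    unfolding polar_def x_def y_def mult_1 w4 w5 by (simp_all add: algebra_simps power2_eq_square)
  have "2 * (a ^ 2 - \<epsilon> * b ^ 2) - 2 * l = 0" "2 * (c ^ 2 - \<epsilon> * e ^ 2) + 2 * (\<epsilon>' * l) = 0"
    "2 * (a * c - \<epsilon> * b * e) = 0"
    unfolding h[symmetric] xx yy xy by (simp_all add: mult.assoc)
  then have "a ^ 2 - \<epsilon> * b ^ 2 - l = 0" "c ^ 2 - \<epsilon> * e ^ 2 + \<epsilon>' * l = 0" "a * c - \<epsilon> * b * e = 0"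
    using two unfolding right_diff_distrib[symmetric] distrib_left[symmetric] mult_eq_0_iff by blast+
  then show ?thesis
    by (intro pencil_discriminant[OF _ _ _ det]) (simp_all only: eq_neg_iff_add_eq_0 right_minus_eq)
qed

text \<open>Consecutive levels q and q + 1 isolate a 1 by 1 diagonal block, and its product with the
  same block of the inverse is 1.\<close>

lemma iso_matrix_diagonal:
  assumes iso: "iso_matrix qs \<beta> \<beta>' m n" and q: "q \<in> set (0 # qs)" "Suc q \<in> set qs" "q < 6"
  shows "m q q \<noteq> 0"
proof -
  have "(\<Sum>j<6. m q j * n j q) = 1" using iso_matrixD(3)[OF iso, of q q] q(3) by (simp add: unit_vec_def)
  moreover have "m q j * n j q = 0" if "j < 6" "j \<noteq> q" for j
  proof (cases "j < q")
    case True
    then show ?thesis using iso_matrixD(2)[OF iso, of q j q] q by auto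
  next
    case False
    then show ?thesis using iso_matrixD(1)[OF iso, of "Suc q" q j] q that by auto
  qed
  ultimately have "m q q * n q q = 1" using q(3) by (simp add: sum.remove[of _ q])
  then show ?thesis by auto
qed

text \<open>The last two columns of n vanish above row 4, so the lower right 2 by 2 blocks of m and
  n are inverse to each other.\<close>

lemma iso_matrix_last_block:
  assumes iso: "iso_matrix qs \<beta> \<beta>' m n" and q: "4 \<in> set qs"
  shows "m 4 4 * m 5 5 - m 4 5 * m 5 4 \<noteq> 0"
proof -
  have z: "n j 4 = 0" "n j 5 = 0" if "j < 4" for j using iso_matrixD(2)[OF iso q] that by auto
  have "m 4 4 * n 4 4 + m 4 5 * n 5 4 = 1" "m 4 4 * n 4 5 + m 4 5 * n 5 5 = 0"
    "m 5 4 * n 4 4 + m 5 5 * n 5 4 = 0" "m 5 4 * n 4 5 + m 5 5 * n 5 5 = 1"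
    using iso_matrixD(3)[OF iso, of 4 4] iso_matrixD(3)[OF iso, of 4 5]
      iso_matrixD(3)[OF iso, of 5 4] iso_matrixD(3)[OF iso, of 5 5]
    by (simp_all add: eval_coeff z)
  moreover have "(m 4 4 * m 5 5 - m 4 5 * m 5 4) * (n 4 4 * n 5 5 - n 4 5 * n 5 4)
    = (m 4 4 * n 4 4 + m 4 5 * n 5 4) * (m 5 4 * n 4 5 + m 5 5 * n 5 5)
      - (m 4 4 * n 4 5 + m 4 5 * n 5 5) * (m 5 4 * n 4 4 + m 5 5 * n 5 4)" by algebra
  ultimately show ?thesis by auto
qed

text \<open>The digits of a stratum are its block sizes, the successive differences of the level
  list. Where possible, normal forms with the same level list become one bracket with free
  coefficients, so that one matrix computation compares them all.\<close>

definition stratum_51 :: "'k::field \<Rightarrow> ('k \<times> nat \<times> nat) list list" where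
  "stratum_51 p = [[], [], [], [], [], [(1, 0, 1), (p, 2, 3)]]"

text \<open>If p' = 0, dx_5 pulls back to the decomposable y_0 y_1, and the Pluecker relation
  between its coefficients reads m_55^2 p = 0.\<close>

lemma iso_51:
  fixes p p' :: "'k::field"
  assumes iso: "iso_matrix [5, 6, 6, 6, 6] (form_bracket (stratum_51 p)) (form_bracket (stratum_51 p')) m n" and "p' = 0"
  shows "p = 0"
proof -
  note E = iso_matrixD(5)[OF iso]
  have Z: "m i 5 = 0" if "i < 5" for i using iso_matrixD(1)[OF iso, of 5 i 5] that by simp
  have "m 5 5 \<noteq> 0" by (rule iso_matrix_diagonal[OF iso]) auto
  have "minor m 0 1 0 1 = m 5 5" "minor m 0 1 0 2 = 0" "minor m 0 1 0 3 = 0"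
    "minor m 0 1 1 2 = 0" "minor m 0 1 1 3 = 0" "minor m 0 1 2 3 = m 5 5 * p"
    using E[of 5 0 1] E[of 5 0 2] E[of 5 0 3] E[of 5 1 2] E[of 5 1 3] E[of 5 2 3] \<open>p' = 0\<close>
    by (simp_all add: stratum_51_def eval_coeff minor_def algebra_simps)
  moreover have "minor m 0 1 0 1 * minor m 0 1 2 3
    = minor m 0 1 0 2 * minor m 0 1 1 3 - minor m 0 1 0 3 * minor m 0 1 1 2"
    unfolding minor_def by algebra
  ultimately show ?thesis using \<open>m 5 5 \<noteq> 0\<close> by simp
qed

definition stratum_42 :: "'k::field \<Rightarrow> ('k \<times> nat \<times> nat) list list" where
  "stratum_42 \<epsilon> = [[], [], [], [], [(1, 0, 3), (1, 1, 2)], [(1, 1, 3), (\<epsilon>, 0, 2)]]"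

lemma iso_42_family:
  fixes \<epsilon> \<epsilon>' :: "'k::field"
  assumes two: "(2::'k) \<noteq> 0"
    and iso: "iso_matrix [4, 6, 6, 6, 6] (form_bracket (stratum_42 \<epsilon>)) (form_bracket (stratum_42 \<epsilon>')) m n"
  shows "\<exists>t. \<epsilon>' = t ^ 2 * \<epsilon>"
proof (rule pencil_iso[OF two iso_matrix_last_block[OF iso], where m = m])
  note E = iso_matrixD(5)[OF iso]
  show "minor m 0 3 0 2 + minor m 1 2 0 2 = m 4 5 * \<epsilon>" "minor m 0 3 0 3 + minor m 1 2 0 3 = m 4 4"
    "minor m 0 3 1 2 + minor m 1 2 1 2 = m 4 4" "minor m 0 3 1 3 + minor m 1 2 1 3 = m 4 5"
    "minor m 0 3 2 3 + minor m 1 2 2 3 = 0"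
    using E[of 4 0 2] E[of 4 0 3] E[of 4 1 2] E[of 4 1 3] E[of 4 2 3]
    by (simp_all add: stratum_42_def eval_coeff minor_def algebra_simps)
  show "minor m 1 3 0 2 + \<epsilon>' * minor m 0 2 0 2 = m 5 5 * \<epsilon>" "minor m 1 3 0 3 + \<epsilon>' * minor m 0 2 0 3 = m 5 4"
    "minor m 1 3 1 2 + \<epsilon>' * minor m 0 2 1 2 = m 5 4" "minor m 1 3 1 3 + \<epsilon>' * minor m 0 2 1 3 = m 5 5"
    "minor m 1 3 2 3 + \<epsilon>' * minor m 0 2 2 3 = 0"
    using E[of 5 0 2] E[of 5 0 3] E[of 5 1 2] E[of 5 1 3] E[of 5 2 3]
    by (simp_all add: stratum_42_def eval_coeff minor_def algebra_simps)
qed simp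

text \<open>In the target dx_4 and dx_5 share the factor x_0, so all polarizations vanish. In the
  source they come from a^2 - \<epsilon> b^2, which is not identically 0 even for \<epsilon> =
  0.\<close>

lemma iso_42_isotropic:
  fixes \<epsilon> :: "'k::field"
  assumes two: "(2::'k) \<noteq> 0"
    and iso: "iso_matrix [4, 6, 6, 6, 6]
      (form_bracket (stratum_42 \<epsilon>))
      (form_bracket [[], [], [], [], [(1, 0, 1)], [(1, 0, 2)]]) m n"
  shows False
proof -
  note E = iso_matrixD(5)[OF iso]
  define x where "x = minor m 0 1"
  define y where "y = minor m 0 2"
  have x: "x 0 1 = 0" "x 0 2 = m 4 5 * \<epsilon>" "x 0 3 = m 4 4" "x 1 2 = m 4 4" "x 1 3 = m 4 5" "x 2 3 = 0"
    using E[of 4 0 1] E[of 4 0 2] E[of 4 0 3] E[of 4 1 2] E[of 4 1 3] E[of 4 2 3]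
    by (simp_all add: stratum_42_def eval_coeff minor_def algebra_simps x_def)
  have y: "y 0 1 = 0" "y 0 2 = m 5 5 * \<epsilon>" "y 0 3 = m 5 4" "y 1 2 = m 5 4" "y 1 3 = m 5 5" "y 2 3 = 0"
    using E[of 5 0 1] E[of 5 0 2] E[of 5 0 3] E[of 5 1 2] E[of 5 1 3] E[of 5 2 3]
    by (simp_all add: stratum_42_def eval_coeff minor_def algebra_simps y_def)
  have "polar x x = 0" "polar y y = 0" "polar x y = 0" unfolding x_def y_def by (rule polar_minor)+
  then have "2 * (m 4 4 ^ 2 - \<epsilon> * m 4 5 ^ 2) = 0" "2 * (m 5 4 ^ 2 - \<epsilon> * m 5 5 ^ 2) = 0"
    "2 * (m 4 4 * m 5 4 - \<epsilon> * m 4 5 * m 5 5) = 0"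
    unfolding polar_def x y by (simp_all add: algebra_simps power2_eq_square)
  then show False
    using two pencil_contradiction[of "m 4 4" \<epsilon> "m 4 5" "m 5 4" "m 5 5"] iso_matrix_last_block[OF iso] by simp
qed

definition stratum_411 :: "'k::field \<Rightarrow> 'k \<Rightarrow> ('k \<times> nat \<times> nat) list list" where
  "stratum_411 p q = [[], [], [], [], [(1, 0, 1)], [(1, 0, 4), (p, 1, 3), (q, 2, 3)]]"

text \<open>x_4 occurs in dx_5 only next to x_0, which fixes x_0 up to scale; then dx_4 = x_0 x_1
  keeps x_1 in the span of x_0 and x_1. Terms x_2 x_3 and x_1 x_3 absent from the target thus cannot
  occur in the source.\<close>

lemma iso_411:
  fixes p q p' q' :: "'k::field"
  assumes iso: "iso_matrix [4, 5, 6, 6, 6] (form_bracket (stratum_411 p q)) (form_bracket (stratum_411 p' q')) m n" and "q' = 0"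
  shows "q = 0 \<and> (p' = 0 \<longrightarrow> p = 0)"
proof -
  note E = iso_matrixD(5)[OF iso]
  have Z: "m 0 4 = 0" "m 1 4 = 0" "m 2 4 = 0" "m 3 4 = 0" "m 0 5 = 0" "m 1 5 = 0" "m 2 5 = 0" "m 3 5 = 0" "m 4 5 = 0"
    using iso_matrixD(1)[OF iso, of 4] iso_matrixD(1)[OF iso, of 5] by simp_all
  have d: "m 4 4 \<noteq> 0" "m 5 5 \<noteq> 0" by (rule iso_matrix_diagonal[OF iso]; simp)+
  have 1: "m 0 1 = 0" "m 0 2 = 0" "m 0 3 = 0"
    using E[of 5 1 4] E[of 5 2 4] E[of 5 3 4] d by (simp_all add: stratum_411_def eval_coeff Z)
  have "m 5 5 = m 0 0 * m 4 4" using E[of 5 0 4] by (simp add: stratum_411_def eval_coeff Z)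
  then have "m 0 0 \<noteq> 0" using d by auto
  then have 2: "m 1 2 = 0" "m 1 3 = 0"
    using E[of 4 0 2] E[of 4 0 3] by (simp_all add: stratum_411_def eval_coeff Z 1)
  have "q = 0" using E[of 5 2 3] d \<open>q' = 0\<close> by (simp add: stratum_411_def eval_coeff Z 1 2)
  moreover have "p = 0" if "p' = 0"
    using E[of 5 1 3] d \<open>q' = 0\<close> that by (simp add: stratum_411_def eval_coeff Z 1 2)
  ultimately show ?thesis by blast
qed

definition stratum_321 :: "'k::field \<Rightarrow> 'k \<Rightarrow> 'k \<Rightarrow> 'k \<Rightarrow> 'k \<Rightarrow> ('k \<times> nat \<times> nat) list list" where
  "stratum_321 a b c e f = [[], [], [], [(1, 0, 1)], [(1, 0, 2)],
     [(a, 0, 3), (b, 0, 4), (c, 1, 3), (e, 2, 4), (f, 1, 2)]]"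

text \<open>dx_3 and dx_4 share the factor x_0, which is therefore preserved up to scale, and c X^2
  + e Y^2 on x_1, x_2 changes by congruence and scaling. Its rank and the square class of c e are
  invariant; b and f separate the forms of lower rank.\<close>

lemma iso_321:
  fixes a b c e f a' b' c' e' f' :: "'k::field"
  assumes iso: "iso_matrix [3, 5, 6, 6, 6] (form_bracket (stratum_321 a b c e f)) (form_bracket (stratum_321 a' b' c' e' f')) m n"
  shows "c' = 0 \<Longrightarrow> e' = 0 \<Longrightarrow> c = 0 \<and> e = 0"
    "\<exists>t. t \<noteq> 0 \<and> c * e = t ^ 2 * (c' * e')"
    "b' = 0 \<Longrightarrow> c' \<noteq> 0 \<Longrightarrow> e' = 0 \<Longrightarrow> f' = 0 \<Longrightarrow> a' = 0 \<Longrightarrow> c \<noteq> 0 \<Longrightarrow> b = 0"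
    "b' = 0 \<Longrightarrow> c' = 0 \<Longrightarrow> e' = 0 \<Longrightarrow> f' = 0 \<Longrightarrow> f = 0"
proof -
  note E = iso_matrixD(5)[OF iso]
  have Z: "m 0 3 = 0" "m 1 3 = 0" "m 2 3 = 0" "m 0 4 = 0" "m 1 4 = 0" "m 2 4 = 0"
    "m 0 5 = 0" "m 1 5 = 0" "m 2 5 = 0" "m 3 5 = 0" "m 4 5 = 0"
    using iso_matrixD(1)[OF iso, of 3] iso_matrixD(1)[OF iso, of 5] by simp_all
  have nZ: "n 1 3 = 0" "n 2 3 = 0" "n 1 4 = 0" "n 2 4 = 0" "n 1 5 = 0" "n 2 5 = 0"
    using iso_matrixD(2)[OF iso, of 3] by simp_all
  have g: "m 5 5 \<noteq> 0" by (rule iso_matrix_diagonal[OF iso]; simp)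
  have 1: "m 0 1 * m 1 2 - m 0 2 * m 1 1 = 0" "m 0 1 * m 2 2 - m 0 2 * m 2 1 = 0"
    using E[of 3 1 2] E[of 4 1 2] by (simp_all add: stratum_321_def eval_coeff Z)
  define \<Delta> where "\<Delta> = m 1 1 * m 2 2 - m 1 2 * m 2 1"
  have n: "n 1 0 * m 0 1 + n 1 1 * m 1 1 + n 1 2 * m 2 1 = 1" "n 1 0 * m 0 2 + n 1 1 * m 1 2 + n 1 2 * m 2 2 = 0"
    "n 2 0 * m 0 1 + n 2 1 * m 1 1 + n 2 2 * m 2 1 = 0" "n 2 0 * m 0 2 + n 2 1 * m 1 2 + n 2 2 * m 2 2 = 1"
    using iso_matrixD(4)[OF iso, of 1 1] iso_matrixD(4)[OF iso, of 1 2]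
      iso_matrixD(4)[OF iso, of 2 1] iso_matrixD(4)[OF iso, of 2 2]
    by (simp_all add: eval_coeff nZ)
  \<comment> \<open>Cauchy-Binet for rows 1, 2 of n and columns 1, 2 of m. Two of the three minors
    of m vanish by the common factor x_0, so the third, \<open>\<Delta>\<close>, is nonzero.\<close>
  have "(n 1 0 * m 0 1 + n 1 1 * m 1 1 + n 1 2 * m 2 1) * (n 2 0 * m 0 2 + n 2 1 * m 1 2 + n 2 2 * m 2 2)
      - (n 1 0 * m 0 2 + n 1 1 * m 1 2 + n 1 2 * m 2 2) * (n 2 0 * m 0 1 + n 2 1 * m 1 1 + n 2 2 * m 2 1)
    = (n 1 0 * n 2 1 - n 1 1 * n 2 0) * (m 0 1 * m 1 2 - m 0 2 * m 1 1)
      + (n 1 0 * n 2 2 - n 1 2 * n 2 0) * (m 0 1 * m 2 2 - m 0 2 * m 2 1)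
      + (n 1 1 * n 2 2 - n 1 2 * n 2 1) * \<Delta>"
    unfolding \<Delta>_def by algebra
  then have \<Delta>: "\<Delta> \<noteq> 0" unfolding n 1 by auto
  have "m 0 1 * \<Delta> = m 1 1 * (m 0 1 * m 2 2 - m 0 2 * m 2 1) - m 2 1 * (m 0 1 * m 1 2 - m 0 2 * m 1 1)"
    "m 0 2 * \<Delta> = m 1 2 * (m 0 1 * m 2 2 - m 0 2 * m 2 1) - m 2 2 * (m 0 1 * m 1 2 - m 0 2 * m 1 1)"
    unfolding \<Delta>_def by algebra+
  then have 2: "m 0 1 = 0" "m 0 2 = 0" using \<Delta> unfolding 1 by simp_all
  have 3: "m 3 3 = m 0 0 * m 1 1" "m 3 4 = m 0 0 * m 1 2" "m 4 3 = m 0 0 * m 2 1" "m 4 4 = m 0 0 * m 2 2"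
    using E[of 3 0 1] E[of 3 0 2] E[of 4 0 1] E[of 4 0 2] by (simp_all add: stratum_321_def eval_coeff 2 Z)
  have 4: "m 5 5 * c = m 0 0 * (c' * m 1 1 ^ 2 + e' * m 2 1 ^ 2)"
    "m 0 0 * (c' * m 1 1 * m 1 2 + e' * m 2 1 * m 2 2) = 0"
    "m 5 5 * e = m 0 0 * (c' * m 1 2 ^ 2 + e' * m 2 2 ^ 2)"
    using E[of 5 1 3] E[of 5 1 4] E[of 5 2 4]
    by (simp_all add: stratum_321_def eval_coeff 2 Z 3 algebra_simps power2_eq_square)
  have "m 0 0 \<noteq> 0"
  proof
    assume "m 0 0 = 0"
    then have "n 0 0 * m 0 0 = 0" by simp
    moreover have "m 0 0 * n 0 0 = 1"
      using iso_matrixD(3)[OF iso, of 0 0] by (simp add: eval_coeff Z 2)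
    ultimately show False by (simp add: mult.commute)
  qed
  \<comment> \<open>The product of the diagonal entries differs from the determinant of the
    congruent form by the square of the off-diagonal entry, which is 0.\<close>
  have "m 5 5 ^ 2 * (c * e) = (m 5 5 * c) * (m 5 5 * e)" by algebra
  also have "\<dots> = m 0 0 ^ 2 * \<Delta> ^ 2 * (c' * e') + (m 0 0 * (c' * m 1 1 * m 1 2 + e' * m 2 1 * m 2 2)) ^ 2"
    unfolding 4(1,3) \<Delta>_def by algebra
  finally have "m 5 5 ^ 2 * (c * e) = m 0 0 ^ 2 * \<Delta> ^ 2 * (c' * e')" unfolding 4(2) by simp
  then have "c * e = (m 0 0 * \<Delta> / m 5 5) ^ 2 * (c' * e')" using g by (simp add: field_simps)
  moreover have "m 0 0 * \<Delta> / m 5 5 \<noteq> 0" using g \<Delta> \<open>m 0 0 \<noteq> 0\<close> by simp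
  ultimately show "\<exists>t. t \<noteq> 0 \<and> c * e = t ^ 2 * (c' * e')" by blast
  show "c' = 0 \<Longrightarrow> e' = 0 \<Longrightarrow> c = 0 \<and> e = 0" using 4 g by simp
  show "b' = 0 \<Longrightarrow> c' = 0 \<Longrightarrow> e' = 0 \<Longrightarrow> f' = 0 \<Longrightarrow> f = 0"
    using E[of 5 1 2] g by (simp add: stratum_321_def eval_coeff 2 Z)
  assume h: "b' = 0" "c' \<noteq> 0" "e' = 0" "f' = 0" "a' = 0" "c \<noteq> 0"
  then have "m 1 1 \<noteq> 0" using 4(1) g by auto
  then have "m 1 2 = 0" using 4(2) h \<open>m 0 0 \<noteq> 0\<close> by simp
  then show "b = 0" using E[of 5 0 4] g h by (simp add: stratum_321_def eval_coeff 2 Z 3)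
qed

definition stratum_312 :: "'k::field \<Rightarrow> 'k \<Rightarrow> ('k \<times> nat \<times> nat) list list" where
  "stratum_312 p \<epsilon> = [[], [], [], [(1, 0, 1)], [(1, 0, 3), (p, 1, 2)], [(1, 1, 3), (\<epsilon>, 0, 2)]]"

text \<open>For p' = 1 this is the pencil of \<open>pencil_iso\<close>. For p' = 0 and \<epsilon>' =
  0 the target forms share the factor x_3; as the source has equal coefficients at x_0 x_3 and x_1
  x_2, the leading 2 by 2 block of m becomes singular, but its determinant is m_33.\<close>

lemma iso_312:
  fixes p p' \<epsilon> \<epsilon>' :: "'k::field"
  assumes two: "(2::'k) \<noteq> 0" and "p = 1"
    and iso: "iso_matrix [3, 4, 6, 6, 6] (form_bracket (stratum_312 p \<epsilon>)) (form_bracket (stratum_312 p' \<epsilon>')) m n"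
  shows "p' = 1 \<Longrightarrow> \<exists>t. \<epsilon>' = t ^ 2 * \<epsilon>" "p' = 0 \<Longrightarrow> \<epsilon>' \<noteq> 0"
proof -
  note E = iso_matrixD(5)[OF iso]
  have Z: "m 0 3 = 0" "m 1 3 = 0" "m 2 3 = 0" "m 3 4 = 0" "m 3 5 = 0"
    using iso_matrixD(1)[OF iso, of 3] iso_matrixD(1)[OF iso, of 4] by simp_all
  have d: "m 3 3 \<noteq> 0" by (rule iso_matrix_diagonal[OF iso]; simp)
  have 1: "m 0 0 * m 1 1 - m 0 1 * m 1 0 = m 3 3" "m 0 0 * m 1 2 - m 0 2 * m 1 0 = 0"
    "m 0 1 * m 1 2 - m 0 2 * m 1 1 = 0"
    using E[of 3 0 1] E[of 3 0 2] E[of 3 1 2] by (simp_all add: stratum_312_def eval_coeff Z)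
  have "m 0 2 * (m 0 0 * m 1 1 - m 0 1 * m 1 0)
      = m 0 1 * (m 0 0 * m 1 2 - m 0 2 * m 1 0) - m 0 0 * (m 0 1 * m 1 2 - m 0 2 * m 1 1)"
    by algebra
  then have "m 0 2 = 0" using d unfolding 1 by simp
  show "\<exists>t. \<epsilon>' = t ^ 2 * \<epsilon>" if "p' = 1"
  proof (rule pencil_iso[OF two iso_matrix_last_block[OF iso], where m = m])
    show "minor m 0 3 0 2 + minor m 1 2 0 2 = m 4 5 * \<epsilon>" "minor m 0 3 0 3 + minor m 1 2 0 3 = m 4 4"
      "minor m 0 3 1 2 + minor m 1 2 1 2 = m 4 4" "minor m 0 3 1 3 + minor m 1 2 1 3 = m 4 5"
      "minor m 0 3 2 3 + minor m 1 2 2 3 = 0"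
      using E[of 4 0 2] E[of 4 0 3] E[of 4 1 2] E[of 4 1 3] E[of 4 2 3] that \<open>p = 1\<close>
      by (simp_all add: stratum_312_def eval_coeff minor_def algebra_simps)
    show "minor m 1 3 0 2 + \<epsilon>' * minor m 0 2 0 2 = m 5 5 * \<epsilon>" "minor m 1 3 0 3 + \<epsilon>' * minor m 0 2 0 3 = m 5 4"
      "minor m 1 3 1 2 + \<epsilon>' * minor m 0 2 1 2 = m 5 4" "minor m 1 3 1 3 + \<epsilon>' * minor m 0 2 1 3 = m 5 5"
      "minor m 1 3 2 3 + \<epsilon>' * minor m 0 2 2 3 = 0"
      using E[of 5 0 2] E[of 5 0 3] E[of 5 1 2] E[of 5 1 3] E[of 5 2 3] \<open>p = 1\<close>
      by (simp_all add: stratum_312_def eval_coeff minor_def algebra_simps)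
  qed simp
  show "\<epsilon>' \<noteq> 0" if "p' = 0"
  proof
    assume "\<epsilon>' = 0"
    have "m 0 0 * m 3 3 = m 4 4" "m 0 1 * m 3 2 = m 4 4" "m 1 0 * m 3 3 = m 5 4" "m 1 1 * m 3 2 - m 1 2 * m 3 1 = m 5 4"
      using E[of 4 0 3] E[of 4 1 2] E[of 5 0 3] E[of 5 1 2] that \<open>p = 1\<close> \<open>\<epsilon>' = 0\<close> \<open>m 0 2 = 0\<close>
      by (simp_all add: stratum_312_def eval_coeff Z)
    moreover have "m 1 2 = 0"
    proof -
      have "m 1 2 * (m 0 0 * m 1 1 - m 0 1 * m 1 0)
        = m 1 1 * (m 0 0 * m 1 2 - m 0 2 * m 1 0) - m 1 0 * (m 0 1 * m 1 2 - m 0 2 * m 1 1)" by algebra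
      then show ?thesis using d unfolding 1 by simp
    qed
    ultimately have eq: "m 0 0 * m 3 3 = m 0 1 * m 3 2" "m 1 0 * m 3 3 = m 1 1 * m 3 2" by simp_all
    have "m 3 3 * m 3 3 = (m 0 0 * m 3 3) * m 1 1 - m 0 1 * (m 1 0 * m 3 3)"
      unfolding 1[symmetric] by (simp add: algebra_simps)
    also have "\<dots> = 0" unfolding eq by algebra
    finally show False using d by simp
  qed
qed

definition stratum_3111 :: "'k::field \<Rightarrow> 'k \<Rightarrow> 'k \<Rightarrow> 'k \<Rightarrow> ('k \<times> nat \<times> nat) list list" where
  "stratum_3111 p q r s = [[], [], [], [(1, 0, 1)], [(1, 0, 3), (p, 1, 2)],
     [(1, 0, 4), (q, 1, 2), (r, 1, 3), (s, 2, 3)]]"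

text \<open>x_3 enters dx_4 only through x_0 x_3, so x_0 picks up no multiple of x_1; the vanishing
  of further entries follows from dx_3 and dx_4. Hence p, q and r are only rescaled in the cases
  compared.\<close>

lemma iso_3111:
  fixes p q r s p' q' r' s' :: "'k::field"
  assumes iso: "iso_matrix [3, 4, 5, 6, 6] (form_bracket (stratum_3111 p q r s)) (form_bracket (stratum_3111 p' q' r' s')) m n"
  shows "p' = 0 \<Longrightarrow> p = 0"
    "p = 0 \<Longrightarrow> p' = 0 \<Longrightarrow> s = 0 \<Longrightarrow> s' = 0 \<Longrightarrow> (q' = 0 \<longrightarrow> q = 0) \<and> (r' = 0 \<longrightarrow> r = 0)"
proof -
  note E = iso_matrixD(5)[OF iso]
  have Z: "m 0 3 = 0" "m 1 3 = 0" "m 2 3 = 0" "m 0 4 = 0" "m 1 4 = 0" "m 2 4 = 0" "m 3 4 = 0"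
    "m 0 5 = 0" "m 1 5 = 0" "m 2 5 = 0" "m 3 5 = 0" "m 4 5 = 0"
    using iso_matrixD(1)[OF iso, of 3] iso_matrixD(1)[OF iso, of 4] iso_matrixD(1)[OF iso, of 5] by simp_all
  have d: "m 3 3 \<noteq> 0" "m 4 4 \<noteq> 0" "m 5 5 \<noteq> 0" by (rule iso_matrix_diagonal[OF iso]; simp)+
  have 1: "m 0 1 = 0" using E[of 4 1 3] d by (simp add: stratum_3111_def eval_coeff Z)
  have "m 0 0 * m 3 3 = m 4 4" using E[of 4 0 3] by (simp add: stratum_3111_def eval_coeff Z)
  then have "m 0 0 \<noteq> 0" using d by auto
  have "m 0 0 * m 1 1 = m 3 3" using E[of 3 0 1] by (simp add: stratum_3111_def eval_coeff 1 Z)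
  then have "m 1 1 \<noteq> 0" using d by auto
  then have 2: "m 0 2 = 0" using E[of 3 1 2] by (simp add: stratum_3111_def eval_coeff 1 Z)
  then have 3: "m 1 2 = 0" using E[of 3 0 2] \<open>m 0 0 \<noteq> 0\<close> by (simp add: stratum_3111_def eval_coeff Z 2)
  show "p' = 0 \<Longrightarrow> p = 0" using E[of 4 1 2] d by (simp add: stratum_3111_def eval_coeff 1 2 Z)
  assume h: "p = 0" "p' = 0" "s = 0" "s' = 0"
  have 4: "m 3 2 = 0" using E[of 4 0 2] h \<open>m 0 0 \<noteq> 0\<close> by (simp add: stratum_3111_def eval_coeff 2 3 Z)
  show "(q' = 0 \<longrightarrow> q = 0) \<and> (r' = 0 \<longrightarrow> r = 0)"
    using E[of 5 1 2] E[of 5 1 3] d h by (auto simp: stratum_3111_def eval_coeff 1 2 3 4 Z)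
qed

definition stratum_2121 :: "'k::field \<Rightarrow> ('k \<times> nat \<times> nat) list list" where
  "stratum_2121 \<epsilon> = [[], [], [(1, 0, 1)], [(1, 0, 2)], [(1, 1, 2)], [(1, 0, 3), (\<epsilon>, 1, 4)]]"

text \<open>If P is the block on x_0, x_1, then x_2 scales by det P, and (x_3, x_4) transforms by
  det P times P. So X^2 + \<epsilon> Y^2 changes by congruence and scaling, and comparing
  determinants gives the square factor.\<close>

lemma iso_2121:
  fixes \<epsilon> \<epsilon>' :: "'k::field"
  assumes iso: "iso_matrix [2, 3, 5, 6, 6] (form_bracket (stratum_2121 \<epsilon>)) (form_bracket (stratum_2121 \<epsilon>')) m n"
  shows "\<exists>t. \<epsilon> = t ^ 2 * \<epsilon>'"
proof -
  note E = iso_matrixD(5)[OF iso]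
  have Z: "m 0 2 = 0" "m 1 2 = 0" "m 0 3 = 0" "m 1 3 = 0" "m 2 3 = 0" "m 0 4 = 0" "m 1 4 = 0" "m 2 4 = 0"
    using iso_matrixD(1)[OF iso, of 2] iso_matrixD(1)[OF iso, of 3] by simp_all
  have d: "m 2 2 \<noteq> 0" "m 5 5 \<noteq> 0" by (rule iso_matrix_diagonal[OF iso]; simp)+
  have 1: "m 3 3 = m 0 0 * m 2 2" "m 3 4 = m 0 1 * m 2 2" "m 4 3 = m 1 0 * m 2 2" "m 4 4 = m 1 1 * m 2 2"
    "m 2 2 = m 0 0 * m 1 1 - m 0 1 * m 1 0"
    using E[of 3 0 2] E[of 3 1 2] E[of 4 0 2] E[of 4 1 2] E[of 2 0 1] by (simp_all add: stratum_2121_def eval_coeff Z)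
  have 2: "m 5 5 = m 2 2 * (m 0 0 ^ 2 + \<epsilon>' * m 1 0 ^ 2)" "m 2 2 * (m 0 0 * m 0 1 + \<epsilon>' * m 1 0 * m 1 1) = 0"
    "m 5 5 * \<epsilon> = m 2 2 * (m 0 1 ^ 2 + \<epsilon>' * m 1 1 ^ 2)"
    using E[of 5 0 3] E[of 5 0 4] E[of 5 1 4]
    by (simp_all add: stratum_2121_def eval_coeff Z 1(1-4) algebra_simps power2_eq_square)
  have "m 5 5 ^ 2 * \<epsilon> = m 5 5 * (m 5 5 * \<epsilon>)" by algebra
  also have "\<dots> = m 2 2 ^ 2 * ((m 0 0 * m 1 1 - m 0 1 * m 1 0) ^ 2 * \<epsilon>')
      + (m 2 2 * (m 0 0 * m 0 1 + \<epsilon>' * m 1 0 * m 1 1)) ^ 2"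
    unfolding 2(3) unfolding 2(1) by algebra
  also have "\<dots> = (m 2 2 * m 2 2) ^ 2 * \<epsilon>'" unfolding 2(2) 1(5)[symmetric] by (simp add: power2_eq_square)
  finally have "\<epsilon> = (m 2 2 * m 2 2 / m 5 5) ^ 2 * \<epsilon>'" using d by (simp add: field_simps)
  then show ?thesis by blast
qed

definition stratum_21111 :: "'k::field \<Rightarrow> 'k \<Rightarrow> 'k \<Rightarrow> 'k \<Rightarrow> 'k \<Rightarrow> 'k \<Rightarrow> ('k \<times> nat \<times> nat) list list" where
  "stratum_21111 p a b c e f = [[], [], [(1, 0, 1)], [(1, 0, 2)], [(1, 0, 3), (p, 1, 2)],
     [(a, 0, 4), (b, 1, 3), (c, 1, 2), (e, 1, 4), (f, 2, 3)]]"

text \<open>Once m_01 = 0, each coefficient equation contains a nonzero diagonal factor, so a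
  coefficient absent from the target is absent from the source. The last claim tells forms 17 and 18
  apart.\<close>

lemma iso_21111:
  fixes p a b c e f p' a' b' c' e' f' :: "'k::field"
  assumes iso: "iso_matrix [2, 3, 4, 5, 6] (form_bracket (stratum_21111 p a b c e f)) (form_bracket (stratum_21111 p' a' b' c' e' f')) m n"
  shows "p' = 0 \<Longrightarrow> p = 0" "e' = 0 \<Longrightarrow> e = 0"
    "p = 0 \<Longrightarrow> b' = 0 \<Longrightarrow> c' = 0 \<Longrightarrow> e' = 0 \<Longrightarrow> f' = 0 \<Longrightarrow> c = 0"
proof -
  note E = iso_matrixD(5)[OF iso]
  have Z: "m 0 2 = 0" "m 1 2 = 0" "m 0 3 = 0" "m 1 3 = 0" "m 2 3 = 0" "m 0 4 = 0" "m 1 4 = 0" "m 2 4 = 0" "m 3 4 = 0"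
    "m 3 5 = 0" "m 4 5 = 0"
    using iso_matrixD(1)[OF iso, of 2] iso_matrixD(1)[OF iso, of 3] iso_matrixD(1)[OF iso, of 4]
      iso_matrixD(1)[OF iso, of 5] by simp_all
  have d: "m 2 2 \<noteq> 0" "m 4 4 \<noteq> 0" "m 5 5 \<noteq> 0" by (rule iso_matrix_diagonal[OF iso]; simp)+
  have 1: "m 0 1 = 0" using E[of 3 1 2] d by (simp add: stratum_21111_def eval_coeff Z)
  show "p' = 0 \<Longrightarrow> p = 0" using E[of 4 1 2] d by (simp add: stratum_21111_def eval_coeff 1 Z)
  show "e' = 0 \<Longrightarrow> e = 0" using E[of 5 1 4] d by (simp add: stratum_21111_def eval_coeff 1 Z)
  show "p = 0 \<Longrightarrow> b' = 0 \<Longrightarrow> c' = 0 \<Longrightarrow> e' = 0 \<Longrightarrow> f' = 0 \<Longrightarrow> c = 0"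
    using E[of 5 1 2] d by (simp add: stratum_21111_def eval_coeff 1 Z)
qed

declare One_nat_def [simp]

section \<open>Uniqueness of the normal form\<close>

lemma form_bracket_eqI:
  assumes "length L = length L'"
    and "\<forall>i<length L. \<forall>u v. (\<Sum>(c, p, q)\<leftarrow>L ! i. c * (u p * v q - u q * v p))
      = (\<Sum>(c, p, q)\<leftarrow>L' ! i. c * (u p * v q - u q * v p))"
  shows "form_bracket L = form_bracket L'"
  using assms by (auto simp: form_bracket_def fun_eq_iff)

text \<open>Equality is asserted for the brackets only, since the lists may differ by entries with
  coefficient 0.\<close>

lemma normal_form_stratum:
  "k \<in> {1, 2} \<Longrightarrow> form_bracket (normal_form k \<epsilon>) = form_bracket (stratum_51 (of_bool (k = 2)))"
  "form_bracket (normal_form 3 \<epsilon>) = form_bracket [[], [], [], [], [(1, 0, 1)], [(1, 0, 2)]]"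
  "form_bracket (normal_form 22 \<epsilon>) = form_bracket (stratum_42 \<epsilon>)"
  "k \<in> {4, 5, 6} \<Longrightarrow> form_bracket (normal_form k \<epsilon>)
     = form_bracket (stratum_411 (of_bool (k = 5)) (of_bool (k = 6)))"
  "k \<in> {8, 9, 10, 23} \<Longrightarrow> form_bracket (normal_form k \<epsilon>)
     = form_bracket (stratum_321 (of_bool (k \<in> {8, 9})) (of_bool (k = 10)) (of_bool (k \<in> {10, 23}))
         (if k = 23 then \<epsilon> else 0) (of_bool (k = 9)))"
  "k \<in> {11, 24} \<Longrightarrow> form_bracket (normal_form k \<epsilon>)
     = form_bracket (stratum_312 (of_bool (k = 24)) (if k = 24 then \<epsilon> else 0))"
  "k \<in> {12, 13, 14, 15, 16} \<Longrightarrow> form_bracket (normal_form k \<epsilon>)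
     = form_bracket (stratum_3111 (of_bool (k = 16)) (of_bool (k \<in> {13, 15})) (of_bool (k \<in> {14, 15}))
         (- of_bool (k = 16)))"
  "form_bracket (normal_form 25 \<epsilon>) = form_bracket (stratum_2121 \<epsilon>)"
  "k \<in> {17, 18, 19, 20, 21} \<Longrightarrow> form_bracket (normal_form k \<epsilon>)
     = form_bracket (stratum_21111 (of_bool (k \<in> {20, 21})) (of_bool (k \<in> {17, 18, 20})) (of_bool (k = 20))
         (of_bool (k = 18)) (of_bool (k \<in> {19, 21})) (- of_bool (k \<in> {19, 21})))"
  by (rule form_bracket_eqI; (elim insertE emptyE)?; simp add: normal_form_def all_less_numeral stratum_51_def stratum_42_def stratum_411_def stratum_321_def
        stratum_312_def stratum_3111_def stratum_2121_def stratum_21111_def)+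

lemma less_26_cases:
  assumes "k < (26::nat)"
  shows "k \<in> {0, 1, 2, 3, 4, 5, 6, 7, 8, 9, 10, 11, 12, 13, 14, 15, 16, 17, 18, 19, 20, 21, 22, 23, 24, 25}"
  using assms unfolding insert_iff empty_iff by presburger

lemma nilpotent_normal_form:
  fixes \<epsilon> :: "'k::field"
  assumes "k < 26"
  shows "nilpotent 6 (form_bracket (normal_form k \<epsilon>))"
proof -
  have L: "length (normal_form k \<epsilon>) = 6" "\<forall>i<6. \<forall>(c, p, q)\<in>set (normal_form k \<epsilon> ! i). p < i \<and> q < i"
    using less_26_cases[OF assms] by (elim insertE emptyE; simp add: all_less_numeral normal_form_def)+
  have "alternating i (\<lambda>u v. form_bracket (normal_form k \<epsilon>) u v i)" if "i < 6" for i
    unfolding form_bracket_def using alternating_form[of "normal_form k \<epsilon> ! i" i] L that by auto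
  moreover have "form_bracket (normal_form k \<epsilon>) (form_bracket (normal_form k \<epsilon>) u v) w i
    + form_bracket (normal_form k \<epsilon>) (form_bracket (normal_form k \<epsilon>) v w) u i
    + form_bracket (normal_form k \<epsilon>) (form_bracket (normal_form k \<epsilon>) w u) v i = 0" if "i < 6" for u v w i
  proof -
    have "i \<in> {0, 1, 2, 3, 4, 5}"
      using that unfolding insert_iff empty_iff by presburger
    with less_26_cases[OF assms] show ?thesis
      by (elim insertE emptyE; simp add: form_bracket_def normal_form_def algebra_simps)
  qed
  ultimately show ?thesis using assms unfolding nilpotent_def jacobi_def by blast
qed

lemma level_list_cases:
  assumes "k < 26"
  shows "level_list k = [6, 6, 6, 6, 6] \<and> k \<in> {0} \<or>
    level_list k = [3, 6, 6, 6, 6] \<and> k \<in> {7} \<or>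
    level_list k = [5, 6, 6, 6, 6] \<and> k \<in> {1, 2} \<or>
    level_list k = [4, 6, 6, 6, 6] \<and> k \<in> {3, 22} \<or>
    level_list k = [4, 5, 6, 6, 6] \<and> k \<in> {4, 5, 6} \<or>
    level_list k = [3, 5, 6, 6, 6] \<and> k \<in> {8, 9, 10, 23} \<or>
    level_list k = [3, 4, 6, 6, 6] \<and> k \<in> {11, 24} \<or>
    level_list k = [3, 4, 5, 6, 6] \<and> k \<in> {12, 13, 14, 15, 16} \<or>
    level_list k = [2, 3, 5, 6, 6] \<and> k \<in> {25} \<or>
    level_list k = [2, 3, 4, 5, 6] \<and> k \<in> {17, 18, 19, 20, 21}"
  using less_26_cases[OF assms] by (elim insertE emptyE; simp add: level_list_def)

text \<open>The comparison of discriminants yields a factor t that might be 0; having it in both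
  directions settles that case.\<close>

lemma square_multiple_unit:
  fixes x y :: "'k::field"
  assumes "\<exists>t. x = t ^ 2 * y" "\<exists>t. y = t ^ 2 * x"
  shows "\<exists>t. t \<noteq> 0 \<and> x = t ^ 2 * y"
proof (cases "x = 0")
  case True
  then show ?thesis using assms(2) by (intro exI[of _ 1]) auto
next
  case False
  then show ?thesis using assms(1) by fastforce
qed

lemma normal_form_unique:
  fixes \<epsilon> \<epsilon>' :: "'k::field"
  assumes two: "(2::'k) \<noteq> 0" and k: "k < 26" "k' < 26"
    and iso: "lie_iso 6 (form_bracket (normal_form k \<epsilon>)) (form_bracket (normal_form k' \<epsilon>'))"
  shows "k = k' \<and> (22 \<le> k \<longrightarrow> (\<exists>t. t \<noteq> 0 \<and> \<epsilon>' = t ^ 2 * \<epsilon>))"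
proof -
  obtain m n where lev: "level_list k = level_list k'"
    and M: "iso_matrix (level_list k) (form_bracket (normal_form k \<epsilon>)) (form_bracket (normal_form k' \<epsilon>')) m n"
    using lie_iso_matrix[OF nilpotent_imp_bracket[OF nilpotent_normal_form]
        nilpotent_imp_bracket[OF nilpotent_normal_form] iso levels_normal_form(1) levels_normal_form(1)]
      levels_normal_form(2) k by metis
  note M' = iso_matrix_sym[OF M]
  from level_list_cases[OF k(1)] show ?thesis
  proof (elim disjE conjE)
    assume "level_list k = [6, 6, 6, 6, 6]" "k \<in> {0}"
    moreover from this have "k' \<in> {0}" using level_list_cases[OF k(2)] unfolding lev by auto
    ultimately show ?thesis by auto
  next
    assume "level_list k = [3, 6, 6, 6, 6]" "k \<in> {7}"
    moreover from this have "k' \<in> {7}" using level_list_cases[OF k(2)] unfolding lev by auto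
    ultimately show ?thesis by auto
  next
    assume l: "level_list k = [5, 6, 6, 6, 6]" and "k \<in> {1, 2}"
    moreover have "k' \<in> {1, 2}" using level_list_cases[OF k(2)] l unfolding lev by auto
    ultimately have kk: "k \<in> {1, 2}" "k' \<in> {1, 2}" by auto
    note N = M[unfolded l normal_form_stratum(1)[OF kk(1)] normal_form_stratum(1)[OF kk(2)]]
    show ?thesis using iso_51[OF N] iso_51[OF iso_matrix_sym[OF N]] kk by auto
  next
    assume l: "level_list k = [4, 6, 6, 6, 6]" and "k \<in> {3, 22}"
    moreover have "k' \<in> {3, 22}" using level_list_cases[OF k(2)] l unfolding lev by auto
    ultimately have kk: "k \<in> {3, 22}" "k' \<in> {3, 22}" by auto
    have "False" if "k = 22" "k' = 3"
      using iso_42_isotropic[OF two, of \<epsilon> m n] M that l by (simp add: normal_form_stratum(2,3))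
    moreover have "False" if "k = 3" "k' = 22"
      using iso_42_isotropic[OF two, of \<epsilon>' n m] M' that l by (simp add: normal_form_stratum(2,3))
    moreover have "\<exists>t. t \<noteq> 0 \<and> \<epsilon>' = t ^ 2 * \<epsilon>" if "k = 22" "k' = 22"
      using iso_42_family[OF two, of \<epsilon> \<epsilon>' m n] iso_42_family[OF two, of \<epsilon>' \<epsilon> n m] M M' that l
      by (intro square_multiple_unit) (simp_all add: normal_form_stratum(3))
    ultimately show ?thesis using kk by auto
  next
    assume l: "level_list k = [4, 5, 6, 6, 6]" and "k \<in> {4, 5, 6}"
    moreover have "k' \<in> {4, 5, 6}" using level_list_cases[OF k(2)] l unfolding lev by auto
    ultimately have kk: "k \<in> {4, 5, 6}" "k' \<in> {4, 5, 6}" by auto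
    note N = M[unfolded l normal_form_stratum(4)[OF kk(1)] normal_form_stratum(4)[OF kk(2)]]
    show ?thesis using iso_411[OF N] iso_411[OF iso_matrix_sym[OF N]] kk by auto
  next
    assume l: "level_list k = [3, 5, 6, 6, 6]" and "k \<in> {8, 9, 10, 23}"
    moreover have "k' \<in> {8, 9, 10, 23}" using level_list_cases[OF k(2)] l unfolding lev by auto
    ultimately have kk: "k \<in> {8, 9, 10, 23}" "k' \<in> {8, 9, 10, 23}" by auto
    note N = M[unfolded l normal_form_stratum(5)[OF kk(1)] normal_form_stratum(5)[OF kk(2)]]
    note I = iso_321[OF N] iso_321[OF iso_matrix_sym[OF N]]
    have "k = k'" using I kk by (elim insertE emptyE) auto
    moreover have "\<exists>t. t \<noteq> 0 \<and> \<epsilon>' = t ^ 2 * \<epsilon>" if "k = 23" "k' = 23"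
      using I(6) that by simp
    ultimately show ?thesis using kk by auto
  next
    assume l: "level_list k = [3, 4, 6, 6, 6]" and "k \<in> {11, 24}"
    moreover have "k' \<in> {11, 24}" using level_list_cases[OF k(2)] l unfolding lev by auto
    ultimately have kk: "k \<in> {11, 24}" "k' \<in> {11, 24}" by auto
    note N = M[unfolded l normal_form_stratum(6)[OF kk(1)] normal_form_stratum(6)[OF kk(2)]]
    note I = iso_312[OF two _ N] iso_312[OF two _ iso_matrix_sym[OF N]]
    have "k = k'" using I(2,4) kk by (elim insertE emptyE) auto
    moreover have "\<exists>t. t \<noteq> 0 \<and> \<epsilon>' = t ^ 2 * \<epsilon>" if "k = 24" "k' = 24"
      using I(1,3) that by (intro square_multiple_unit) simp_all
    ultimately show ?thesis using kk by auto
  next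
    assume l: "level_list k = [3, 4, 5, 6, 6]" and "k \<in> {12, 13, 14, 15, 16}"
    moreover have "k' \<in> {12, 13, 14, 15, 16}" using level_list_cases[OF k(2)] l unfolding lev by auto
    ultimately have kk: "k \<in> {12, 13, 14, 15, 16}" "k' \<in> {12, 13, 14, 15, 16}" by auto
    note N = M[unfolded l normal_form_stratum(7)[OF kk(1)] normal_form_stratum(7)[OF kk(2)]]
    note I = iso_3111[OF N] iso_3111[OF iso_matrix_sym[OF N]]
    have "k = k'" using I kk by (elim insertE emptyE) auto
    then show ?thesis using kk by auto
  next
    assume lk: "level_list k = [2, 3, 5, 6, 6]" and "k \<in> {25}"
    moreover have "k' \<in> {25}" using level_list_cases[OF k(2)] lk unfolding lev by auto
    ultimately have l: "k = 25" "k' = 25" "level_list k = [2, 3, 5, 6, 6]" by auto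
    note N = M[unfolded l(3)[unfolded l(1)] l(1,2) normal_form_stratum(8)]
    show ?thesis
      using square_multiple_unit[OF iso_2121[OF iso_matrix_sym[OF N]] iso_2121[OF N]] l by simp
  next
    assume l: "level_list k = [2, 3, 4, 5, 6]" and "k \<in> {17, 18, 19, 20, 21}"
    moreover have "k' \<in> {17, 18, 19, 20, 21}" using level_list_cases[OF k(2)] l unfolding lev by auto
    ultimately have kk: "k \<in> {17, 18, 19, 20, 21}" "k' \<in> {17, 18, 19, 20, 21}" by auto
    note N = M[unfolded l normal_form_stratum(9)[OF kk(1)] normal_form_stratum(9)[OF kk(2)]]
    note I = iso_21111[OF N] iso_21111[OF iso_matrix_sym[OF N]]
    have "k = k'" using I kk by (elim insertE emptyE) auto
    then show ?thesis using kk by auto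
  qed
qed

lemma normal_form_scale:
  fixes c :: "'k::field"
  assumes "k \<in> {22, 23, 24, 25}" "c \<noteq> 0"
  shows "lie_iso 6 (form_bracket (normal_form k \<epsilon>)) (form_bracket (normal_form k (c ^ 2 * \<epsilon>)))"
proof -
  \<comment> \<open>Diagonal weights under which every coefficient is kept except the one carrying
    \<epsilon>, which acquires c^2.\<close>
  define R :: "('k \<times> nat) list list" where "R = (if k = 23 then [[(1, 0)], [(c, 1)], [(1, 2)], [(c, 3)], [(1, 4)], [(c ^ 2, 5)]]
    else if k = 25 then [[(c, 0)], [(1, 1)], [(c, 2)], [(c ^ 2, 3)], [(c, 4)], [(c ^ 3, 5)]]
    else [[(1, 0)], [(c, 1)], [(1, 2)], [(c, 3)], [(c, 4)], [(c ^ 2, 5)]])"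
  have R: "length R = 6" "\<forall>r\<in>set R. \<forall>(c, j)\<in>set r. j < 6" by (simp_all add: R_def)
  have "linear_map 6 (row_map R)" using linear_map_row_map[of R] R by simp
  moreover have "injective_map 6 (row_map R)"
    using assms(1) by (elim insertE emptyE; simp add: injective_map_def all_less_numeral row_map_def R_def assms(2))
  moreover have "lie_hom 6 (row_map R) (form_bracket (normal_form k \<epsilon>)) (form_bracket (normal_form k (c ^ 2 * \<epsilon>)))"
    using assms(1) by (elim insertE emptyE; simp add: lie_hom_def all_less_numeral row_map_def R_def
        form_bracket_def normal_form_def algebra_simps power2_eq_square power3_eq_cube)
  ultimately show ?thesis unfolding lie_iso_def by blast
qed

section \<open>The exterior algebra\<close>

lemma ext_sign_union_left:
  assumes "finite A" "finite B" "finite C" "A \<inter> B = {}"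
  shows "(ext_sign (A \<union> B) C :: 'k::field) = ext_sign A C * ext_sign B C"
proof -
  have "finite {(a, b). a \<in> X \<and> b \<in> C \<and> b < a}" if "finite X" for X :: "nat set"
    by (rule finite_subset[of _ "X \<times> C"]) (use that assms in auto)
  moreover have "{(a, b). a \<in> A \<union> B \<and> b \<in> C \<and> b < a}
    = {(a, b). a \<in> A \<and> b \<in> C \<and> b < a} \<union> {(a, b). a \<in> B \<and> b \<in> C \<and> b < a}" by auto
  moreover have "{(a, b). a \<in> A \<and> b \<in> C \<and> b < a} \<inter> {(a, b). a \<in> B \<and> b \<in> C \<and> b < a} = {}"
    using assms(4) by auto
  ultimately show ?thesis
    using assms by (simp add: ext_sign_def card_Un_disjoint power_add)
qed

lemma ext_sign_union_right:
  assumes "finite A" "finite B" "finite C" "B \<inter> C = {}"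
  shows "(ext_sign A (B \<union> C) :: 'k::field) = ext_sign A B * ext_sign A C"
proof -
  have "finite {(a, b). a \<in> A \<and> b \<in> X \<and> b < a}" if "finite X" for X :: "nat set"
    by (rule finite_subset[of _ "A \<times> X"]) (use that assms in auto)
  moreover have "{(a, b). a \<in> A \<and> b \<in> B \<union> C \<and> b < a}
    = {(a, b). a \<in> A \<and> b \<in> B \<and> b < a} \<union> {(a, b). a \<in> A \<and> b \<in> C \<and> b < a}" by auto
  moreover have "{(a, b). a \<in> A \<and> b \<in> B \<and> b < a} \<inter> {(a, b). a \<in> A \<and> b \<in> C \<and> b < a} = {}"
    using assms(4) by auto
  ultimately show ?thesis
    using assms by (simp add: ext_sign_def card_Un_disjoint power_add)
qed

text \<open>Each pair from A and B is an inversion in exactly one of the two orders, so the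
  inversion counts add up to the product of the cardinalities.\<close>

lemma ext_sign_swap:
  assumes "finite A" "finite B" "A \<inter> B = {}"
  shows "ext_sign A B * ext_sign B A = ((-1) ^ (card A * card B) :: 'k::field)"
proof -
  let ?X = "{(a, b). a \<in> A \<and> b \<in> B \<and> b < a}" and ?Y = "{(a, b). a \<in> A \<and> b \<in> B \<and> a < b}"
  have fin: "finite ?X" "finite ?Y"
    by (rule finite_subset[of _ "A \<times> B"]; use assms in auto)+
  have "{(b, a). b \<in> B \<and> a \<in> A \<and> a < b} = prod.swap ` ?Y" by auto
  then have "card {(b, a). b \<in> B \<and> a \<in> A \<and> a < b} = card ?Y"
    by (simp add: card_image)
  moreover have "?X \<union> ?Y = A \<times> B" using assms(3) by (auto simp: neq_iff[symmetric])
  moreover have "card (?X \<union> ?Y) = card ?X + card ?Y" using fin by (intro card_Un_disjoint) auto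
  ultimately show ?thesis by (simp add: ext_sign_def card_cartesian_product flip: power_add)
qed

lemma ext_sign_square: "ext_sign A B * ext_sign A B = (1 :: 'k::field)"
  by (simp add: ext_sign_def flip: power_mult_distrib)

lemma ext_sign_square_left: "ext_sign A B * (ext_sign A B * x) = (x :: 'k::field)"
  by (simp add: ext_sign_square flip: mult.assoc)

lemma ext_sign_empty [simp]: "ext_sign {} B = 1" "ext_sign A {} = 1"
  by (simp_all add: ext_sign_def)

lemma ext_sign_less:
  assumes "\<And>a b. a \<in> A \<Longrightarrow> b \<in> B \<Longrightarrow> a < b"
  shows "ext_sign A B = 1"
proof -
  have "{(a, b). a \<in> A \<and> b \<in> B \<and> b < a} = {}" using assms by fastforce
  then show ?thesis by (simp only: ext_sign_def card.empty power_0)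
qed

lemma ext_sign_greater_singleton: "b < a \<Longrightarrow> ext_sign {a} {b} = (-1 :: 'k::field)"
proof -
  assume "b < a"
  then have "{(x, y). x \<in> {a} \<and> y \<in> {b} \<and> y < x} = {(a, b)}" by auto
  then show ?thesis by (simp add: ext_sign_def)
qed

lemma ext_mult_linear_left:
  "ext_mult (\<lambda>S. c * f S + f' S) g = (\<lambda>S. c * ext_mult f g S + ext_mult f' g S)"
  by (auto simp: ext_mult_def fun_eq_iff sum.distrib sum_distrib_left algebra_simps)

lemma ext_mult_linear_right:
  "ext_mult f (\<lambda>S. c * g S + g' S) = (\<lambda>S. c * ext_mult f g S + ext_mult f g' S)"
  by (auto simp: ext_mult_def fun_eq_iff sum.distrib sum_distrib_left algebra_simps)

lemma ext_mult_scale: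
  "ext_mult (\<lambda>S. c * f S) g = (\<lambda>S. c * ext_mult f g S)"
  "ext_mult f (\<lambda>S. c * g S) = (\<lambda>S. c * ext_mult f g S)"
  by (auto simp: ext_mult_def fun_eq_iff sum_distrib_left algebra_simps)

lemma ext_mult_zero [simp]: "ext_mult (\<lambda>S. 0) g = (\<lambda>S. 0)" "ext_mult f (\<lambda>S. 0) = (\<lambda>S. 0)"
  by (auto simp: ext_mult_def fun_eq_iff)

lemma ext_mult_sum:
  "ext_mult (\<lambda>S. \<Sum>i\<in>I. f i S) g = (\<lambda>S. \<Sum>i\<in>I. ext_mult (f i) g S)"
  "ext_mult f' (\<lambda>S. \<Sum>i\<in>I. h i S) = (\<lambda>S. \<Sum>i\<in>I. ext_mult f' (h i) S)"
proof -
  show "ext_mult (\<lambda>S. \<Sum>i\<in>I. f i S) g = (\<lambda>S. \<Sum>i\<in>I. ext_mult (f i) g S)"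
  proof
    fix S
    show "ext_mult (\<lambda>S. \<Sum>i\<in>I. f i S) g S = (\<Sum>i\<in>I. ext_mult (f i) g S)"
      unfolding ext_mult_def using sum.swap[of "\<lambda>A i. ext_sign A (S - A) * f i A * g (S - A)" I "Pow S"]
      by (simp add: sum_distrib_left sum_distrib_right)
  qed
  show "ext_mult f' (\<lambda>S. \<Sum>i\<in>I. h i S) = (\<lambda>S. \<Sum>i\<in>I. ext_mult f' (h i) S)"
  proof
    fix S
    show "ext_mult f' (\<lambda>S. \<Sum>i\<in>I. h i S) S = (\<Sum>i\<in>I. ext_mult f' (h i) S)"
      unfolding ext_mult_def using sum.swap[of "\<lambda>A i. ext_sign A (S - A) * f' A * h i (S - A)" I "Pow S"]
      by (simp add: sum_distrib_left)
  qed
qed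

text \<open>Both sides sum over decompositions of S into three blocks: chains A in B in S on the
  left, disjoint A and C on the right, matched by C = B - A. Either sign counts the inversions
  between the three pairs of blocks.\<close>

lemma ext_mult_assoc: "ext_mult (ext_mult f g) h = ext_mult f (ext_mult g h)"
proof
  fix S :: "nat set"
  show "ext_mult (ext_mult f g) h S = ext_mult f (ext_mult g h) S"
  proof (cases "finite S")
    case True
    define t where "t A B = ext_sign A (B - A) * ext_sign B (S - B) * (f A * g (B - A) * h (S - B))" for A B
    define s where "s A C = ext_sign A (S - A) * ext_sign C (S - A - C) * (f A * g C * h (S - A - C))" for A C
    have "ext_mult (ext_mult f g) h S = (\<Sum>B\<in>Pow S. \<Sum>A\<in>Pow B. t A B)"
      using True by (simp add: ext_mult_def t_def sum_distrib_left sum_distrib_right finite_subset algebra_simps)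
    also have "\<dots> = (\<Sum>(B, A)\<in>Sigma (Pow S) Pow. t A B)"
      using True by (intro sum.Sigma) (auto intro: finite_subset)
    also have "\<dots> = (\<Sum>(A, C)\<in>Sigma (Pow S) (\<lambda>A. Pow (S - A)). s A C)"
    proof (rule sum.reindex_bij_witness[of _ "\<lambda>(A, C). (A \<union> C, A)" "\<lambda>(B, A). (A, B - A)"])
      fix x assume x: "x \<in> Sigma (Pow S) Pow"
      obtain B A where BA: "x = (B, A)" by (cases x)
      have sub: "A \<subseteq> B" "B \<subseteq> S" using x BA by auto
      have fin: "finite A" "finite B"
        using sub True finite_subset[of B S] finite_subset[of A B] by auto
      show "(\<lambda>(A, C). (A \<union> C, A)) ((\<lambda>(B, A). (A, B - A)) x) = x" using BA sub by auto
      show "(\<lambda>(B, A). (A, B - A)) x \<in> Sigma (Pow S) (\<lambda>A. Pow (S - A))" using BA sub by auto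
      have BS: "B = A \<union> (B - A)" "S - A = (B - A) \<union> (S - B)" "S - A - (B - A) = S - B" using sub by auto
      have "(ext_sign B (S - B) :: 'a) = ext_sign A (S - B) * ext_sign (B - A) (S - B)"
        by (subst BS(1), rule ext_sign_union_left) (use fin True in auto)
      moreover have "(ext_sign A (S - A) :: 'a) = ext_sign A (B - A) * ext_sign A (S - B)"
        by (subst BS(2), rule ext_sign_union_right) (use fin True in auto)
      ultimately show "(case (\<lambda>(B, A). (A, B - A)) x of (A, C) \<Rightarrow> s A C) = (case x of (B, A) \<Rightarrow> t A B)"
        using BA BS(3) by (simp add: s_def t_def)
    next
      fix y assume y: "y \<in> Sigma (Pow S) (\<lambda>A. Pow (S - A))"
      then show "(\<lambda>(B, A). (A, B - A)) ((\<lambda>(A, C). (A \<union> C, A)) y) = y" by auto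
      show "(\<lambda>(A, C). (A \<union> C, A)) y \<in> Sigma (Pow S) Pow" using y by auto
    qed
    also have "\<dots> = (\<Sum>A\<in>Pow S. \<Sum>C\<in>Pow (S - A). s A C)"
      using True by (intro sum.Sigma[symmetric]) auto
    also have "\<dots> = ext_mult f (ext_mult g h) S"
      using True by (simp add: ext_mult_def s_def sum_distrib_left algebra_simps)
    finally show ?thesis .
  next
    case False
    then show ?thesis by (simp add: ext_mult_def)
  qed
qed

lemma ext_elemsD: "f \<in> ext_elems n \<Longrightarrow> \<not> S \<subseteq> {..<n} \<Longrightarrow> f S = 0"
  by (auto simp: ext_elems_def)

lemma ext_elems_infinite: "f \<in> ext_elems n \<Longrightarrow> infinite S \<Longrightarrow> f S = 0"
  by (rule ext_elemsD) (auto dest: finite_subset)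

lemma ext_one_elems: "ext_one \<in> ext_elems n"
  by (auto simp: ext_one_def ext_elems_def)

lemma ext_elems_linear:
  assumes "f \<in> ext_elems n" "g \<in> ext_elems n"
  shows "(\<lambda>S. c * f S + g S) \<in> ext_elems n"
proof -
  have "c * f S + g S = 0" if "\<not> S \<subseteq> {..<n}" for S
    using ext_elemsD[OF assms(1) that] ext_elemsD[OF assms(2) that] by simp
  then show ?thesis unfolding ext_elems_def by blast
qed

lemma ext_elems_zero: "(\<lambda>S. 0) \<in> ext_elems n"
  by (auto simp: ext_elems_def)

lemma ext_elems_scale: "f \<in> ext_elems n \<Longrightarrow> (\<lambda>S. c * f S) \<in> ext_elems n"
  by (auto simp: ext_elems_def)

lemma ext_elems_sum:
  assumes "\<And>i. i \<in> I \<Longrightarrow> f i \<in> ext_elems n"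
  shows "(\<lambda>S. \<Sum>i\<in>I. f i S) \<in> ext_elems n"
proof -
  have "(\<Sum>i\<in>I. f i S) = 0" if "\<not> S \<subseteq> {..<n}" for S
    using ext_elemsD[OF assms that] by (simp add: sum.neutral)
  then show ?thesis unfolding ext_elems_def by blast
qed

lemma ext_mult_elems:
  assumes "f \<in> ext_elems n" "g \<in> ext_elems n"
  shows "ext_mult f g \<in> ext_elems n"
  unfolding ext_elems_def
proof (intro CollectI allI impI, rule ccontr)
  fix S assume nz: "ext_mult f g S \<noteq> 0" and S: "\<not> S \<subseteq> {..<n}"
  have "f A = 0 \<or> g (S - A) = 0" if "A \<subseteq> S" for A
    using ext_elemsD[OF assms(1), of A] ext_elemsD[OF assms(2), of "S - A"] S that by blast
  then have "ext_mult f g S = 0" by (auto simp: ext_mult_def intro!: sum.neutral)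
  then show False using nz by simp
qed

lemma ext_one_left: "f \<in> ext_elems n \<Longrightarrow> ext_mult ext_one f = f"
proof
  fix S assume f: "f \<in> ext_elems n"
  show "ext_mult ext_one f S = f S"
  proof (cases "finite S")
    case True
    have "(\<Sum>A\<in>Pow S. ext_sign A (S - A) * ext_one A * f (S - A)) = (\<Sum>A\<in>Pow S. if A = {} then f S else 0)"
      by (rule sum.cong) (auto simp: ext_one_def)
    then show ?thesis using True by (simp add: ext_mult_def)
  next
    case False
    then show ?thesis using ext_elems_infinite[OF f] by (simp add: ext_mult_def)
  qed
qed

lemma ext_one_right: "f \<in> ext_elems n \<Longrightarrow> ext_mult f ext_one = f"
proof
  fix S assume f: "f \<in> ext_elems n"
  show "ext_mult f ext_one S = f S"
  proof (cases "finite S")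
    case True
    have "(\<Sum>A\<in>Pow S. ext_sign A (S - A) * f A * ext_one (S - A)) = (\<Sum>A\<in>Pow S. if A = S then f S else 0)"
      by (rule sum.cong) (auto simp: ext_one_def)
    then show ?thesis using True by (simp add: ext_mult_def)
  next
    case False
    then show ?thesis using ext_elems_infinite[OF f] by (simp add: ext_mult_def)
  qed
qed

lemma ext_homogD: "ext_homog n p f \<Longrightarrow> f \<in> ext_elems n" "ext_homog n p f \<Longrightarrow> f S \<noteq> 0 \<Longrightarrow> card S = p"
  by (auto simp: ext_homog_def)

lemma ext_homog_zero: "ext_homog n p (\<lambda>S. 0)"
  by (auto simp: ext_homog_def ext_elems_def)

lemma ext_homogI: "f \<in> ext_elems n \<Longrightarrow> (\<And>S. card S \<noteq> p \<Longrightarrow> f S = 0) \<Longrightarrow> ext_homog n p f"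
  unfolding ext_homog_def by blast

lemma ext_homog_eq_0: "ext_homog n p f \<Longrightarrow> card S \<noteq> p \<Longrightarrow> f S = 0"
  unfolding ext_homog_def by blast

lemma ext_homog_linear: "ext_homog n p f \<Longrightarrow> ext_homog n p g \<Longrightarrow> ext_homog n p (\<lambda>S. c * f S + g S)"
  by (rule ext_homogI) (simp_all add: ext_elems_linear ext_homogD(1) ext_homog_eq_0)

lemma ext_homog_scale: "ext_homog n p f \<Longrightarrow> ext_homog n p (\<lambda>S. c * f S)"
  by (rule ext_homogI) (simp_all add: ext_elems_scale ext_homogD(1) ext_homog_eq_0)

lemma ext_homog_sum:
  assumes "\<And>i. i \<in> I \<Longrightarrow> ext_homog n p (f i)"
  shows "ext_homog n p (\<lambda>S. \<Sum>i\<in>I. f i S)"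
proof (rule ext_homogI)
  show "(\<lambda>S. \<Sum>i\<in>I. f i S) \<in> ext_elems n" by (rule ext_elems_sum) (rule ext_homogD(1)[OF assms])
  show "(\<Sum>i\<in>I. f i S) = 0" if "card S \<noteq> p" for S
    using ext_homog_eq_0[OF assms that] by (simp add: sum.neutral)
qed

lemma ext_homog_mult:
  assumes f: "ext_homog n p f" and g: "ext_homog n q g"
  shows "ext_homog n (p + q) (ext_mult f g)"
  unfolding ext_homog_def
proof (intro conjI allI impI)
  show "ext_mult f g \<in> ext_elems n" using ext_mult_elems f g ext_homogD(1) by blast
  fix S assume nz: "ext_mult f g S \<noteq> 0"
  then have fin: "finite S" by (auto simp: ext_mult_def split: if_splits)
  then obtain A where A: "A \<subseteq> S" "f A \<noteq> 0" "g (S - A) \<noteq> 0"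
    using nz by (auto simp: ext_mult_def elim!: sum.not_neutral_contains_not_neutral)
  have "card S = card A + card (S - A)"
    using A(1) fin by (metis card_Diff_subset card_mono finite_subset le_add_diff_inverse)
  then show "card S = p + q" using ext_homogD(2)[OF f A(2)] ext_homogD(2)[OF g A(3)] by simp
qed

text \<open>Exchanging the blocks A and S - A costs (-1)^(|A| |S - A|), and only sets A with two
  elements contribute.\<close>

lemma ext_even_commute:
  assumes g: "ext_homog n 2 g"
  shows "ext_mult g f = ext_mult f g"
proof
  fix S
  show "ext_mult g f S = ext_mult f g S"
  proof (cases "finite S")
    case True
    have "(\<Sum>A\<in>Pow S. ext_sign A (S - A) * g A * f (S - A)) = (\<Sum>A\<in>Pow S. ext_sign A (S - A) * f A * g (S - A))"
    proof (rule sum.reindex_bij_witness[of _ "\<lambda>A. S - A" "\<lambda>A. S - A"])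
      fix A assume A: "A \<in> Pow S"
      have "ext_sign (S - A) A * g A = ext_sign A (S - A) * g A"
      proof (cases "g A = 0")
        case False
        then have "card A = 2" using ext_homogD(2)[OF g] by simp
        then have "ext_sign A (S - A) * ext_sign (S - A) A = (1::'a)"
          using ext_sign_swap[of A "S - A"] A True by (simp add: finite_subset power_mult)
        then have "ext_sign (S - A) A = (ext_sign A (S - A) :: 'a)"
          using ext_sign_square_left[of A "S - A" "ext_sign (S - A) A :: 'a"] by simp
        then show ?thesis by simp
      qed simp
      moreover have "S - (S - A) = A" using A by auto
      ultimately show "ext_sign (S - A) (S - (S - A)) * f (S - A) * g (S - (S - A)) = ext_sign A (S - A) * g A * f (S - A)"
        by auto
    qed auto
    then show ?thesis using True by (simp add: ext_mult_def)
  next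
    case False
    then show ?thesis by (simp add: ext_mult_def)
  qed
qed

section \<open>Generators, basis elements and algebra maps\<close>

definition gen :: "nat \<Rightarrow> nat set \<Rightarrow> 'k::field" where
  "gen i S = (if S = {i} then 1 else 0)"

definition ext_basis :: "nat set \<Rightarrow> nat set \<Rightarrow> 'k::field" where
  "ext_basis A S = (if S = A then 1 else 0)"

definition ext_linear :: "nat \<Rightarrow> ((nat set \<Rightarrow> 'k::field) \<Rightarrow> (nat set \<Rightarrow> 'k)) \<Rightarrow> bool" where
  "ext_linear n F \<longleftrightarrow> (\<forall>f\<in>ext_elems n. \<forall>g\<in>ext_elems n. \<forall>c. F (\<lambda>S. c * f S + g S) = (\<lambda>S. c * F f S + F g S))"

lemma gen_homog: "i < n \<Longrightarrow> ext_homog n 1 (gen i)"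
  by (auto simp: gen_def ext_homog_def ext_elems_def)

lemma gen_elems: "i < n \<Longrightarrow> gen i \<in> ext_elems n"
  using gen_homog ext_homogD(1) by blast

lemma ext_basis_elems: "A \<subseteq> {..<n} \<Longrightarrow> ext_basis A \<in> ext_elems n"
  by (auto simp: ext_basis_def ext_elems_def)

lemma ext_basis_empty: "ext_basis {} = ext_one"
  by (auto simp: ext_basis_def ext_one_def)

lemma ext_linearD:
  assumes "ext_linear n F"
  shows "f \<in> ext_elems n \<Longrightarrow> g \<in> ext_elems n \<Longrightarrow> F (\<lambda>S. c * f S + g S) = (\<lambda>S. c * F f S + F g S)"
    "F (\<lambda>S. 0) = (\<lambda>S. 0)" "f \<in> ext_elems n \<Longrightarrow> F (\<lambda>S. c * f S) = (\<lambda>S. c * F f S)"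
proof -
  show *: "f \<in> ext_elems n \<Longrightarrow> g \<in> ext_elems n \<Longrightarrow> F (\<lambda>S. c * f S + g S) = (\<lambda>S. c * F f S + F g S)" for f g c
    using assms unfolding ext_linear_def by blast
  show z: "F (\<lambda>S. 0) = (\<lambda>S. 0)"
    using *[of "\<lambda>S. 0" "\<lambda>S. 0" "-1"] ext_elems_zero[of n] by simp
  show "f \<in> ext_elems n \<Longrightarrow> F (\<lambda>S. c * f S) = (\<lambda>S. c * F f S)"
    using *[of f "\<lambda>S. 0" c] ext_elems_zero[of n] z by simp
qed

lemma ext_linear_sum:
  assumes F: "ext_linear n F" and "finite I" "\<And>i. i \<in> I \<Longrightarrow> f i \<in> ext_elems n"
  shows "F (\<lambda>S. \<Sum>i\<in>I. c i * f i S) = (\<lambda>S. \<Sum>i\<in>I. c i * F (f i) S)"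
  using assms(2,3)
proof (induction I rule: finite_induct)
  case empty
  show ?case using ext_linearD(2)[OF F] by simp
next
  case (insert i I)
  have "(\<lambda>S. \<Sum>i\<in>I. c i * f i S) \<in> ext_elems n"
    by (rule ext_elems_sum) (use insert in \<open>auto intro: ext_elems_scale\<close>)
  then show ?case
    using insert ext_linearD(1)[OF F, of "f i" "\<lambda>S. \<Sum>i\<in>I. c i * f i S" "c i"] by simp
qed

lemma ext_expand: "f \<in> ext_elems n \<Longrightarrow> f = (\<lambda>T. \<Sum>S\<in>Pow {..<n}. f S * ext_basis S T)"
proof
  fix T assume f: "f \<in> ext_elems n"
  have "(\<Sum>S\<in>Pow {..<n}. f S * ext_basis S T) = (\<Sum>S\<in>Pow {..<n}. if S = T then f T else 0)"
    by (rule sum.cong) (auto simp: ext_basis_def)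
  then show "f T = (\<Sum>S\<in>Pow {..<n}. f S * ext_basis S T)" using ext_elemsD[OF f, of T] by simp
qed

lemma ext_linear_eqI:
  assumes F: "ext_linear n F" and G: "ext_linear n G"
    and eq: "\<And>S. S \<subseteq> {..<n} \<Longrightarrow> F (ext_basis S) = G (ext_basis S)" and f: "f \<in> ext_elems n"
  shows "F f = G f"
proof -
  have "H f = (\<lambda>T. \<Sum>S\<in>Pow {..<n}. f S * H (ext_basis S) T)" if "ext_linear n H" for H
    using ext_linear_sum[OF that, of "Pow {..<n}" ext_basis f] ext_expand[OF f] ext_basis_elems
    by (metis (no_types, lifting) PowD finite_Pow_iff finite_lessThan)
  moreover have "(\<Sum>S\<in>Pow {..<n}. f S * F (ext_basis S) T) = (\<Sum>S\<in>Pow {..<n}. f S * G (ext_basis S) T)" for T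
    by (rule sum.cong) (auto simp: eq)
  ultimately show ?thesis using F G by simp
qed

lemma ext_mult_gen_left:
  assumes y: "ext_homog n 1 y" and S: "finite S"
  shows "ext_mult y f S = (\<Sum>a\<in>S. ext_sign {a} (S - {a}) * y {a} * f (S - {a}))"
proof -
  have "ext_mult y f S = (\<Sum>A\<in>Pow S. ext_sign A (S - A) * y A * f (S - A))" using S by (simp add: ext_mult_def)
  also have "\<dots> = (\<Sum>A\<in>(\<lambda>a. {a}) ` S. ext_sign A (S - A) * y A * f (S - A))"
  proof (rule sum.mono_neutral_right)
    show "\<forall>A\<in>Pow S - (\<lambda>a. {a}) ` S. ext_sign A (S - A) * y A * f (S - A) = 0"
    proof
      fix A assume A: "A \<in> Pow S - (\<lambda>a. {a}) ` S"
      have "card A \<noteq> 1" using A by (auto simp: card_1_singleton_iff)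
      then show "ext_sign A (S - A) * y A * f (S - A) = 0" using ext_homog_eq_0[OF y] by simp
    qed
  qed (use S in auto)
  also have "\<dots> = (\<Sum>a\<in>S. ext_sign {a} (S - {a}) * y {a} * f (S - {a}))"
    by (subst sum.reindex) (auto simp: inj_on_def)
  finally show ?thesis .
qed

lemma gen_ext_basis:
  assumes "finite A" "\<And>a. a \<in> A \<Longrightarrow> b < a"
  shows "ext_mult (gen b) (ext_basis A) = (ext_basis (insert b A) :: nat set \<Rightarrow> 'k::field)"
proof
  fix S
  have bA: "b \<notin> A" using assms(2) by blast
  show "ext_mult (gen b) (ext_basis A) S = (ext_basis (insert b A) S :: 'k)"
  proof (cases "finite S")
    case True
    have "ext_mult (gen b) (ext_basis A) S = ((\<Sum>a\<in>S. ext_sign {a} (S - {a}) * gen b {a} * ext_basis A (S - {a})) :: 'k)"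
      by (rule ext_mult_gen_left[OF gen_homog[of b "Suc b"]]) (use True in simp_all)
    also have "\<dots> = (\<Sum>a\<in>S. if a = b then ext_basis (insert b A) S else 0)"
    proof (rule sum.cong)
      fix a assume a: "a \<in> S"
      show "ext_sign {a} (S - {a}) * gen b {a} * ext_basis A (S - {a}) = (if a = b then ext_basis (insert b A) S else (0::'k))"
      proof (cases "a = b \<and> S - {b} = A")
        case True
        then have "S = insert b A" using a by auto
        moreover have "ext_sign {b} A = (1::'k)" using assms(2) by (intro ext_sign_less) auto
        ultimately show ?thesis using True bA by (simp add: gen_def ext_basis_def)
      next
        case False
        then show ?thesis using bA by (auto simp: gen_def ext_basis_def)
      qed
    qed simp
    also have "\<dots> = ext_basis (insert b A) S" using True by (auto simp: ext_basis_def)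
    finally show ?thesis .
  next
    case False
    then show ?thesis using assms(1) by (auto simp: ext_mult_def ext_basis_def)
  qed
qed

text \<open>Every basis element is an iterated product of generators, so an identity that is compatible with
  multiplication by a generator only has to be checked on \<open>1\<close>.\<close>
lemma ext_basis_induct [consumes 1, case_names one mult]:
  fixes P :: "(nat set \<Rightarrow> 'k::field) \<Rightarrow> bool"
  assumes "S \<subseteq> {..<n}" and one: "P ext_one"
    and mult: "\<And>b f. b < n \<Longrightarrow> f \<in> ext_elems n \<Longrightarrow> P f \<Longrightarrow> P (ext_mult (gen b) f)"
  shows "P (ext_basis S)"
proof -
  have "finite S" using assms(1) finite_subset by blast
  then show ?thesis using assms(1)
  proof (induction S rule: finite_linorder_min_induct)
    case empty
    then show ?case using one by (simp add: ext_basis_empty)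
  next
    case (insert b A)
    then have "P (ext_mult (gen b) (ext_basis A))" by (intro mult ext_basis_elems) auto
    moreover have "ext_mult (gen b) (ext_basis A) = (ext_basis (insert b A) :: nat set \<Rightarrow> 'k)"
      using insert by (intro gen_ext_basis) auto
    ultimately show ?case by simp
  qed
qed

definition ord_prod :: "(nat \<Rightarrow> nat set \<Rightarrow> 'k::field) \<Rightarrow> nat set \<Rightarrow> nat set \<Rightarrow> 'k" where
  "ord_prod y S = foldr (\<lambda>i. ext_mult (y i)) (sorted_list_of_set S) ext_one"

lemma ord_prod_empty: "ord_prod y {} = ext_one"
  by (simp add: ord_prod_def)

lemma ord_prod_insert:
  assumes "finite A" "\<And>a. a \<in> A \<Longrightarrow> b < a"
  shows "ord_prod y (insert b A) = ext_mult (y b) (ord_prod y A)"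
proof -
  have "Min (insert b A) = b" using assms by (intro Min_eqI) (auto intro: less_imp_le)
  moreover have "b \<notin> A" using assms by blast
  ultimately have "sorted_list_of_set (insert b A) = b # sorted_list_of_set A"
    using sorted_list_of_set_nonempty[of "insert b A"] assms(1) by simp
  then show ?thesis by (simp add: ord_prod_def)
qed

text \<open>The universal property of the exterior algebra: elements of degree one square to zero
  and anticommute, so any assignment of x_i to y_i extends to an algebra map, called
  \<open>hom\<close>, with e_S sent to the ordered product over S.\<close>

locale anticommuting =
  fixes n :: nat and y :: "nat \<Rightarrow> nat set \<Rightarrow> 'k::field"
  assumes homog: "i < n \<Longrightarrow> ext_homog n 1 (y i)"
begin

lemma square: "i < n \<Longrightarrow> ext_mult (y i) (y i) = (\<lambda>S. 0)"
proof
  fix S assume i: "i < n"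
  show "ext_mult (y i) (y i) S = 0"
  proof (cases "card S = 2")
    case True
    then obtain a b where ab: "S = {a, b}" "a < b" by (metis card_2_iff linorder_neq_iff insert_commute)
    have "ext_mult (y i) (y i) S = (\<Sum>x\<in>S. ext_sign {x} (S - {x}) * y i {x} * y i (S - {x}))"
      by (rule ext_mult_gen_left[OF homog[OF i]]) (simp add: ab)
    also have "\<dots> = 0"
    proof -
      have "ext_sign {a} {b} = (1::'k)" "ext_sign {b} {a} = (-1::'k)"
        using ab(2) by (auto intro: ext_sign_less ext_sign_greater_singleton)
      then show ?thesis using ab by (simp add: insert_Diff_if)
    qed
    finally show ?thesis .
  next
    case False
    then show ?thesis using ext_homog_eq_0[OF ext_homog_mult[OF homog[OF i] homog[OF i]]] by simp
  qed
qed

lemma anticommute: "i < n \<Longrightarrow> j < n \<Longrightarrow> ext_mult (y i) (y j) = (\<lambda>S. - ext_mult (y j) (y i) S)"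
proof
  fix S assume ij: "i < n" "j < n"
  \<comment> \<open>Polarization: the constant family y_i + y_j satisfies the same assumption, so
    its square is zero as well.\<close>
  interpret s: anticommuting n "\<lambda>_ S. 1 * y i S + y j S"
    by unfold_locales (rule ext_homog_linear[OF homog[OF ij(1)] homog[OF ij(2)]])
  have "ext_mult (\<lambda>S. 1 * y i S + y j S) (\<lambda>S. 1 * y i S + y j S) S = 0" using s.square[OF ij(1)] by metis
  then have "ext_mult (y i) (y j) S + ext_mult (y j) (y i) S = 0"
    unfolding ext_mult_linear_left ext_mult_linear_right by (simp add: square ij add.commute)
  then show "ext_mult (y i) (y j) S = - ext_mult (y j) (y i) S" by (simp add: eq_neg_iff_add_eq_0)
qed

lemma ord_prod_homog:
  assumes "S \<subseteq> {..<n}"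
  shows "ext_homog n (card S) (ord_prod y S)"
proof -
  have "finite S" using assms finite_subset by blast
  then show ?thesis using assms
  proof (induction S rule: finite_linorder_min_induct)
    case empty
    show ?case by (auto simp: ord_prod_empty ext_one_def ext_homog_def ext_elems_def)
  next
    case (insert b A)
    have "ext_homog n (1 + card A) (ext_mult (y b) (ord_prod y A))"
      using insert by (intro ext_homog_mult homog) auto
    moreover have "b \<notin> A" using insert by auto
    ultimately show ?case using insert by (simp add: ord_prod_insert)
  qed
qed

text \<open>Induction that strips off the least element b of S. For i below b the product is already
  ordered, for i = b a square appears, and otherwise y_i moves past y_b at the cost of the sign of
  one inversion.\<close>

lemma mult_ord_prod:
  assumes "i < n" "S \<subseteq> {..<n}"
  shows "ext_mult (y i) (ord_prod y S) = (\<lambda>T. if i \<in> S then 0 else ext_sign {i} S * ord_prod y (insert i S) T)"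
proof -
  have "finite S" using assms(2) finite_subset by blast
  then show ?thesis using assms(2)
  proof (induction S rule: finite_linorder_min_induct)
    case empty
    show ?case using ord_prod_insert[of "{}" i y] by simp
  next
    case (insert b A)
    then have b: "b < n" and A: "A \<subseteq> {..<n}" "b \<notin> A" by auto
    have P: "ord_prod y (insert b A) = ext_mult (y b) (ord_prod y A)" using insert by (intro ord_prod_insert) auto
    consider "i < b" | "i = b" | "b < i" by linarith
    then show ?case
    proof cases
      case 1
      then have lt: "i < a" if "a \<in> insert b A" for a using that insert by auto
      then have "ext_sign {i} (insert b A) = (1::'k)" by (intro ext_sign_less) auto
      moreover have "i \<notin> insert b A" using lt by blast
      moreover have "ord_prod y (insert i (insert b A)) = ext_mult (y i) (ord_prod y (insert b A))"
        using lt insert by (intro ord_prod_insert) auto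
      ultimately show ?thesis by simp
    next
      case 2
      have "ext_mult (y i) (ord_prod y (insert b A)) = ext_mult (ext_mult (y i) (y i)) (ord_prod y A)"
        by (simp add: P 2 ext_mult_assoc)
      then show ?thesis using 2 square[OF assms(1)] by simp
    next
      case 3
      have "ext_mult (y i) (ord_prod y (insert b A)) = ext_mult (ext_mult (y i) (y b)) (ord_prod y A)"
        by (simp add: P ext_mult_assoc)
      also have "\<dots> = ext_mult (\<lambda>S. (-1) * ext_mult (y b) (y i) S) (ord_prod y A)"
        using anticommute[OF assms(1) b] by simp
      also have "\<dots> = (\<lambda>T. (-1) * ext_mult (y b) (ext_mult (y i) (ord_prod y A)) T)"
        unfolding ext_mult_scale ext_mult_assoc ..
      also have "\<dots> = (\<lambda>T. if i \<in> insert b A then 0 else ext_sign {i} (insert b A) * ord_prod y (insert i (insert b A)) T)"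
      proof (cases "i \<in> A")
        case True
        then show ?thesis using insert.IH A by simp
      next
        case False
        have "ord_prod y (insert b (insert i A)) = ext_mult (y b) (ord_prod y (insert i A))"
          using insert 3 by (intro ord_prod_insert) auto
        moreover have "(ext_sign {i} ({b} \<union> A) :: 'k) = ext_sign {i} {b} * ext_sign {i} A"
          using insert A by (intro ext_sign_union_right) auto
        moreover have "ext_sign {i} {b} = (-1::'k)" using 3 by (rule ext_sign_greater_singleton)
        ultimately show ?thesis
          using insert.IH A False 3 by (simp add: ext_mult_scale insert_commute)
      qed
      finally show ?thesis .
    qed
  qed
qed

lemma ord_prod_mult:
  assumes "A \<subseteq> {..<n}" "B \<subseteq> {..<n}"
  shows "ext_mult (ord_prod y A) (ord_prod y B)
    = (\<lambda>T. if A \<inter> B = {} then ext_sign A B * ord_prod y (A \<union> B) T else 0)"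
proof -
  have "finite A" using assms(1) finite_subset by blast
  then show ?thesis using assms(1)
  proof (induction A rule: finite_linorder_min_induct)
    case empty
    show ?case using ext_one_left[OF ext_homogD(1)[OF ord_prod_homog[OF assms(2)]]] by (simp add: ord_prod_empty)
  next
    case (insert b A)
    then have b: "b < n" and A: "A \<subseteq> {..<n}" "b \<notin> A" "finite A" by auto
    have fB: "finite B" using assms(2) finite_subset by blast
    have P: "ord_prod y (insert b A) = ext_mult (y b) (ord_prod y A)" using insert by (intro ord_prod_insert) auto
    have eq: "ext_mult (ord_prod y (insert b A)) (ord_prod y B)
      = ext_mult (y b) (\<lambda>T. if A \<inter> B = {} then ext_sign A B * ord_prod y (A \<union> B) T else 0)"
      using insert.IH A by (simp add: P ext_mult_assoc)
    show ?case
    proof (cases "A \<inter> B = {}")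
      case False
      then show ?thesis unfolding eq by auto
    next
      case True
      have "(ext_sign {b} (A \<union> B) :: 'k) = ext_sign {b} A * ext_sign {b} B"
        using True A fB by (intro ext_sign_union_right) auto
      moreover have "ext_sign {b} A = (1::'k)" using insert by (intro ext_sign_less) auto
      moreover have "(ext_sign ({b} \<union> A) B :: 'k) = ext_sign {b} B * ext_sign A B"
        using A fB by (intro ext_sign_union_left) auto
      ultimately show ?thesis
        unfolding eq using True A mult_ord_prod[OF b, of "A \<union> B"] assms(2)
        by (auto simp: ext_mult_scale fun_eq_iff)
    qed
  qed
qed

definition hom :: "(nat set \<Rightarrow> 'k) \<Rightarrow> nat set \<Rightarrow> 'k" where
  "hom f = (\<lambda>T. \<Sum>S\<in>Pow {..<n}. f S * ord_prod y S T)"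

lemma hom_linear: "ext_linear n hom"
  by (auto simp: ext_linear_def hom_def sum.distrib sum_distrib_left algebra_simps)

lemma hom_elems: "hom f \<in> ext_elems n"
  unfolding hom_def by (intro ext_elems_sum ext_elems_scale) (use ord_prod_homog ext_homogD(1) in blast)

lemma hom_homog: "ext_homog n p f \<Longrightarrow> ext_homog n p (hom f)"
  unfolding hom_def
proof (rule ext_homog_sum)
  fix S assume f: "ext_homog n p f" and S: "S \<in> Pow {..<n}"
  show "ext_homog n p (\<lambda>T. f S * ord_prod y S T)"
  proof (cases "card S = p")
    case True
    then show ?thesis using ext_homog_scale ord_prod_homog S by blast
  next
    case False
    then show ?thesis using ext_homog_eq_0[OF f False] by (simp add: ext_homog_zero)
  qed
qed

lemma hom_one: "hom ext_one = ext_one"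
proof
  fix T
  have "(\<Sum>S\<in>Pow {..<n}. ext_one S * ord_prod y S T) = (\<Sum>S\<in>Pow {..<n}. if S = {} then ext_one T else 0)"
    by (rule sum.cong) (auto simp: ext_one_def ord_prod_empty)
  then show "hom ext_one T = ext_one T" by (simp add: hom_def)
qed

lemma hom_gen: "i < n \<Longrightarrow> hom (gen i) = y i"
proof
  fix T assume i: "i < n"
  have "ord_prod y {i} = y i"
    using ord_prod_insert[of "{}" i y] ext_one_right[OF ext_homogD(1)[OF homog[OF i]]] by (simp add: ord_prod_empty)
  then have "(\<Sum>S\<in>Pow {..<n}. gen i S * ord_prod y S T) = (\<Sum>S\<in>Pow {..<n}. if S = {i} then y i T else 0)"
    by (intro sum.cong) (auto simp: gen_def)
  then show "hom (gen i) T = y i T" using i by (simp add: hom_def)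
qed

text \<open>Disjoint pairs (A, B) correspond to pairs (S, A) with A contained in S, where S is the
  union; overlapping pairs contribute 0.\<close>

lemma hom_mult:
  "f \<in> ext_elems n \<Longrightarrow> g \<in> ext_elems n \<Longrightarrow> hom (ext_mult f g) = ext_mult (hom f) (hom g)"
proof
  fix T assume fg: "f \<in> ext_elems n" "g \<in> ext_elems n"
  let ?P = "Pow {..<n}"
  have fin: "finite S" if "S \<in> ?P" for S using that finite_subset by blast
  have diff: "A \<inter> B = {} \<Longrightarrow> A \<union> B - A = B" for A B :: "nat set" by auto
  have "ext_mult (hom f) (hom g) = (\<lambda>T. \<Sum>A\<in>?P. f A * (\<Sum>B\<in>?P. g B * ext_mult (ord_prod y A) (ord_prod y B) T))"
    unfolding hom_def ext_mult_sum ext_mult_scale by (simp add: sum_distrib_left)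
  then have "ext_mult (hom f) (hom g) T = (\<Sum>A\<in>?P. \<Sum>B\<in>?P. f A * (g B * ext_mult (ord_prod y A) (ord_prod y B) T))"
    by (simp add: sum_distrib_left)
  also have "\<dots> = (\<Sum>A\<in>?P. \<Sum>B\<in>?P. if A \<inter> B = {} then f A * (g B * (ext_sign A B * ord_prod y (A \<union> B) T)) else 0)"
    by (intro sum.cong refl) (auto simp: ord_prod_mult)
  also have "\<dots> = (\<Sum>(A, B)\<in>?P \<times> ?P. if A \<inter> B = {} then f A * (g B * (ext_sign A B * ord_prod y (A \<union> B) T)) else 0)"
    by (rule sum.cartesian_product)
  also have "\<dots> = (\<Sum>(A, B)\<in>{(A, B)\<in>?P \<times> ?P. A \<inter> B = {}}. f A * (g B * (ext_sign A B * ord_prod y (A \<union> B) T)))"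
    by (rule sum.mono_neutral_cong_right) (auto split: if_splits)
  also have "\<dots> = (\<Sum>(S, A)\<in>Sigma ?P Pow. ext_sign A (S - A) * f A * g (S - A) * ord_prod y S T)"
    by (rule sum.reindex_bij_witness[of _ "\<lambda>(S, A). (A, S - A)" "\<lambda>(A, B). (A \<union> B, A)"])
       (auto simp: diff Un_absorb1 ac_simps)
  also have "\<dots> = (\<Sum>S\<in>?P. \<Sum>A\<in>Pow S. ext_sign A (S - A) * f A * g (S - A) * ord_prod y S T)"
    by (rule sum.Sigma[symmetric]) (auto intro: finite_subset)
  also have "\<dots> = hom (ext_mult f g) T"
    unfolding hom_def by (intro sum.cong refl) (simp add: ext_mult_def fin sum_distrib_right finite_subset)
  finally show "hom (ext_mult f g) T = ext_mult (hom f) (hom g) T" by simp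
qed

end

text \<open>Interior product with the i-th dual basis vector. Multiplying it by a 2-form g_i and
  summing over i gives the derivation that sends each x_i to g_i.\<close>

definition contr :: "nat \<Rightarrow> (nat set \<Rightarrow> 'k::field) \<Rightarrow> nat set \<Rightarrow> 'k" where
  "contr i f S = (if finite S \<and> i \<notin> S then ext_sign {i} S * f (insert i S) else 0)"

lemma contr_linear: "contr i (\<lambda>S. c * f S + g S) = (\<lambda>S. c * contr i f S + contr i g S)"
  by (auto simp: contr_def fun_eq_iff algebra_simps)

lemma contr_elems: "f \<in> ext_elems n \<Longrightarrow> contr i f \<in> ext_elems n"
  by (auto simp: contr_def ext_elems_def)

lemma contr_homog: "ext_homog n (Suc p) f \<Longrightarrow> ext_homog n p (contr i f)"
  by (rule ext_homogI) (auto intro: contr_elems ext_homogD(1) simp: contr_def ext_homog_eq_0)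

lemma contr_homog_0: "ext_homog n 0 f \<Longrightarrow> contr i f = (\<lambda>S. 0)"
  by (auto simp: contr_def fun_eq_iff ext_homog_eq_0 card_gt_0_iff)

lemma contr_gen: "contr i (gen j) = (if i = j then ext_one else (\<lambda>S. 0))"
  by (auto simp: contr_def gen_def ext_one_def fun_eq_iff)

lemma sum_Pow_insert:
  assumes "finite S" "i \<notin> S"
  shows "(\<Sum>A\<in>Pow (insert i S). f A) = (\<Sum>A\<in>Pow S. f A) + (\<Sum>A\<in>Pow S. f (insert i A))"
proof -
  have "(\<Sum>A\<in>Pow (insert i S). f A) = (\<Sum>A\<in>Pow S. f A) + (\<Sum>A\<in>insert i ` Pow S. f A)"
    unfolding Pow_insert using assms by (intro sum.union_disjoint) auto
  also have "(\<Sum>A\<in>insert i ` Pow S. f A) = (\<Sum>A\<in>Pow S. f (insert i A))"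
    by (subst sum.reindex) (use assms(2) in \<open>auto intro!: inj_onI\<close>)
  finally show ?thesis .
qed

text \<open>At S without i, the blocks of the enlarged set are split by which of them contains i,
  and this gives the two terms. At S containing i the left side is 0, and on the right the summands
  for A and for A with i added cancel.\<close>

lemma contr_mult:
  fixes a b :: "nat set \<Rightarrow> 'k::field"
  assumes a: "ext_homog n p a"
  shows "contr i (ext_mult a b) = (\<lambda>S. ext_mult (contr i a) b S + (-1) ^ p * ext_mult a (contr i b) S)"
proof
  fix S :: "nat set"
  consider "infinite S" | "finite S" "i \<notin> S" | "finite S" "i \<in> S" by blast
  then show "contr i (ext_mult a b) S = ext_mult (contr i a) b S + (-1) ^ p * ext_mult a (contr i b) S"
  proof cases
    case 1
    then show ?thesis by (simp add: contr_def ext_mult_def)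
  next
    case 2
    have fin: "finite A" "finite (S - A)" if "A \<in> Pow S" for A using that 2 finite_subset by auto
    have si: "(ext_sign {i} S :: 'k) = ext_sign {i} A * ext_sign {i} (S - A)" if "A \<in> Pow S" for A
    proof -
      have "S = A \<union> (S - A)" using that by auto
      then show ?thesis using ext_sign_union_right[of "{i}" A "S - A"] fin[OF that] by (metis Diff_disjoint finite.emptyI finite.insertI)
    qed
    have 1: "ext_sign {i} S * (ext_sign (insert i A) (insert i S - insert i A) * a (insert i A) * b (insert i S - insert i A))
      = ext_sign A (S - A) * contr i a A * b (S - A)" if A: "A \<in> Pow S" for A
    proof -
      have "i \<notin> A" using A 2 by auto
      then have "(ext_sign (insert i A) (S - A) :: 'k) = ext_sign {i} (S - A) * ext_sign A (S - A)"
        using ext_sign_union_left[of "{i}" A "S - A"] fin[OF A] by simp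
      moreover have "insert i S - insert i A = S - A" using 2 by auto
      ultimately show ?thesis using si[OF A] \<open>i \<notin> A\<close> fin[OF A]
        by (simp add: contr_def mult_ac ext_sign_square)
    qed
    have 2: "ext_sign {i} S * (ext_sign A (insert i S - A) * a A * b (insert i S - A))
      = (-1) ^ p * (ext_sign A (S - A) * a A * contr i b (S - A))" if A: "A \<in> Pow S" for A
    proof (cases "a A = 0")
      case False
      then have p: "card A = p" using ext_homogD(2)[OF a] by simp
      have iA: "i \<notin> A" "insert i S - A = insert i (S - A)" using A 2 by auto
      have un: "(ext_sign A (insert i (S - A)) :: 'k) = ext_sign A {i} * ext_sign A (S - A)"
        using ext_sign_union_right[of A "{i}" "S - A"] fin[OF A] 2 by simp
      have sw: "(ext_sign {i} A * ext_sign A {i} :: 'k) = (-1) ^ p"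
        using ext_sign_swap[of "{i}" A] fin[OF A] iA p by simp
      have "(ext_sign {i} S * ext_sign A (insert i (S - A)) :: 'k)
        = (ext_sign {i} A * ext_sign A {i}) * (ext_sign A (S - A) * ext_sign {i} (S - A))"
        unfolding si[OF A] un by (simp only: ac_simps)
      then have "(ext_sign {i} S * ext_sign A (insert i (S - A)) :: 'k)
        = (-1) ^ p * (ext_sign A (S - A) * ext_sign {i} (S - A))" unfolding sw .
      then show ?thesis using 2 fin[OF A] unfolding iA(2) contr_def by (simp add: mult.assoc[symmetric])
    qed simp
    have "contr i (ext_mult a b) S = (\<Sum>A\<in>Pow (insert i S).
        ext_sign {i} S * (ext_sign A (insert i S - A) * a A * b (insert i S - A)))"
      using \<open>finite S\<close> \<open>i \<notin> S\<close> by (simp add: contr_def ext_mult_def sum_distrib_left)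
    also have "\<dots> = (\<Sum>A\<in>Pow S. (-1) ^ p * (ext_sign A (S - A) * a A * contr i b (S - A)))
        + (\<Sum>A\<in>Pow S. ext_sign A (S - A) * contr i a A * b (S - A))"
      unfolding sum_Pow_insert[OF \<open>finite S\<close> \<open>i \<notin> S\<close>]
      by (intro arg_cong2[where f = "(+)"] sum.cong refl) (simp_all only: 1 2)
    finally show ?thesis using \<open>finite S\<close> by (simp add: ext_mult_def sum_distrib_left)
  next
    case 3
    define R where "R = S - {i}"
    have R: "S = insert i R" "finite R" "i \<notin> R" using 3 by (auto simp: R_def)
    have fin: "finite A" "finite (R - A)" if "A \<in> Pow R" for A using that R finite_subset by auto
    have 1: "ext_sign A (S - A) * contr i a A * b (S - A) + (-1) ^ p * (ext_sign (insert i A) (S - insert i A) *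
        a (insert i A) * contr i b (S - insert i A)) = 0" if A: "A \<in> Pow R" for A
    proof (cases "a (insert i A) = 0")
      case True
      then show ?thesis by (simp add: contr_def)
    next
      case False
      have iA: "i \<notin> A" "S - A = insert i (R - A)" "S - insert i A = R - A" using A R by auto
      have p: "p = Suc (card A)" using ext_homogD(2)[OF a False] iA(1) fin[OF A] by simp
      have un: "(ext_sign A (insert i (R - A)) :: 'k) = ext_sign A {i} * ext_sign A (R - A)"
        "(ext_sign (insert i A) (R - A) :: 'k) = ext_sign {i} (R - A) * ext_sign A (R - A)"
        using ext_sign_union_right[of A "{i}" "R - A"] ext_sign_union_left[of "{i}" A "R - A"] fin[OF A] R iA by simp_all
      have sw: "(ext_sign A {i} * ext_sign {i} A :: 'k) = (-1) ^ card A"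
        using ext_sign_swap[of A "{i}"] fin[OF A] iA by simp
      have c: "contr i a A = ext_sign {i} A * a (insert i A)"
        "contr i b (R - A) = ext_sign {i} (R - A) * b (insert i (R - A))"
        using fin[OF A] iA R by (simp_all add: contr_def)
      have e1: "ext_sign A (S - A) * contr i a A * b (S - A)
        = (ext_sign A {i} * ext_sign {i} A) * (ext_sign A (R - A) * a (insert i A) * b (insert i (R - A)))"
        unfolding iA(2) un c by (simp only: ac_simps)
      have e2: "ext_sign (insert i A) (S - insert i A) * a (insert i A) * contr i b (S - insert i A)
        = (ext_sign {i} (R - A) * ext_sign {i} (R - A)) * (ext_sign A (R - A) * a (insert i A) * b (insert i (R - A)))"
        unfolding iA(3) un c by (simp only: ac_simps)
      show ?thesis unfolding e1 e2 sw ext_sign_square p by simp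
    qed
    have zero: "ext_sign (insert i A) (S - insert i A) * contr i a (insert i A) * b (S - insert i A) = 0"
      "ext_sign A (S - A) * a A * contr i b (S - A) = 0" if "A \<in> Pow R" for A
      using that R by (auto simp: contr_def)
    have "ext_mult (contr i a) b S + (-1) ^ p * ext_mult a (contr i b) S
      = (\<Sum>A\<in>Pow R. ext_sign A (S - A) * contr i a A * b (S - A) + (-1) ^ p * (ext_sign (insert i A) (S - insert i A) *
        a (insert i A) * contr i b (S - insert i A)))"
    proof -
      have zsum: "(\<Sum>A\<in>Pow R. ext_sign (insert i A) (S - insert i A) * contr i a (insert i A) * b (S - insert i A)) = 0"
        "(\<Sum>A\<in>Pow R. ext_sign A (S - A) * a A * contr i b (S - A)) = 0"
        by (rule sum.neutral, use zero in blast)+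
      have "ext_mult (contr i a) b S = (\<Sum>A\<in>Pow R. ext_sign A (S - A) * contr i a A * b (S - A))"
        using 3(1) by (simp only: ext_mult_def sum_Pow_insert[OF R(2,3), folded R(1)] zsum) (simp add: R(1)[symmetric])
      moreover have "ext_mult a (contr i b) S = (\<Sum>A\<in>Pow R. ext_sign (insert i A) (S - insert i A) *
          a (insert i A) * contr i b (S - insert i A))"
        using 3(1) by (simp only: ext_mult_def sum_Pow_insert[OF R(2,3), folded R(1)] zsum) (simp add: R(1)[symmetric])
      ultimately show ?thesis by (simp add: sum.distrib sum_distrib_left)
    qed
    also have "\<dots> = 0" by (rule sum.neutral) (use 1 in blast)
    finally show ?thesis using 3 by (simp add: contr_def)
  qed
qed

section \<open>Minimal algebras and nilpotent brackets\<close>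

lemma homog1_expand:
  assumes "ext_homog n 1 y"
  shows "y = (\<lambda>S. \<Sum>j<n. y {j} * gen j S)"
proof
  fix S
  show "y S = (\<Sum>j<n. y {j} * gen j S)"
  proof (cases "\<exists>j<n. S = {j}")
    case True
    then obtain k where k: "k < n" "S = {k}" by blast
    then have "(\<Sum>j<n. y {j} * gen j S) = (\<Sum>j<n. if j = k then y {k} else 0)"
      by (intro sum.cong) (auto simp: gen_def)
    then show ?thesis using k by simp
  next
    case False
    then have "(\<Sum>j<n. y {j} * gen j S) = 0" by (intro sum.neutral) (auto simp: gen_def)
    moreover have "y S = 0"
    proof (rule ccontr)
      assume "y S \<noteq> 0"
      then have "card S = 1" "S \<subseteq> {..<n}" using assms by (auto simp: ext_homog_def ext_elems_def)
      then show False using False by (auto simp: card_1_singleton_iff)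
    qed
    ultimately show ?thesis by simp
  qed
qed

lemma mult_homog1_pair:
  assumes "ext_homog n 1 y" "a < b"
  shows "ext_mult y z {a, b} = y {a} * z {b} - y {b} * (z {a} :: 'k::field)"
proof -
  have "ext_sign {a} {b} = (1::'k)" "ext_sign {b} {a} = (-1::'k)"
    using assms(2) by (auto intro: ext_sign_less ext_sign_greater_singleton)
  then show ?thesis using assms(2) by (simp add: ext_mult_gen_left[OF assms(1)] insert_Diff_if)
qed

lemma mult_homog1_triple:
  assumes "ext_homog n 1 y" "a < b" "b < c"
  shows "ext_mult y f {a, b, c} = y {a} * f {b, c} - y {b} * f {a, c} + y {c} * (f {a, b} :: 'k::field)"
proof -
  have s: "ext_sign {a} {b, c} = (1::'k)" using assms by (intro ext_sign_less) auto
  have "(ext_sign {b} ({a} \<union> {c}) :: 'k) = ext_sign {b} {a} * ext_sign {b} {c}"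
    using assms by (intro ext_sign_union_right) auto
  moreover have "ext_sign {b} {a} = (-1::'k)" "ext_sign {b} {c} = (1::'k)"
    using assms by (auto intro: ext_sign_less ext_sign_greater_singleton)
  ultimately have s': "ext_sign {b} {a, c} = (-1::'k)" by (simp add: insert_commute)
  have "(ext_sign {c} ({a} \<union> {b}) :: 'k) = ext_sign {c} {a} * ext_sign {c} {b}"
    using assms by (intro ext_sign_union_right) auto
  moreover have "ext_sign {c} {a} = (-1::'k)" "ext_sign {c} {b} = (-1::'k)"
    using assms by (auto intro: ext_sign_greater_singleton)
  ultimately have s'': "ext_sign {c} {a, b} = (1::'k)" by (simp add: insert_commute)
  show ?thesis using assms(2,3) s s' s'' by (simp add: ext_mult_gen_left[OF assms(1)] insert_Diff_if)
qed

lemma homog2_eqI: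
  assumes f: "ext_homog n 2 f" and g: "ext_homog n 2 g"
    and eq: "\<And>a b. a < b \<Longrightarrow> b < n \<Longrightarrow> f {a, b} = g {a, b}"
  shows "f = g"
proof
  fix S
  show "f S = g S"
  proof (cases "card S = 2 \<and> S \<subseteq> {..<n}")
    case True
    then obtain x y where "S = {x, y}" "x \<noteq> y" by (auto simp: card_2_iff)
    then obtain a b where "S = {a, b}" "a < b" by (metis insert_commute linorder_neq_iff)
    then show ?thesis using eq True by auto
  next
    case False
    then show ?thesis
      using ext_homog_eq_0[OF f] ext_homog_eq_0[OF g] ext_elemsD[OF ext_homogD(1)[OF f]] ext_elemsD[OF ext_homogD(1)[OF g]]
      by metis
  qed
qed

lemma homog3_eq_0I:
  assumes f: "ext_homog n 3 f"
    and eq: "\<And>a b c. a < b \<Longrightarrow> b < c \<Longrightarrow> c < n \<Longrightarrow> f {a, b, c} = 0"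
  shows "f = (\<lambda>S. 0)"
proof
  fix S
  show "f S = 0"
  proof (cases "card S = 3 \<and> S \<subseteq> {..<n}")
    case True
    define s where "s = sorted_list_of_set S"
    have fin: "finite S" using True finite_subset by blast
    have s: "set s = S" "sorted_wrt (<) s" "length s = 3"
      using fin True by (simp_all add: s_def strict_sorted_list_of_set)
    obtain a b c where abc: "s = [a, b, c]" using s(3) by (auto simp: numeral_3_eq_3 length_Suc_conv)
    then have "S = {a, b, c}" "a < b" "b < c" using s by auto
    then show ?thesis using eq True by auto
  next
    case False
    then show ?thesis using ext_homog_eq_0[OF f] ext_elemsD[OF ext_homogD(1)[OF f]] by metis
  qed
qed

definition two_form :: "nat \<Rightarrow> (nat \<Rightarrow> nat \<Rightarrow> 'k::field) \<Rightarrow> nat set \<Rightarrow> 'k" where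
  "two_form m c = (\<lambda>S. \<Sum>q<m. \<Sum>p<q. c p q * ext_mult (gen p) (gen q) S)"

lemma gen_mult_homog: "p < n \<Longrightarrow> q < n \<Longrightarrow> ext_homog n 2 (ext_mult (gen p) (gen q))"
  using ext_homog_mult[OF gen_homog gen_homog, of p n q] by (simp add: numeral_2_eq_2)

lemma two_form_homog: "m \<le> n \<Longrightarrow> ext_homog n 2 (two_form m c)"
  unfolding two_form_def by (intro ext_homog_sum ext_homog_scale gen_mult_homog) auto

lemma two_form_pair:
  fixes c :: "nat \<Rightarrow> nat \<Rightarrow> 'k::field"
  assumes "a < b"
  shows "two_form m c {a, b} = (if b < m then c a b else 0)"
proof -
  have "ext_mult (gen p) (gen q) {a, b} = (if p = a \<and> q = b then 1 else 0 :: 'k)" if "p < q" for p q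
    using mult_homog1_pair[OF gen_homog[of p "Suc p"] assms, of "gen q"] that assms by (auto simp: gen_def)
  then have "two_form m c {a, b} = (\<Sum>q<m. \<Sum>p<q. if p = a \<and> q = b then c a b else 0)"
    unfolding two_form_def by (intro sum.cong) auto
  also have "\<dots> = (\<Sum>q<m. if q = b then c a b else 0)"
    by (intro sum.cong refl) (use assms in \<open>auto intro!: sum.neutral\<close>)
  finally show ?thesis by simp
qed

lemma homog2_expand:
  assumes "ext_homog n 2 f"
  shows "f = two_form n (\<lambda>p q. f {p, q})"
  by (rule homog2_eqI[OF assms two_form_homog]) (simp_all add: two_form_pair)

text \<open>The structure constant of [e_p, e_q] along e_i is the coefficient of x_p x_q in dx_i; no
  sign is introduced in dualising.\<close>

definition dual_bracket :: "nat \<Rightarrow> ((nat set \<Rightarrow> 'k::field) \<Rightarrow> (nat set \<Rightarrow> 'k)) \<Rightarrow> 'k bracket" where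
  "dual_bracket n d u v i = (\<Sum>q<n. \<Sum>p<q. d (gen i) {p, q} * (u p * v q - u q * v p))"

lemma alternating_sum:
  assumes "\<And>q. q \<in> I \<Longrightarrow> q < n" "\<And>q p. q \<in> I \<Longrightarrow> p \<in> J q \<Longrightarrow> p < n"
  shows "alternating n (\<lambda>u v. \<Sum>q\<in>I. \<Sum>p\<in>J q. c p q * (u p * v q - u q * v p))"
  unfolding alternating_def linear_form_def
proof (intro conjI allI impI)
  fix u v u' :: "nat \<Rightarrow> 'a" and x :: 'a
  let ?S = "\<lambda>u v. \<Sum>q\<in>I. \<Sum>p\<in>J q. c p q * (u p * v q - u q * v p)"
  show "?S (\<lambda>k. x * u k + u' k) v = x * ?S u v + ?S u' v"
    unfolding sum_distrib_left sum.distrib[symmetric] by (intro sum.cong refl) (simp add: algebra_simps)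
  show "?S v u = - ?S u v"
    unfolding sum_negf[symmetric] by (intro sum.cong refl) (simp add: algebra_simps)
  show "?S u u = 0" by (simp add: mult.commute)
  show "?S u v = 0" if "\<forall>k<n. u k = 0" using that assms by (auto intro!: sum.neutral)
qed

lemma dual_bracket_bracket: "bracket n (dual_bracket n d)"
  unfolding bracket_def dual_bracket_def by (intro allI impI alternating_sum) auto

lemma sum_pairs_unit:
  fixes c :: "nat \<Rightarrow> nat \<Rightarrow> 'k::field"
  assumes "a < b" "b < n"
  shows "(\<Sum>q<n. \<Sum>p<q. c p q * (unit_vec a p * unit_vec b q - unit_vec a q * unit_vec b p)) = c a b"
proof -
  have "(\<Sum>q<n. \<Sum>p<q. c p q * (unit_vec a p * unit_vec b q - unit_vec a q * unit_vec b p))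
    = (\<Sum>q<n. \<Sum>p<q. if p = a \<and> q = b then c a b else 0)"
    by (intro sum.cong refl) (use assms in \<open>auto simp: unit_vec_def\<close>)
  also have "\<dots> = (\<Sum>q<n. if q = b then c a b else 0)"
    by (intro sum.cong refl) (use assms in \<open>auto intro!: sum.neutral\<close>)
  finally show ?thesis using assms by simp
qed

lemma dual_bracket_unit:
  "a < b \<Longrightarrow> b < n \<Longrightarrow> dual_bracket n d (unit_vec a) (unit_vec b) i = d (gen i) {a, b}"
  unfolding dual_bracket_def by (rule sum_pairs_unit)

lemma is_dgaD:
  assumes "is_dga n d"
  shows "ext_linear n d" "f \<in> ext_elems n \<Longrightarrow> d f \<in> ext_elems n"
    "ext_homog n p f \<Longrightarrow> ext_homog n (Suc p) (d f)"
    "ext_homog n p a \<Longrightarrow> b \<in> ext_elems n \<Longrightarrow>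
      d (ext_mult a b) = (\<lambda>S. ext_mult (d a) b S + (-1) ^ p * ext_mult a (d b) S)"
    "f \<in> ext_elems n \<Longrightarrow> d (d f) = (\<lambda>S. 0)"
  using assms by (auto simp: is_dga_def ext_linear_def)

lemma is_dga_gen: "is_dga n d \<Longrightarrow> i < n \<Longrightarrow> ext_homog n 2 (d (gen i))"
  using is_dgaD(3)[OF _ gen_homog, of n d i] by (simp add: numeral_2_eq_2)

lemma is_dga_gen_mult:
  "is_dga n d \<Longrightarrow> i < n \<Longrightarrow> b \<in> ext_elems n \<Longrightarrow>
    d (ext_mult (gen i) b) = (\<lambda>S. (-1) * ext_mult (gen i) (d b) S + ext_mult (d (gen i)) b S)"
  using is_dgaD(4)[OF _ gen_homog, of n d i b] by (simp add: fun_eq_iff)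

lemma is_dga_one: "is_dga n d \<Longrightarrow> d ext_one = (\<lambda>S. 0)"
proof -
  assume d: "is_dga n d"
  have "ext_homog n 0 ext_one" by (auto simp: ext_homog_def ext_one_def ext_one_elems)
  from is_dgaD(4)[OF d this ext_one_elems]
  have "d ext_one = (\<lambda>S. d ext_one S + d ext_one S)"
    unfolding ext_one_left[OF is_dgaD(2)[OF d ext_one_elems]] ext_one_right[OF is_dgaD(2)[OF d ext_one_elems]]
      ext_one_left[OF ext_one_elems[of n]] by simp
  then have "d ext_one S = d ext_one S + d ext_one S" for S by metis
  then show ?thesis by (metis add_cancel_left_left)
qed

text \<open>A multiplicative map intertwines the differentials on the generators exactly when the transpose of its
  matrix is a homomorphism of the dual brackets.\<close>
lemma dga_hom_iff:
  fixes d1 d2 \<phi> :: "(nat set \<Rightarrow> 'k::field) \<Rightarrow> (nat set \<Rightarrow> 'k)"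
  assumes d1: "is_dga n d1" and d2: "is_dga n d2"
    and lin: "ext_linear n \<phi>" and hom: "\<And>p f. ext_homog n p f \<Longrightarrow> ext_homog n p (\<phi> f)"
    and mult: "\<And>a b. a \<in> ext_elems n \<Longrightarrow> b \<in> ext_elems n \<Longrightarrow> \<phi> (ext_mult a b) = ext_mult (\<phi> a) (\<phi> b)"
  defines "F \<equiv> \<lambda>u i. \<Sum>j<n. \<phi> (gen i) {j} * u j"
  shows "(\<forall>i<n. \<phi> (d1 (gen i)) = d2 (\<phi> (gen i))) \<longleftrightarrow> lie_hom n F (dual_bracket n d2) (dual_bracket n d1)"
proof -
  have F: "linear_map n F" unfolding F_def linear_map_def by (simp add: linear_form_lin_comb)
  have Fu: "F (unit_vec a) i = \<phi> (gen i) {a}" if "a < n" for a i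
  proof -
    have "F (unit_vec a) i = (\<Sum>j<n. if j = a then \<phi> (gen i) {a} else 0)"
      unfolding F_def by (rule sum.cong) (auto simp: unit_vec_def)
    then show ?thesis using that by simp
  qed
  have y: "ext_homog n 1 (\<phi> (gen i))" if "i < n" for i using hom gen_homog that by blast
  have h1: "ext_homog n 2 (\<phi> (d1 (gen i)))" if "i < n" for i using hom is_dga_gen[OF d1 that] by blast
  have h2: "ext_homog n 2 (d2 (\<phi> (gen i)))" if "i < n" for i
    using is_dgaD(3)[OF d2 y[OF that]] by (simp add: numeral_2_eq_2)
  have 1: "\<phi> (d1 (gen i)) {a, b} = dual_bracket n d1 (F (unit_vec a)) (F (unit_vec b)) i"
    if i: "i < n" and ab: "a < b" "b < n" for i a b
  proof -
    let ?c = "\<lambda>p q. d1 (gen i) {p, q}"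
    have g2: "ext_mult (gen p) (gen q) \<in> (ext_elems n :: (nat set \<Rightarrow> 'k) set)" if "p < n" "q < n" for p q
      using gen_mult_homog[OF that] ext_homogD(1) by blast
    have "\<phi> (two_form n ?c) = (\<lambda>S. \<Sum>q<n. 1 * \<phi> (\<lambda>S. \<Sum>p<q. ?c p q * ext_mult (gen p) (gen q) S) S)"
    proof -
      have "(\<lambda>S. \<Sum>p<q. ?c p q * ext_mult (gen p) (gen q) S) \<in> ext_elems n" if "q \<in> {..<n}" for q
        by (intro ext_elems_sum ext_elems_scale g2) (use that in auto)
      from ext_linear_sum[OF lin finite_lessThan this, where c = "\<lambda>_. 1"] show ?thesis by (simp add: two_form_def)
    qed
    also have "\<dots> = (\<lambda>S. \<Sum>q<n. \<Sum>p<q. ?c p q * ext_mult (\<phi> (gen p)) (\<phi> (gen q)) S)"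
    proof (intro ext sum.cong refl)
      fix S q assume q: "q \<in> {..<n}"
      have "\<phi> (\<lambda>S. \<Sum>p<q. ?c p q * ext_mult (gen p) (gen q) S) = (\<lambda>S. \<Sum>p<q. ?c p q * \<phi> (ext_mult (gen p) (gen q)) S)"
        by (rule ext_linear_sum[OF lin]) (use q g2 in auto)
      then show "1 * \<phi> (\<lambda>S. \<Sum>p<q. ?c p q * ext_mult (gen p) (gen q) S) S
        = (\<Sum>p<q. ?c p q * ext_mult (\<phi> (gen p)) (\<phi> (gen q)) S)"
        using q by (simp add: mult gen_elems)
    qed
    finally have "\<phi> (d1 (gen i)) {a, b} = (\<Sum>q<n. \<Sum>p<q. ?c p q * ext_mult (\<phi> (gen p)) (\<phi> (gen q)) {a, b})"
      using homog2_expand[OF is_dga_gen[OF d1 i]] by simp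
    also have "\<dots> = (\<Sum>q<n. \<Sum>p<q. ?c p q * (F (unit_vec a) p * F (unit_vec b) q - F (unit_vec a) q * F (unit_vec b) p))"
    proof (intro sum.cong refl)
      fix q p assume "q \<in> {..<n}" "p \<in> {..<q}"
      then show "?c p q * ext_mult (\<phi> (gen p)) (\<phi> (gen q)) {a, b}
        = ?c p q * (F (unit_vec a) p * F (unit_vec b) q - F (unit_vec a) q * F (unit_vec b) p)"
        using mult_homog1_pair[OF y[of p] ab(1), of "\<phi> (gen q)"] ab by (simp add: Fu mult.commute)
    qed
    finally show ?thesis by (simp add: dual_bracket_def)
  qed
  have 2: "d2 (\<phi> (gen i)) {a, b} = F (dual_bracket n d2 (unit_vec a) (unit_vec b)) i"
    if i: "i < n" and ab: "a < b" "b < n" for i a b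
  proof -
    have "d2 (\<lambda>S. \<Sum>j<n. \<phi> (gen i) {j} * gen j S) = (\<lambda>S. \<Sum>j<n. \<phi> (gen i) {j} * d2 (gen j) S)"
      by (rule ext_linear_sum[OF is_dgaD(1)[OF d2]]) (auto intro: gen_elems)
    then have "d2 (\<phi> (gen i)) = (\<lambda>S. \<Sum>j<n. \<phi> (gen i) {j} * d2 (gen j) S)"
      using homog1_expand[OF y[OF i]] by simp
    then show ?thesis using ab by (simp add: F_def dual_bracket_unit)
  qed
  show ?thesis
  proof
    assume eq: "\<forall>i<n. \<phi> (d1 (gen i)) = d2 (\<phi> (gen i))"
    show "lie_hom n F (dual_bracket n d2) (dual_bracket n d1)"
      by (rule lie_hom_unitI[OF dual_bracket_bracket dual_bracket_bracket F]) (metis 1 2 eq)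
  next
    assume h: "lie_hom n F (dual_bracket n d2) (dual_bracket n d1)"
    show "\<forall>i<n. \<phi> (d1 (gen i)) = d2 (\<phi> (gen i))"
    proof (intro allI impI)
      fix i assume i: "i < n"
      show "\<phi> (d1 (gen i)) = d2 (\<phi> (gen i))"
        by (rule homog2_eqI[OF h1[OF i] h2[OF i]]) (use h i in \<open>simp add: 1 2 lie_hom_def\<close>)
    qed
  qed
qed

lemma dga_iso_imp_lie_iso:
  fixes d1 d2 :: "(nat set \<Rightarrow> 'k::field) \<Rightarrow> (nat set \<Rightarrow> 'k)"
  assumes d1: "is_dga n d1" and d2: "is_dga n d2" and iso: "dga_iso n d1 d2"
  shows "lie_iso n (dual_bracket n d2) (dual_bracket n d1)"
proof -
  obtain \<phi> where bij: "bij_betw \<phi> (ext_elems n) (ext_elems n)" and lin: "ext_linear n \<phi>"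
    and hom: "\<And>p f. ext_homog n p f \<Longrightarrow> ext_homog n p (\<phi> f)"
    and mult: "\<And>a b. a \<in> ext_elems n \<Longrightarrow> b \<in> ext_elems n \<Longrightarrow> \<phi> (ext_mult a b) = ext_mult (\<phi> a) (\<phi> b)"
    and comm: "\<And>f. f \<in> ext_elems n \<Longrightarrow> \<phi> (d1 f) = d2 (\<phi> f)"
    using iso unfolding dga_iso_def ext_linear_def by blast
  define F where "F u i = (\<Sum>j<n. \<phi> (gen i) {j} * u j)" for u i
  have "lie_hom n F (dual_bracket n d2) (dual_bracket n d1)"
    using dga_hom_iff[OF d1 d2 lin hom mult] comm gen_elems unfolding F_def by blast
  moreover have "linear_map n F" unfolding F_def linear_map_def by (simp add: linear_form_lin_comb)
  moreover have "injective_map n F"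
  proof -
    \<comment> \<open>G is the matrix of \<open>\<phi>\<close> on generators and F its transpose.
      Injectivity of \<open>\<phi>\<close> makes G injective, and the inverse of G carries
      injectivity over to F.\<close>
    define G where "G c j = (\<Sum>i<n. \<phi> (gen i) {j} * c i)" for c j
    have linG: "linear_map n G" unfolding G_def linear_map_def by (simp add: linear_form_lin_comb)
    have injG: "injective_map n G"
      unfolding injective_map_def
    proof (intro allI impI)
      fix c i assume c: "\<forall>j<n. G c j = 0" and i: "i < n"
      define f where "f = (\<lambda>S. \<Sum>i<n. c i * gen i S)"
      have f: "ext_homog n 1 f" unfolding f_def by (intro ext_homog_sum ext_homog_scale gen_homog) auto
      have "\<phi> f = (\<lambda>S. \<Sum>i<n. c i * \<phi> (gen i) S)"
        unfolding f_def by (rule ext_linear_sum[OF lin]) (auto intro: gen_elems)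
      then have "\<phi> f {j} = 0" if "j < n" for j using c that by (simp add: G_def mult.commute)
      then have "\<phi> f = (\<lambda>S. 0)" using homog1_expand[OF hom[OF f]] by (simp add: sum.neutral)
      then have "\<phi> f = \<phi> (\<lambda>S. 0)" using ext_linearD(2)[OF lin] by simp
      then have "f = (\<lambda>S. 0)"
        using bij ext_homogD(1)[OF f] ext_elems_zero unfolding bij_betw_def inj_on_def by blast
      then have "f {i} = 0" by simp
      moreover have "f {i} = (\<Sum>k<n. if k = i then c i else 0)"
        unfolding f_def by (rule sum.cong) (auto simp: gen_def)
      ultimately show "c i = 0" using i by simp
    qed
    obtain H where H: "linear_map n H" "injective_map n H" "\<And>u i. i < n \<Longrightarrow> G (H u) i = u i"
      "\<And>u i. i < n \<Longrightarrow> H (G u) i = u i" using injective_map_inverse[OF linG injG] by blast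
    show ?thesis
      unfolding injective_map_def
    proof (intro allI impI)
      fix u k assume u: "\<forall>i<n. F u i = 0" and k: "k < n"
      have "u k = (\<Sum>j<n. unit_vec k j * u j)"
        using k by (simp add: unit_vec_def if_distrib[of "\<lambda>x. x * _"] cong: if_cong)
      also have "\<dots> = (\<Sum>j<n. \<Sum>i<n. H (unit_vec k) i * (\<phi> (gen i) {j} * u j))"
      proof (rule sum.cong)
        fix j assume "j \<in> {..<n}"
        then have "unit_vec k j = G (H (unit_vec k)) j" using H(3) by simp
        then show "unit_vec k j * u j = (\<Sum>i<n. H (unit_vec k) i * (\<phi> (gen i) {j} * u j))"
          by (simp add: G_def sum_distrib_left mult_ac)
      qed simp
      also have "\<dots> = (\<Sum>i<n. H (unit_vec k) i * F u i)"
        by (subst sum.swap) (simp add: F_def sum_distrib_left)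
      finally show "u k = 0" using u by simp
    qed
  qed
  ultimately show ?thesis unfolding lie_iso_def by blast
qed

lemma ext_hom_eqI:
  assumes lin: "ext_linear n \<phi>" "ext_linear n \<psi>"
    and one: "\<phi> ext_one = \<psi> ext_one" and gen: "\<And>i. i < n \<Longrightarrow> \<phi> (gen i) = \<psi> (gen i)"
    and mult: "\<And>a b. a \<in> ext_elems n \<Longrightarrow> b \<in> ext_elems n \<Longrightarrow> \<phi> (ext_mult a b) = ext_mult (\<phi> a) (\<phi> b)"
      "\<And>a b. a \<in> ext_elems n \<Longrightarrow> b \<in> ext_elems n \<Longrightarrow> \<psi> (ext_mult a b) = ext_mult (\<psi> a) (\<psi> b)"
    and f: "f \<in> ext_elems n"
  shows "\<phi> f = \<psi> f"
proof (rule ext_linear_eqI[OF lin _ f])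
  fix S :: "nat set" assume "S \<subseteq> {..<n}"
  then show "\<phi> (ext_basis S) = \<psi> (ext_basis S)"
    by (induction rule: ext_basis_induct) (simp_all add: one mult gen_elems gen)
qed

text \<open>The transpose of F maps generators to degree one and extends to an algebra map, with
  inverse supplied by G. Compatibility with d holds on generators by \<open>dga_hom_iff\<close> and
  spreads to products by the Leibniz rule.\<close>

lemma lie_iso_imp_dga_iso:
  fixes d1 d2 :: "(nat set \<Rightarrow> 'k::field) \<Rightarrow> (nat set \<Rightarrow> 'k)"
  assumes d1: "is_dga n d1" and d2: "is_dga n d2" and iso: "lie_iso n (dual_bracket n d2) (dual_bracket n d1)"
  shows "dga_iso n d1 d2"
proof -
  obtain F where F: "linear_map n F" "injective_map n F" "lie_hom n F (dual_bracket n d2) (dual_bracket n d1)"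
    using iso by (auto simp: lie_iso_def)
  obtain G where G: "linear_map n G" "injective_map n G" "\<And>u i. i < n \<Longrightarrow> F (G u) i = u i"
    "\<And>u i. i < n \<Longrightarrow> G (F u) i = u i" using injective_map_inverse[OF F(1,2)] by blast
  define y where "y H i = (\<lambda>S. \<Sum>j<n. H (unit_vec j) i * gen j S)" for H :: "(nat \<Rightarrow> 'k) \<Rightarrow> nat \<Rightarrow> 'k" and i
  have yh: "ext_homog n 1 (y H i)" for H i
    unfolding y_def by (intro ext_homog_sum ext_homog_scale gen_homog) auto
  interpret A: anticommuting n "y F" by unfold_locales (rule yh)
  interpret B: anticommuting n "y G" by unfold_locales (rule yh)
  have y1: "y H i {j} = H (unit_vec j) i" if "j < n" for H i j
  proof -
    have "y H i {j} = (\<Sum>k<n. if k = j then H (unit_vec j) i else 0)"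
      unfolding y_def by (rule sum.cong) (auto simp: gen_def)
    then show ?thesis using that by simp
  qed
  \<comment> \<open>Transposition reverses composition: K after H being the identity makes
    \<open>hom\<close> of H after \<open>hom\<close> of K the identity.\<close>
  have inverse: "anticommuting.hom n (y H) (anticommuting.hom n (y K) f) = f"
    if H: "linear_map n H" and K: "linear_map n K" and KH: "\<And>u i. i < n \<Longrightarrow> K (H u) i = u i" and f: "f \<in> ext_elems n"
    for H K :: "(nat \<Rightarrow> 'k) \<Rightarrow> nat \<Rightarrow> 'k" and f
  proof -
    interpret H: anticommuting n "y H" by unfold_locales (rule yh)
    interpret K: anticommuting n "y K" by unfold_locales (rule yh)
    show ?thesis
    proof (rule ext_hom_eqI[where \<phi> = "\<lambda>f. H.hom (K.hom f)" and \<psi> = "\<lambda>f. f", OF _ _ _ _ _ _ f])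
      show "ext_linear n (\<lambda>f. H.hom (K.hom f))"
        unfolding ext_linear_def
        by (simp add: ext_linearD(1)[OF H.hom_linear] ext_linearD(1)[OF K.hom_linear] K.hom_elems)
      show "H.hom (K.hom (gen i)) = gen i" if i: "i < n" for i
      proof -
        have "H.hom (y K i) = (\<lambda>S. \<Sum>j<n. K (unit_vec j) i * H.hom (gen j) S)"
          unfolding y_def[of K] by (rule ext_linear_sum[OF H.hom_linear]) (auto intro: gen_elems)
        then have hom: "H.hom (K.hom (gen i)) S = (\<Sum>j<n. K (unit_vec j) i * y H j S)" for S
          by (simp add: K.hom_gen[OF i] H.hom_gen)
        have "H.hom (K.hom (gen i)) S = (\<Sum>k<n. (\<Sum>j<n. H (unit_vec k) j * K (unit_vec j) i) * gen k S)" for S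
          unfolding hom y_def sum_distrib_left sum_distrib_right by (subst sum.swap) (simp add: mult_ac)
        moreover have "(\<Sum>j<n. H (unit_vec k) j * K (unit_vec j) i) = unit_vec k i" for k
          using linear_form_expand[of n "\<lambda>u. K u i" "H (unit_vec k)"] K i KH[OF i, of "unit_vec k"]
          by (simp add: linear_map_def)
        moreover have "(\<Sum>k<n. unit_vec k i * gen k S) = (\<Sum>k<n. if k = i then gen i S else (0::'k))" for S
          by (rule sum.cong) (auto simp: unit_vec_def)
        ultimately have "H.hom (K.hom (gen i)) S = (\<Sum>k<n. if k = i then gen i S else 0)" for S by simp
        then show ?thesis using i by (simp add: fun_eq_iff)
      qed
    qed (simp_all add: H.hom_one K.hom_one ext_linear_def H.hom_mult K.hom_mult K.hom_elems)
  qed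
  have bij: "bij_betw A.hom (ext_elems n) (ext_elems n)"
    by (rule bij_betw_byWitness[where f' = B.hom])
      (use inverse F(1) G A.hom_elems B.hom_elems in \<open>auto simp: image_subset_iff\<close>)
  \<comment> \<open>The matrix read off from \<open>A.hom\<close> agrees with F on the coordinates
    below n only, so the homomorphism property has to be transferred coordinatewise.\<close>
  let ?F = "\<lambda>u i. \<Sum>j<n. A.hom (gen i) {j} * u j"
  have FF: "?F u i = F u i" if "i < n" for u i
    using linear_form_expand[of n "\<lambda>u. F u i" u] F(1) that by (simp add: linear_map_def A.hom_gen y1 mult.commute)
  have "lie_hom n ?F (dual_bracket n d2) (dual_bracket n d1)"
    unfolding lie_hom_def
  proof (intro allI impI)
    fix u v :: "nat \<Rightarrow> 'k" and i assume i: "i < n"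
    have "dual_bracket n d1 (?F u) (?F v) i = dual_bracket n d1 (F u) (F v) i"
      by (rule bracket_cong[OF dual_bracket_bracket i]) (rule FF, assumption)+
    then show "?F (dual_bracket n d2 u v) i = dual_bracket n d1 (?F u) (?F v) i"
      using F(3) i by (simp add: FF lie_hom_def)
  qed
  then have gens: "A.hom (d1 (gen i)) = d2 (A.hom (gen i))" if "i < n" for i
    using dga_hom_iff[OF d1 d2 A.hom_linear A.hom_homog A.hom_mult] that by blast
  have lin: "ext_linear n (\<lambda>f. A.hom (d1 f))" "ext_linear n (\<lambda>f. d2 (A.hom f))"
    unfolding ext_linear_def
    by (simp_all add: ext_linearD(1)[OF A.hom_linear] ext_linearD(1)[OF is_dgaD(1)[OF d1]]
        ext_linearD(1)[OF is_dgaD(1)[OF d2]] is_dgaD(2)[OF d1] A.hom_elems)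
  have comm: "A.hom (d1 f) = d2 (A.hom f)" if f: "f \<in> ext_elems n" for f
  proof (rule ext_linear_eqI[OF lin _ f])
    fix S :: "nat set" assume "S \<subseteq> {..<n}"
    then show "A.hom (d1 (ext_basis S)) = d2 (A.hom (ext_basis S))"
    proof (induction rule: ext_basis_induct)
      case one
      show ?case using is_dga_one[OF d1] is_dga_one[OF d2] by (simp add: A.hom_one ext_linearD(2)[OF A.hom_linear])
    next
      case (mult b f)
      have e: "d1 f \<in> ext_elems n" "ext_mult (gen b) (d1 f) \<in> ext_elems n" "ext_mult (d1 (gen b)) f \<in> ext_elems n"
        "d1 (gen b) \<in> ext_elems n"
        using mult by (simp_all add: is_dgaD(2)[OF d1] ext_mult_elems gen_elems)
      have "A.hom (d1 (ext_mult (gen b) f)) = (\<lambda>S. (-1) * ext_mult (A.hom (gen b)) (A.hom (d1 f)) S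
          + ext_mult (A.hom (d1 (gen b))) (A.hom f) S)"
        unfolding is_dga_gen_mult[OF d1 mult(1,2)] ext_linearD(1)[OF A.hom_linear e(2,3)]
        using A.hom_mult[OF gen_elems[OF mult(1)] e(1)] A.hom_mult[OF e(4) mult(2)] by simp
      also have "\<dots> = d2 (ext_mult (A.hom (gen b)) (A.hom f))"
        using is_dgaD(4)[OF d2 A.hom_homog[OF gen_homog[OF mult(1)]] A.hom_elems[of f]]
        by (simp add: gens[OF mult(1)] mult(3) fun_eq_iff)
      finally show ?case by (simp add: A.hom_mult gen_elems mult)
    qed
  qed
  show ?thesis
    unfolding dga_iso_def using bij A.hom_linear[unfolded ext_linear_def] A.hom_homog A.hom_one A.hom_mult comm by blast
qed

text \<open>The coefficients of d^2 on a generator are Jacobi sums of the dual bracket. Only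
  linearity, degrees and the Leibniz rule on generators are assumed, so that the lemma also applies
  where d^2 = 0 is still to be proved.\<close>

lemma double_differential_gen:
  fixes d :: "(nat set \<Rightarrow> 'k::field) \<Rightarrow> (nat set \<Rightarrow> 'k)"
  assumes lin: "ext_linear n d" and hom: "\<And>i. i < n \<Longrightarrow> ext_homog n 2 (d (gen i))"
    and leibniz: "\<And>i b. i < n \<Longrightarrow> b \<in> ext_elems n \<Longrightarrow>
      d (ext_mult (gen i) b) = (\<lambda>S. (-1) * ext_mult (gen i) (d b) S + ext_mult (d (gen i)) b S)"
    and i: "i < n" and abc: "a < b" "b < c" "c < n"
  defines "\<beta> \<equiv> dual_bracket n d"
  shows "d (d (gen i)) {a, b, c} = \<beta> (\<beta> (unit_vec a) (unit_vec b)) (unit_vec c) i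
    + \<beta> (\<beta> (unit_vec b) (unit_vec c)) (unit_vec a) i + \<beta> (\<beta> (unit_vec c) (unit_vec a)) (unit_vec b) i"
proof -
  define D where "D k p q = d (gen k) {p, q}" for k p q
  have g2: "ext_mult (gen p) (gen q) \<in> (ext_elems n :: (nat set \<Rightarrow> 'k) set)" if "p < n" "q < n" for p q
    using gen_mult_homog[OF that] ext_homogD(1) by blast
  \<comment> \<open>The Leibniz rule gives - x_p dx_q + dx_p x_q. As dx_p is even, it moves to the
    right, and both products can be read off on the triple.\<close>
  have m: "d (ext_mult (gen p) (gen q)) {a, b, c}
    = ((if q = a then D p b c else 0) - (if q = b then D p a c else 0) + (if q = c then D p a b else 0))
    - ((if p = a then D q b c else 0) - (if p = b then D q a c else 0) + (if p = c then D q a b else 0))"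
    if "p < n" "q < n" for p q
    unfolding leibniz[OF that(1) gen_elems[OF that(2)]] ext_even_commute[OF hom[OF that(1)]]
      mult_homog1_triple[OF gen_homog[OF that(1)] abc(1,2)] mult_homog1_triple[OF gen_homog[OF that(2)] abc(1,2)]
    by (auto simp: gen_def D_def)
  have "d (d (gen i)) = d (two_form n (D i))"
    using homog2_expand[OF hom[OF i]] unfolding D_def by simp
  also have "\<dots> = (\<lambda>S. \<Sum>q<n. d (\<lambda>S. \<Sum>p<q. D i p q * ext_mult (gen p) (gen q) S) S)"
  proof -
    have "(\<lambda>S. \<Sum>p<q. D i p q * ext_mult (gen p) (gen q) S) \<in> ext_elems n" if "q \<in> {..<n}" for q
      by (intro ext_elems_sum ext_elems_scale g2) (use that in auto)
    from ext_linear_sum[OF lin finite_lessThan this, where c = "\<lambda>_. 1"] show ?thesis by (simp add: two_form_def)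
  qed
  also have "\<dots> = (\<lambda>S. \<Sum>q<n. \<Sum>p<q. D i p q * d (ext_mult (gen p) (gen q)) S)"
  proof (intro ext sum.cong refl)
    fix S q assume q: "q \<in> {..<n}"
    have "d (\<lambda>S. \<Sum>p<q. D i p q * ext_mult (gen p) (gen q) S) = (\<lambda>S. \<Sum>p<q. D i p q * d (ext_mult (gen p) (gen q)) S)"
      by (rule ext_linear_sum[OF lin]) (use q g2 in auto)
    then show "d (\<lambda>S. \<Sum>p<q. D i p q * ext_mult (gen p) (gen q) S) S
      = (\<Sum>p<q. D i p q * d (ext_mult (gen p) (gen q)) S)" by simp
  qed
  finally have l: "d (d (gen i)) {a, b, c} = (\<Sum>q<n. \<Sum>p<q. D i p q * d (ext_mult (gen p) (gen q)) {a, b, c})"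
    by simp
  have u: "\<beta> (unit_vec a) (unit_vec b) k = D k a b" "\<beta> (unit_vec b) (unit_vec c) k = D k b c"
    "\<beta> (unit_vec c) (unit_vec a) k = - D k a c" if "k < n" for k
    using bracketD(3)[OF dual_bracket_bracket that, of d "unit_vec a" "unit_vec c"] abc
    by (simp_all add: \<beta>_def D_def dual_bracket_unit)
  have \<beta>: "\<beta> v w i = (\<Sum>q<n. \<Sum>p<q. D i p q * (v p * w q - v q * w p))" for v w
    by (simp add: \<beta>_def D_def dual_bracket_def)
  show ?thesis
    unfolding l \<beta> sum.distrib[symmetric]
  proof (intro sum.cong refl)
    fix q p assume "q \<in> {..<n}" "p \<in> {..<q}"
    then have pq: "p < n" "q < n" by auto
    show "D i p q * d (ext_mult (gen p) (gen q)) {a, b, c} =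
      D i p q * (\<beta> (unit_vec a) (unit_vec b) p * unit_vec c q - \<beta> (unit_vec a) (unit_vec b) q * unit_vec c p)
      + D i p q * (\<beta> (unit_vec b) (unit_vec c) p * unit_vec a q - \<beta> (unit_vec b) (unit_vec c) q * unit_vec a p)
      + D i p q * (\<beta> (unit_vec c) (unit_vec a) p * unit_vec b q - \<beta> (unit_vec c) (unit_vec a) q * unit_vec b p)"
      unfolding m[OF pq] u[OF pq(1)] u[OF pq(2)] using abc by (simp add: unit_vec_def algebra_simps)
  qed
qed

lemma dual_bracket_jacobi:
  assumes d: "is_dga n d"
  shows "jacobi n (dual_bracket n d)"
proof (rule jacobi_unitI[OF dual_bracket_bracket])
  fix i p q r assume *: "i < n" "p < q" "q < r" "r < n"
  show "dual_bracket n d (dual_bracket n d (unit_vec p) (unit_vec q)) (unit_vec r) i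
    + dual_bracket n d (dual_bracket n d (unit_vec q) (unit_vec r)) (unit_vec p) i
    + dual_bracket n d (dual_bracket n d (unit_vec r) (unit_vec p)) (unit_vec q) i = 0"
    using double_differential_gen[OF is_dgaD(1)[OF d] is_dga_gen[OF d] is_dga_gen_mult[OF d] *]
      is_dgaD(5)[OF d gen_elems[OF *(1)]] by simp
qed

text \<open>The minimal basis serves as a coordinate system: F u lists the values x_i(u) and is
  injective because the x_i span degree one. In these coordinates the minimality condition on dx_i
  is the flag condition.\<close>

lemma minimal_alg_bracket:
  fixes d :: "(nat set \<Rightarrow> 'k::field) \<Rightarrow> (nat set \<Rightarrow> 'k)"
  assumes "minimal_alg n d"
  obtains \<beta> where "nilpotent n \<beta>" "lie_iso n (dual_bracket n d) \<beta>"
proof -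
  obtain x :: "nat \<Rightarrow> nat set \<Rightarrow> 'k" where d: "is_dga n d" and x: "\<And>i. i < n \<Longrightarrow> ext_homog n 1 (x i)"
    and span: "\<And>v. ext_homog n 1 v \<Longrightarrow> \<exists>c. v = (\<lambda>S. \<Sum>i<n. c i * x i S)"
    and flag: "\<And>i. i < n \<Longrightarrow> \<exists>c :: nat \<Rightarrow> nat \<Rightarrow> 'k.
      d (x i) = (\<lambda>S. \<Sum>j<i. \<Sum>l<i. c j l * ext_mult (x j) (x l) S)"
    using assms unfolding minimal_alg_def by blast
  let ?\<delta> = "dual_bracket n d"
  define F where "F u i = (\<Sum>j<n. x i {j} * u j)" for u i
  have F: "linear_map n F" unfolding F_def linear_map_def by (simp add: linear_form_lin_comb)
  have Fu: "F (unit_vec a) i = x i {a}" if "a < n" for a i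
  proof -
    have "F (unit_vec a) i = (\<Sum>j<n. if j = a then x i {a} else 0)"
      unfolding F_def by (rule sum.cong) (auto simp: unit_vec_def)
    then show ?thesis using that by simp
  qed
  have injF: "injective_map n F"
    unfolding injective_map_def
  proof (intro allI impI)
    fix u k assume u: "\<forall>i<n. F u i = 0" and k: "k < n"
    obtain c where c: "gen k = (\<lambda>S. \<Sum>i<n. c i * x i S)" using span[OF gen_homog[OF k]] by blast
    have "u k = (\<Sum>j<n. if j = k then u k else 0)" using k by simp
    also have "\<dots> = (\<Sum>j<n. gen k {j} * u j)" by (rule sum.cong) (auto simp: gen_def)
    also have "\<dots> = (\<Sum>j<n. \<Sum>i<n. c i * (x i {j} * u j))" unfolding c by (simp add: sum_distrib_right mult.assoc)
    also have "\<dots> = (\<Sum>i<n. c i * F u i)" by (subst sum.swap) (simp add: F_def sum_distrib_left)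
    finally show "u k = 0" using u by simp
  qed
  obtain G where G: "linear_map n G" "injective_map n G" "\<And>u i. i < n \<Longrightarrow> F (G u) i = u i"
    "\<And>u i. i < n \<Longrightarrow> G (F u) i = u i" using injective_map_inverse[OF F injF] by blast
  define \<beta> where "\<beta> u v = F (?\<delta> (G u) (G v))" for u v
  have "jacobi n \<beta>"
    unfolding \<beta>_def using jacobi_transport[OF dual_bracket_bracket dual_bracket_jacobi[OF d] F G(1,4)] by blast
  moreover have "alternating i (\<lambda>u v. \<beta> u v i)" if i: "i < n" for i
  proof -
    obtain c where c: "d (x i) = (\<lambda>S. \<Sum>j<i. \<Sum>l<i. c j l * ext_mult (x j) (x l) S)" using flag[OF i] by blast
    \<comment> \<open>The coefficient of x_j x_l is written with the indices exchanged, hence with a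
      minus sign, to fit the shape of \<open>alternating_sum\<close>.\<close>
    let ?\<eta> = "\<lambda>u v. \<Sum>j<i. \<Sum>l<i. (- c j l) * (u l * v j - u j * v l :: 'k)"
    have alt: "alternating i ?\<eta>" by (rule alternating_sum) auto
    then have "bracket n (\<lambda>u v k. ?\<eta> u v)" unfolding bracket_def using i by (intro allI impI alternating_mono[OF alt]) simp
    from bracket_pre[OF this F] have alt': "alternating n (\<lambda>u v. ?\<eta> (F u) (F v))"
      using i unfolding bracket_def by blast
    have eq: "F (?\<delta> u v) i = ?\<eta> (F u) (F v)" for u v
    proof (rule alternating_unit_eqI[where n = n and \<omega> = "\<lambda>u v. F (?\<delta> u v) i" and \<omega>' = "\<lambda>u v. ?\<eta> (F u) (F v)"])
      show "alternating n (\<lambda>u v. F (?\<delta> u v) i)" using bracket_post[OF dual_bracket_bracket F] i by (simp add: bracket_def)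
      fix a b assume ab: "a < b" "b < n"
      have "d (\<lambda>S. \<Sum>j<n. x i {j} * gen j S) = (\<lambda>S. \<Sum>j<n. x i {j} * d (gen j) S)"
        by (rule ext_linear_sum[OF is_dgaD(1)[OF d]]) (auto intro: gen_elems)
      then have "d (x i) = (\<lambda>S. \<Sum>j<n. x i {j} * d (gen j) S)" using homog1_expand[OF x[OF i]] by simp
      then have "F (?\<delta> (unit_vec a) (unit_vec b)) i = d (x i) {a, b}" using ab by (simp add: F_def dual_bracket_unit)
      also have "\<dots> = (\<Sum>j<i. \<Sum>l<i. c j l * (x j {a} * x l {b} - x j {b} * x l {a}))"
        unfolding c using i by (intro sum.cong refl) (simp add: mult_homog1_pair[OF x ab(1)])
      also have "\<dots> = ?\<eta> (F (unit_vec a)) (F (unit_vec b))"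
        using ab by (intro sum.cong refl) (simp add: Fu algebra_simps)
      finally show "F (?\<delta> (unit_vec a) (unit_vec b)) i = ?\<eta> (F (unit_vec a)) (F (unit_vec b))" .
    qed (rule alt')
    have "\<beta> u v i = ?\<eta> u v" for u v
      unfolding \<beta>_def eq using i by (intro sum.cong refl) (simp add: G(3))
    then show ?thesis using alt by simp
  qed
  moreover have "lie_iso n ?\<delta> \<beta>"
    unfolding lie_iso_def \<beta>_def using F injF lie_hom_transport[OF dual_bracket_bracket F G(4)] by blast
  ultimately show ?thesis using that unfolding nilpotent_def by blast
qed

text \<open>d is the derivation with x_i sent to the 2-form g_i of structure constants. Since g_i is
  even it commutes with everything, which turns the antiderivation property of contractions into the
  Leibniz rule. Jacobi gives d^2 = 0 on generators, and on products the mixed terms of d^2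
  cancel.\<close>

lemma nilpotent_minimal_alg:
  fixes \<beta> :: "'k::field bracket"
  assumes nil: "nilpotent n \<beta>"
  obtains d where "minimal_alg n d" "\<And>u v i. i < n \<Longrightarrow> dual_bracket n d u v i = \<beta> u v i"
proof -
  have alt: "alternating i (\<lambda>u v. \<beta> u v i)" if "i < n" for i using nil that by (simp add: nilpotent_def)
  define c where "c i p q = \<beta> (unit_vec p) (unit_vec q) i" for i p q
  define g where "g i = two_form i (c i)" for i
  define d where "d f = (\<lambda>S. \<Sum>i<n. ext_mult (g i) (contr i f) S)" for f
  have g: "ext_homog n 2 (g i)" if "i < n" for i unfolding g_def using that by (intro two_form_homog) simp
  have elems: "d f \<in> ext_elems n" if "f \<in> ext_elems n" for f
    unfolding d_def using that by (intro ext_elems_sum ext_mult_elems ext_homogD(1)[OF g] contr_elems) simp_all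
  have lin: "d (\<lambda>S. x * f S + h S) = (\<lambda>S. x * d f S + d h S)" for x f h
    unfolding d_def contr_linear ext_mult_linear_right by (simp add: sum.distrib sum_distrib_left)
  have homog: "ext_homog n (p + 1) (d f)" if f: "ext_homog n p f" for p f
  proof (cases p)
    case 0
    then have "d f = (\<lambda>S. 0)" using contr_homog_0[of n f] f unfolding d_def by simp
    then show ?thesis by (simp add: ext_homog_zero)
  next
    case (Suc q)
    show ?thesis
      unfolding d_def
    proof (rule ext_homog_sum)
      fix i assume "i \<in> {..<n}"
      then show "ext_homog n (p + 1) (ext_mult (g i) (contr i f))"
        using ext_homog_mult[OF g contr_homog[of n q f i]] f Suc by simp
    qed
  qed
  have leibniz: "d (ext_mult a b) = (\<lambda>S. ext_mult (d a) b S + (-1) ^ p * ext_mult a (d b) S)"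
    if a: "ext_homog n p a" for p a b
  proof
    fix S
    have "ext_mult (g i) (ext_mult a h) = ext_mult a (ext_mult (g i) h)" if "i < n" for i h
      using ext_even_commute[OF g[OF that], of a] ext_mult_assoc[of "g i" a h] ext_mult_assoc[of a "g i" h] by simp
    then have "ext_mult (g i) (contr i (ext_mult a b)) S
      = ext_mult (ext_mult (g i) (contr i a)) b S + (-1) ^ p * ext_mult a (ext_mult (g i) (contr i b)) S" if "i < n" for i
      using that ext_mult_linear_right[of "g i" "(-1) ^ p" "ext_mult a (contr i b)" "ext_mult (contr i a) b"]
      unfolding contr_mult[OF a] by (simp add: ext_mult_assoc add.commute)
    then show "d (ext_mult a b) S = ext_mult (d a) b S + (-1) ^ p * ext_mult a (d b) S"
      unfolding d_def ext_mult_sum by (simp add: sum.distrib sum_distrib_left)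
  qed
  have dlin: "ext_linear n d" unfolding ext_linear_def using lin by blast
  have d_gen: "d (gen i) = g i" if i: "i < n" for i
  proof
    fix S
    have "d (gen i) S = (\<Sum>j<n. if j = i then g i S else 0)"
      unfolding d_def using ext_one_right[OF ext_homogD(1)[OF g[OF i]]] by (intro sum.cong) (auto simp: contr_gen)
    then show "d (gen i) S = g i S" using i by simp
  qed
  have leibniz_gen: "d (ext_mult (gen i) b) = (\<lambda>S. (-1) * ext_mult (gen i) (d b) S + ext_mult (d (gen i)) b S)"
    if "i < n" for i b
    using leibniz[OF gen_homog[OF that], of b] by (simp add: fun_eq_iff)
  have dual: "dual_bracket n d u v i = \<beta> u v i" if i: "i < n" for u v i
  proof (rule alternating_unit_eqI[where n = n and \<omega> = "\<lambda>u v. dual_bracket n d u v i" and \<omega>' = "\<lambda>u v. \<beta> u v i"])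
    show "alternating n (\<lambda>u v. dual_bracket n d u v i)" using dual_bracket_bracket[of n d] i by (simp add: bracket_def)
    show "alternating n (\<lambda>u v. \<beta> u v i)" using alternating_mono[OF alt[OF i]] i by simp
    fix a b assume ab: "a < b" "b < n"
    \<comment> \<open>By the flag condition the structure constants outside the range of
      \<open>two_form i\<close> are 0, so cutting the sum off at i loses nothing.\<close>
    have "\<beta> (unit_vec a) (unit_vec b) i = 0" if "\<not> b < i"
    proof -
      have "\<beta> (unit_vec b) (unit_vec a) i = 0"
        by (rule linear_formD(2)[OF alternatingD(1)[OF alt[OF i]]]) (use that in \<open>simp add: unit_vec_def\<close>)
      then show ?thesis using bracketD(3)[OF nilpotent_imp_bracket[OF nil] i, of "unit_vec a" "unit_vec b"] by simp
    qed
    then show "dual_bracket n d (unit_vec a) (unit_vec b) i = \<beta> (unit_vec a) (unit_vec b) i"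
      using ab d_gen[OF i] two_form_pair[OF ab(1), of i "c i"] by (simp add: dual_bracket_unit g_def c_def)
  qed
  have jac: "dual_bracket n d (dual_bracket n d u v) w i = \<beta> (\<beta> u v) w i" if i: "i < n" for u v w i
    unfolding dual[OF i] by (rule bracket_cong[OF nilpotent_imp_bracket[OF nil] i]) (rule dual, assumption, rule refl)
  have dd_gen: "d (d (gen i)) = (\<lambda>S. 0)" if i: "i < n" for i
  proof (rule homog3_eq_0I)
    show "ext_homog n 3 (d (d (gen i)))" using homog[OF g[OF i]] d_gen[OF i] by (simp add: numeral_3_eq_3 numeral_2_eq_2)
    fix a b c :: nat assume "a < b" "b < c" "c < n"
    then have "d (d (gen i)) {a, b, c} = \<beta> (\<beta> (unit_vec a) (unit_vec b)) (unit_vec c) i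
      + \<beta> (\<beta> (unit_vec b) (unit_vec c)) (unit_vec a) i + \<beta> (\<beta> (unit_vec c) (unit_vec a)) (unit_vec b) i"
      using double_differential_gen[OF dlin _ leibniz_gen i, of a b c] g d_gen unfolding jac[OF i] by simp
    then show "d (d (gen i)) {a, b, c} = 0" using nil i by (simp add: nilpotent_def jacobi_def)
  qed
  have dd: "d (d f) = (\<lambda>S. 0)" if f: "f \<in> ext_elems n" for f
  proof (rule ext_linear_eqI[where F = "\<lambda>f. d (d f)" and G = "\<lambda>f S. 0", OF _ _ _ f])
    show "ext_linear n (\<lambda>f. d (d f))" "ext_linear n (\<lambda>f S. 0)" by (simp_all add: ext_linear_def lin)
    fix S :: "nat set" assume "S \<subseteq> {..<n}"
    then show "d (d (ext_basis S)) = (\<lambda>S. 0)"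
    proof (induction rule: ext_basis_induct)
      case one
      have "ext_homog n 0 (ext_one :: nat set \<Rightarrow> 'k)" by (auto simp: ext_homog_def ext_one_def ext_one_elems)
      then have "d ext_one = (\<lambda>S. 0)" unfolding d_def by (simp add: contr_homog_0[of n])
      then show ?case using ext_linearD(2)[OF dlin] by simp
    next
      case (mult b f)
      have h: "ext_homog n 2 (d (gen b))" using g d_gen mult(1) by simp
      show ?case
        unfolding leibniz_gen[OF mult(1)] lin leibniz[OF h] using mult(3) dd_gen[OF mult(1)] by simp
    qed
  qed
  have dga: "is_dga n d"
    unfolding is_dga_def using elems lin homog leibniz dd by blast
  have "minimal_alg n d"
    unfolding minimal_alg_def
  proof (intro conjI exI[where x = gen] allI impI)
    show "c i = 0" if c: "(\<lambda>S. \<Sum>i<n. c i * gen i S) = (\<lambda>S. 0)" and i: "i < n" for c :: "nat \<Rightarrow> 'k" and i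
    proof -
      have "c i = (\<Sum>j<n. if j = i then c i else 0)" using i by simp
      also have "\<dots> = (\<Sum>j<n. c j * gen j {i})" by (rule sum.cong) (auto simp: gen_def)
      also have "\<dots> = 0" using fun_cong[OF c] .
      finally show ?thesis .
    qed
    show "\<exists>c. v = (\<lambda>S. \<Sum>i<n. c i * gen i S)" if "ext_homog n 1 v" for v
      using homog1_expand[OF that] by (rule exI[where x = "\<lambda>i. v {i}"])
    show "\<exists>c. d (gen i) = (\<lambda>S. \<Sum>j<i. \<Sum>l<i. c j l * ext_mult (gen j) (gen l) S)" if i: "i < n" for i
    proof (intro exI[where x = "\<lambda>j l. if j < l then c i j l else 0"] ext)
      fix S
      let ?t = "\<lambda>j l. c i j l * ext_mult (gen j) (gen l) S"
      have "(\<Sum>j<i. \<Sum>l<i. (if j < l then c i j l else 0) * ext_mult (gen j) (gen l) S)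
        = (\<Sum>l<i. \<Sum>j<i. if j < l then ?t j l else 0)"
        by (subst sum.swap) (intro sum.cong refl, simp)
      also have "\<dots> = (\<Sum>l<i. \<Sum>j<l. ?t j l)"
        by (intro sum.cong refl sum.mono_neutral_cong_right) auto
      finally show "d (gen i) S = (\<Sum>j<i. \<Sum>l<i. (if j < l then c i j l else 0) * ext_mult (gen j) (gen l) S)"
        using d_gen[OF i] by (simp add: g_def two_form_def)
    qed
  qed (rule dga gen_homog, assumption?)+
  then show ?thesis using that dual by blast
qed

section \<open>Counting isomorphism classes\<close>

lemma lie_iso_eqI: "(\<And>u v i. i < n \<Longrightarrow> \<beta> u v i = \<beta>' u v i) \<Longrightarrow> lie_iso n \<beta> \<beta>'"
  unfolding lie_iso_def
  by (intro exI[where x = "\<lambda>u. u"]) (auto simp: linear_map_def linear_form_def injective_map_def lie_hom_def)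

lemma dga_iso_iff_lie_iso:
  assumes "is_dga n d1" "is_dga n d2"
  shows "dga_iso n d1 d2 \<longleftrightarrow> lie_iso n (dual_bracket n d1) (dual_bracket n d2)"
  using dga_iso_imp_lie_iso[OF assms] lie_iso_imp_dga_iso[OF assms] lie_iso_sym[OF dual_bracket_bracket dual_bracket_bracket]
  by blast

lemma minimal_alg_is_dga: "minimal_alg n d \<Longrightarrow> is_dga n d"
  by (simp add: minimal_alg_def)

text \<open>The choice makes a minimal algebra a function of k and \<epsilon>, so that isomorphism
  classes can be indexed by such pairs.\<close>

definition model :: "nat \<Rightarrow> 'k::field \<Rightarrow> (nat set \<Rightarrow> 'k) \<Rightarrow> (nat set \<Rightarrow> 'k)" where
  "model k \<epsilon> = (SOME d. minimal_alg 6 d \<and>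
     (\<forall>u v. \<forall>i<6. dual_bracket 6 d u v i = form_bracket (normal_form k \<epsilon>) u v i))"

lemma model:
  assumes "k < 26"
  shows "minimal_alg 6 (model k \<epsilon>)" "lie_iso 6 (dual_bracket 6 (model k \<epsilon>)) (form_bracket (normal_form k \<epsilon>))"
proof -
  obtain d where "minimal_alg 6 d" "\<And>u v i. i < 6 \<Longrightarrow> dual_bracket 6 d u v i = form_bracket (normal_form k \<epsilon>) u v i"
    using nilpotent_minimal_alg[OF nilpotent_normal_form[OF assms]] by blast
  then have "\<exists>d. minimal_alg 6 d \<and> (\<forall>u v. \<forall>i<6. dual_bracket 6 d u v i = form_bracket (normal_form k \<epsilon>) u v i)" by blast
  from someI_ex[OF this] have m: "minimal_alg 6 (model k \<epsilon>) \<and>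
    (\<forall>u v. \<forall>i<6. dual_bracket 6 (model k \<epsilon>) u v i = form_bracket (normal_form k \<epsilon>) u v i)"
    unfolding model_def .
  then show "minimal_alg 6 (model k \<epsilon>)" by blast
  show "lie_iso 6 (dual_bracket 6 (model k \<epsilon>)) (form_bracket (normal_form k \<epsilon>))"
    by (rule lie_iso_eqI) (use m in blast)
qed

lemma model_iso_iff:
  assumes "k < 26" "k' < 26"
  shows "dga_iso 6 (model k \<epsilon>) (model k' \<epsilon>') \<longleftrightarrow>
    lie_iso 6 (form_bracket (normal_form k \<epsilon>)) (form_bracket (normal_form k' \<epsilon>'))"
proof -
  have b: "bracket 6 (form_bracket (normal_form k \<epsilon>))" if "k < 26" for k and \<epsilon> :: 'a
    by (rule nilpotent_imp_bracket[OF nilpotent_normal_form[OF that]])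
  note m = model(2)[OF assms(1), of \<epsilon>] model(2)[OF assms(2), of \<epsilon>']
  show ?thesis
    unfolding dga_iso_iff_lie_iso[OF model(1)[OF assms(1), THEN minimal_alg_is_dga] model(1)[OF assms(2), THEN minimal_alg_is_dga]]
    using m lie_iso_sym[OF dual_bracket_bracket b[OF assms(1)] m(1)] lie_iso_sym[OF dual_bracket_bracket b[OF assms(2)] m(2)]
    by (meson lie_iso_trans)
qed

lemma minimal_alg_model:
  fixes d :: "(nat set \<Rightarrow> 'k::field) \<Rightarrow> (nat set \<Rightarrow> 'k)"
  assumes two: "(2::'k) \<noteq> 0" and d: "minimal_alg 6 d"
  obtains k \<epsilon> where "k < 26" "dga_iso 6 (model k \<epsilon>) d"
proof -
  obtain \<beta> where \<beta>: "nilpotent 6 \<beta>" "lie_iso 6 (dual_bracket 6 d) \<beta>" using minimal_alg_bracket[OF d] by blast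
  obtain k \<epsilon> where k: "k < 26" "lie_iso 6 \<beta> (form_bracket (normal_form k \<epsilon>))"
    using nilpotent_classified[OF two \<beta>(1)] unfolding classified_def by blast
  have "bracket 6 (form_bracket (normal_form k \<epsilon>))" by (rule nilpotent_imp_bracket[OF nilpotent_normal_form[OF k(1)]])
  then have "lie_iso 6 (form_bracket (normal_form k \<epsilon>)) (dual_bracket 6 d)"
    using lie_iso_sym[OF dual_bracket_bracket] lie_iso_trans[OF \<beta>(2) k(2)] by blast
  then have "lie_iso 6 (dual_bracket 6 (model k \<epsilon>)) (dual_bracket 6 d)"
    using lie_iso_trans[OF model(2)[OF k(1)]] by blast
  then have "dga_iso 6 (model k \<epsilon>) d"
    using dga_iso_iff_lie_iso minimal_alg_is_dga[OF d] minimal_alg_is_dga[OF model(1)[OF k(1)]] by blast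
  then show ?thesis using that k(1) by blast
qed

lemma equiv_dga_iso:
  "equiv {d. minimal_alg n d} {(d1, d2). minimal_alg n d1 \<and> minimal_alg n d2 \<and> dga_iso n d1 d2}"
proof (rule equivI)
  show "refl_on {d. minimal_alg n d} {(d1, d2). minimal_alg n d1 \<and> minimal_alg n d2 \<and> dga_iso n d1 d2}"
    by (auto simp: refl_on_def dga_iso_iff_lie_iso minimal_alg_is_dga lie_iso_refl)
  show "sym {(d1, d2). minimal_alg n d1 \<and> minimal_alg n d2 \<and> dga_iso n d1 d2}"
    using lie_iso_sym[OF dual_bracket_bracket dual_bracket_bracket]
    by (auto simp: sym_def dga_iso_iff_lie_iso minimal_alg_is_dga)
  show "trans {(d1, d2). minimal_alg n d1 \<and> minimal_alg n d2 \<and> dga_iso n d1 d2}"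
    using lie_iso_trans by (fastforce simp: trans_def dga_iso_iff_lie_iso minimal_alg_is_dga)
qed auto

lemma equiv_square_class:
  "equiv {x :: 'k::field. x \<noteq> 0} {(a, b). a \<noteq> 0 \<and> b \<noteq> 0 \<and> (\<exists>c. c \<noteq> 0 \<and> a = c ^ 2 * b)}"
proof (rule equivI)
  show "refl_on {x :: 'k. x \<noteq> 0} {(a, b). a \<noteq> 0 \<and> b \<noteq> 0 \<and> (\<exists>c. c \<noteq> 0 \<and> a = c ^ 2 * b)}"
    by (auto simp: refl_on_def intro: exI[where x = 1])
  show "sym {(a :: 'k, b). a \<noteq> 0 \<and> b \<noteq> 0 \<and> (\<exists>c. c \<noteq> 0 \<and> a = c ^ 2 * b)}"
  proof (rule symI, clarify)
    fix b c :: 'k assume "c \<noteq> 0"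
    then have "b = (1 / c) ^ 2 * (c ^ 2 * b)" by (simp add: power_divide)
    then show "\<exists>x. x \<noteq> 0 \<and> b = x ^ 2 * (c ^ 2 * b)" using \<open>c \<noteq> 0\<close> by (metis divide_eq_0_iff one_neq_zero)
  qed
  show "trans {(a :: 'k, b). a \<noteq> 0 \<and> b \<noteq> 0 \<and> (\<exists>c. c \<noteq> 0 \<and> a = c ^ 2 * b)}"
  proof (rule transI, clarify)
    fix z c c' :: 'k assume "c \<noteq> 0" "c' \<noteq> 0"
    then show "\<exists>x. x \<noteq> 0 \<and> c ^ 2 * (c' ^ 2 * z) = x ^ 2 * z" by (intro exI[where x = "c * c'"]) (simp add: power_mult_distrib)
  qed
qed auto

text \<open>Both images are quotients of X by the same equivalence relation. Pairs (k, \<epsilon>)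
  can thus be counted through their labels, without naming a representative of each square
  class.\<close>

lemma bij_betw_same_fibres:
  assumes "p ` X = A" "q ` X = B" "\<And>x y. x \<in> X \<Longrightarrow> y \<in> X \<Longrightarrow> p x = p y \<longleftrightarrow> q x = q y"
  shows "\<exists>f. bij_betw f A B"
proof (intro exI bij_betw_imageI)
  have s: "inv_into X p a \<in> X" "p (inv_into X p a) = a" if "a \<in> A" for a
    using that assms(1) by (auto intro: inv_into_into f_inv_into_f)
  show "inj_on (\<lambda>a. q (inv_into X p a)) A"
    by (rule inj_onI) (metis s assms(3))
  show "(\<lambda>a. q (inv_into X p a)) ` A = B"
  proof
    show "(\<lambda>a. q (inv_into X p a)) ` A \<subseteq> B" using s assms(2) by blast
    show "B \<subseteq> (\<lambda>a. q (inv_into X p a)) ` A"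
    proof
      fix b assume "b \<in> B"
      then obtain x where x: "x \<in> X" "b = q x" using assms(2) by blast
      then have "p x \<in> A" using assms(1) by blast
      then have "q (inv_into X p (p x)) = b" using s[of "p x"] assms(3) x by blast
      then show "b \<in> (\<lambda>a. q (inv_into X p a)) ` A" using \<open>p x \<in> A\<close> by blast
    qed
  qed
qed

lemma normal_form_const: "k < 22 \<Longrightarrow> normal_form k \<epsilon> = normal_form k \<epsilon>'"
proof -
  assume "k < 22"
  then have "k \<in> {..<22}" by simp
  then show ?thesis by (simp add: lessThan_nat_numeral lessThan_Suc normal_form_def) auto
qed

text \<open>There may be infinitely many square classes, so the count 26 + 4r is expressed as a
  bijection with a disjoint sum.\<close>

theorem theorem1p2:
  assumes "(2::'k::field) \<noteq> 0"
  shows "\<exists>f. bij_betw f (minimal_iso_classes TYPE('k) 6)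
               ({..<26::nat} <+> ({..<4::nat} \<times> square_classes TYPE('k)))"
proof -
  define R where "R = {(d1, d2 :: (nat set \<Rightarrow> 'k) \<Rightarrow> (nat set \<Rightarrow> 'k)). minimal_alg 6 d1 \<and> minimal_alg 6 d2 \<and> dga_iso 6 d1 d2}"
  define S where "S = {(a :: 'k, b). a \<noteq> 0 \<and> b \<noteq> 0 \<and> (\<exists>c. c \<noteq> 0 \<and> a = c ^ 2 * b)}"
  have R: "equiv {d. minimal_alg 6 d} R" unfolding R_def by (rule equiv_dga_iso)
  have S: "equiv {x. x \<noteq> 0} S" unfolding S_def by (rule equiv_square_class)
  define X where "X = {..<26::nat} \<times> (UNIV :: 'k set)"
  define p where "p = (\<lambda>(k, \<epsilon> :: 'k). R `` {model k \<epsilon>})"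
  \<comment> \<open>A left label is a form without parameter or the degenerate member \<epsilon> = 0
    of a family, which makes 22 + 4 of them; a right label is a nonzero square class within one of
    the four families.\<close>
  define q where "q = (\<lambda>(k :: nat, \<epsilon> :: 'k). if 22 \<le> k \<and> \<epsilon> \<noteq> 0 then Inr (k - 22, S `` {\<epsilon>}) else Inl k)"
  have "p ` X = {d. minimal_alg 6 d} // R"
  proof
    show "p ` X \<subseteq> {d. minimal_alg 6 d} // R" using model(1) by (auto simp: p_def X_def intro!: quotientI)
    show "{d. minimal_alg 6 d} // R \<subseteq> p ` X"
    proof
      fix C assume "C \<in> {d. minimal_alg 6 d} // R"
      then obtain d where d: "minimal_alg 6 d" "C = R `` {d}" by (auto elim: quotientE)
      obtain k \<epsilon> where k: "k < 26" "dga_iso 6 (model k \<epsilon>) d" using minimal_alg_model[OF assms d(1)] by blast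
      then have "(model k \<epsilon>, d) \<in> R" using d(1) model(1) by (simp add: R_def)
      then have "p (k, \<epsilon>) = C" using equiv_class_eq[OF R] d(2) by (simp add: p_def)
      then show "C \<in> p ` X" using k(1) by (force simp: X_def)
    qed
  qed
  moreover have "q ` X = {..<26} <+> ({..<4} \<times> ({x. x \<noteq> 0} // S))"
  proof
    show "q ` X \<subseteq> {..<26} <+> ({..<4} \<times> ({x. x \<noteq> 0} // S))"
      by (auto simp: q_def X_def intro!: quotientI)
    show "{..<26} <+> ({..<4} \<times> ({x. x \<noteq> 0} // S)) \<subseteq> q ` X"
    proof
      fix c :: "nat + nat \<times> 'k set" assume "c \<in> {..<26} <+> ({..<4} \<times> ({x. x \<noteq> 0} // S))"
      then consider k where "c = Inl k" "k < 26" | j \<epsilon> where "c = Inr (j, S `` {\<epsilon>})" "j < 4" "\<epsilon> \<noteq> 0"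
        by (auto elim!: quotientE)
      then show "c \<in> q ` X"
      proof cases
        case 1
        then have "q (k, 0) = c" "(k, 0) \<in> X" by (simp_all add: q_def X_def)
        then show ?thesis by blast
      next
        case 2
        then have "q (22 + j, \<epsilon>) = c" "(22 + j, \<epsilon>) \<in> X" by (simp_all add: q_def X_def)
        then show ?thesis by blast
      qed
    qed
  qed
  moreover have "p x = p y \<longleftrightarrow> q x = q y" if "x \<in> X" "y \<in> X" for x y
  proof -
    obtain k \<epsilon> where x: "x = (k, \<epsilon>)" by (cases x)
    obtain k' \<epsilon>' where y: "y = (k', \<epsilon>')" by (cases y)
    note xy = x y
    have k: "k < 26" "k' < 26" using that by (simp_all add: xy X_def)
    let ?N = "\<lambda>k (\<epsilon> :: 'k). form_bracket (normal_form k \<epsilon>)"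
    note m = model(1)[OF k(1), of \<epsilon>] model(1)[OF k(2), of \<epsilon>']
    have "p x = p y \<longleftrightarrow> (model k \<epsilon>, model k' \<epsilon>') \<in> R"
      using eq_equiv_class_iff[OF R, of "model k \<epsilon>" "model k' \<epsilon>'"] m by (simp add: xy p_def)
    also have "\<dots> \<longleftrightarrow> lie_iso 6 (?N k \<epsilon>) (?N k' \<epsilon>')"
      using m model_iso_iff[OF k] by (simp add: R_def)
    also have "\<dots> \<longleftrightarrow> q x = q y"
    proof
      assume "lie_iso 6 (?N k \<epsilon>) (?N k' \<epsilon>')"
      from normal_form_unique[OF assms k this] have u: "k' = k" "22 \<le> k \<Longrightarrow> \<exists>t. t \<noteq> 0 \<and> \<epsilon>' = t ^ 2 * \<epsilon>" by auto
      show "q x = q y"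
      proof (cases "22 \<le> k \<and> \<epsilon> \<noteq> 0")
        case True
        then obtain t where t: "t \<noteq> 0" "\<epsilon>' = t ^ 2 * \<epsilon>" using u(2) by blast
        then have "(\<epsilon>', \<epsilon>) \<in> S" using True by (auto simp: S_def)
        then show ?thesis using equiv_class_eq[OF S] True t u(1) by (simp add: q_def xy)
      next
        case False
        then have "\<not> (22 \<le> k \<and> \<epsilon>' \<noteq> 0)" using u(2) by fastforce
        then show ?thesis using False u(1) by (simp add: q_def xy)
      qed
    next
      assume eq: "q x = q y"
      then have kk: "k' = k" by (auto simp: q_def xy split: if_splits)
      show "lie_iso 6 (?N k \<epsilon>) (?N k' \<epsilon>')"
      proof (cases "22 \<le> k \<and> \<epsilon> \<noteq> 0")
        case True
        then have e: "S `` {\<epsilon>} = S `` {\<epsilon>'}" "\<epsilon>' \<noteq> 0" using eq kk by (auto simp: q_def xy split: if_splits)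
        then have "(\<epsilon>', \<epsilon>) \<in> S" using eq_equiv_class_iff[OF S, of \<epsilon>' \<epsilon>] True by simp
        then obtain t where "t \<noteq> 0" "\<epsilon>' = t ^ 2 * \<epsilon>" by (auto simp: S_def)
        moreover have "k \<in> {22, 23, 24, 25}" using True k by auto
        ultimately show ?thesis using normal_form_scale kk by blast
      next
        case False
        then have "k < 22 \<or> \<epsilon> = \<epsilon>'" using eq kk by (auto simp: q_def xy split: if_splits)
        then have "normal_form k \<epsilon> = normal_form k' \<epsilon>'" using normal_form_const kk by blast
        then show ?thesis using lie_iso_refl by simp
      qed
    qed
    finally show ?thesis .
  qed
  ultimately show ?thesis
    unfolding minimal_iso_classes_def square_classes_def R_def[symmetric] S_def[symmetric]
    by (rule bij_betw_same_fibres)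
qed

end
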